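(* Let $q$ be a prime power, $n\ge2$ and $1\le d\le q$. Let $P\mathcal{U}_{n-1}\subset\mathbb{P}^n$ be a degenerate Hermitian variety of rank $n$ over $\mathbb{F}_{q^2}$. The functional code $C_d(P\mathcal{U}_{n-1})$ defined by forms of degree $d$ on $P\mathcal{U}_{n-1}$ is an $[m,k,\mathsf{d}]_{q^2}$ code, that is, a linear code over $\mathbb{F}_{q^2}$ with length $$m=|P\mathcal{U}_{n-1}(\mathbb{F}_{q^2})|=1+q^2\,\frac{(q^{n-1}-(-1)^{n-1})(q^n-(-1)^n)}{q^2-1},$$ dimension $$k=\binom{n+d}{d},$$ and minimum distance $\mathsf{d}$ satisfying $$\mathsf{d}\ge |P\mathcal{U}_{n-1}(\mathbb{F}_{q^2})|-\max\left\{|\mathcal{U}_{n-1}(\mathbb{F}_{q^2})|+(d-1)(q+1)q^{2n-4},\ 1+q^2M_{n-1}(d)\right\}.$$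
   Context: $\mathbb{P}^n$ is projective $n$-space over $\overline{\mathbb{F}}_q$, and $X(\mathbb{F}_{q^2})$ is the set of $\mathbb{F}_{q^2}$-rational points of $X$. The Hermitian variety of a nonzero $(n+1)\times(n+1)$ matrix $H=(h_{ij})$ over $\mathbb{F}_{q^2}$ with $h_{ij}=h_{ji}^q$ is the zero set of $\sum_{i,j}h_{ij}x_ix_j^q$ in $\mathbb{P}^n$; its rank is that of $H$, and it is non-degenerate if the rank is $n+1$ (notation $\mathcal{U}_n$, unique up to $\mathbb{F}_{q^2}$-projective equivalence). A Hermitian variety of rank $n$ in $\mathbb{P}^n$ is, up to an $\mathbb{F}_{q^2}$-linear change of coordinates, $V(x_0^{q+1}+\dots+x_{n-1}^{q+1})$, a cone with vertex an $\mathbb{F}_{q^2}$-point $P$ over a non-degenerate Hermitian variety $\mathcal{U}_{n-1}\subset\mathbb{P}^{n-1}$; it is denoted $P\mathcal{U}_{n-1}$. $M_{n-1}(d):=\max_{V(G)}|(\mathcal{U}_{n-1}\cap V(G))(\mathbb{F}_{q^2})|$, over all zero sets $V(G)$ in $\mathbb{P}^{n-1}$ of nonzero homogeneous polynomials $G$ of degree $d$ over $\mathbb{F}_{q^2}$. Functional code: let $\mathcal{X}\subset\mathbb{P}^n$ be a variety over $\mathbb{F}_{q^2}$, and let $\mathsf{P}_1,\dots,\mathsf{P}_N$ be an ordered list of its $\mathbb{F}_{q^2}$-points, each represented by coordinates whose last nonzero entry is $1$. With $\mathbb{F}_{q^2}[x_0,\dots,x_n]_d$ the space of homogeneous polynomials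 of degree $d$ together with $0$, the code $C_d(\mathcal{X})\subseteq\mathbb{F}_{q^2}^N$ is the image of the linear map $F\mapsto(F(\mathsf{P}_1),\dots,F(\mathsf{P}_N))$. Its length is $N$, its dimension is its dimension as an $\mathbb{F}_{q^2}$-vector space, and its minimum distance is the minimum number of nonzero coordinates of a nonzero codeword. *)

theory Defs
  imports
    "HOL-Library.Poly_Mapping"
    "HOL-Algebra.Algebraic_Closure_Type"
    "HOL-Number_Theory.Prime_Powers"
    "Jordan_Normal_Form.DL_Rank"
begin

text \<open>Polynomials in the variables \<open>x\<^sub>0, x\<^sub>1, \<dots>\<close>: a monomial is a finitely supported exponent
  vector, a polynomial is a finitely supported family of coefficients.\<close>

type_synonym 'a mpoly = "(nat \<Rightarrow>\<^sub>0 nat) \<Rightarrow>\<^sub>0 'a"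

text \<open>Homogeneous polynomials of degree \<open>d\<close> in \<open>x\<^sub>0, \<dots>, x\<^sub>n\<close>, together with \<open>0\<close>.\<close>

definition forms :: "nat \<Rightarrow> nat \<Rightarrow> 'a::zero mpoly set" where
  "forms n d = {F. \<forall>m \<in> Poly_Mapping.keys F.
     Poly_Mapping.keys m \<subseteq> {..n} \<and> (\<Sum>i\<in>Poly_Mapping.keys m. Poly_Mapping.lookup m i) = d}"

definition eval_form :: "'k::comm_semiring_1 mpoly \<Rightarrow> 'k vec \<Rightarrow> 'k" where
  "eval_form F x = (\<Sum>m\<in>Poly_Mapping.keys F. Poly_Mapping.lookup F m *
     (\<Prod>i\<in>Poly_Mapping.keys m. (x $ i) ^ Poly_Mapping.lookup m i))"

text \<open>A point of projective \<open>n\<close>-space over \<open>'k\<close> is identified with its unique coordinate vector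
  \<open>(x\<^sub>0, \<dots>, x\<^sub>n)\<close> whose last nonzero entry is \<open>1\<close>.\<close>

definition proj_space :: "nat \<Rightarrow> 'k::field vec set" where
  "proj_space n = {x \<in> carrier_vec (n + 1).
     \<exists>i\<le>n. x $ i = 1 \<and> (\<forall>j. i < j \<and> j \<le> n \<longrightarrow> x $ j = 0)}"

text \<open>Varieties over \<open>'a\<close> live in projective space over the algebraic closure of \<open>'a\<close>. A point
  of that space is \<open>'a\<close>-rational iff its normalized coordinates all come from \<open>'a\<close>; the rational
  points are returned as coordinate vectors over \<open>'a\<close> itself.\<close>

definition zero_set :: "nat \<Rightarrow> 'a::field mpoly \<Rightarrow> 'a alg_closure vec set" where
  "zero_set n G = {x \<in> proj_space n. eval_form (Poly_Mapping.map to_ac G) x = 0}"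

definition rational_points :: "'a::field alg_closure vec set \<Rightarrow> 'a vec set" where
  "rational_points S = {x. map_vec to_ac x \<in> S}"

definition hermitian_matrix :: "nat \<Rightarrow> nat \<Rightarrow> 'a::field mat \<Rightarrow> bool" where
  "hermitian_matrix q n H \<longleftrightarrow> H \<in> carrier_mat (n + 1) (n + 1) \<and> H \<noteq> 0\<^sub>m (n + 1) (n + 1) \<and>
     (\<forall>i\<le>n. \<forall>j\<le>n. H $$ (i, j) = (H $$ (j, i)) ^ q)"

definition hermitian_variety :: "nat \<Rightarrow> nat \<Rightarrow> 'a::field mat \<Rightarrow> 'a alg_closure vec set" where
  "hermitian_variety q n H = {x \<in> proj_space n.
     (\<Sum>i\<le>n. \<Sum>j\<le>n. to_ac (H $$ (i, j)) * x $ i * (x $ j) ^ q) = 0}"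

text \<open>The largest number of rational points in which \<open>S\<close>, a variety in projective \<open>n\<close>-space, meets
  a hypersurface of degree \<open>d\<close> defined over \<open>'a\<close>. The number \<open>M\<^sub>n(d)\<close> is obtained when \<open>X\<close> is a
  non-degenerate Hermitian variety.\<close>

definition max_section :: "nat \<Rightarrow> nat \<Rightarrow> 'a::field alg_closure vec set \<Rightarrow> nat" where
  "max_section n d S =
     Max {card (rational_points (S \<inter> zero_set n G)) | G. G \<in> forms n d \<and> G \<noteq> 0}"

text \<open>The functional code of degree \<open>d\<close> on the points \<open>Ps\<close> of projective \<open>n\<close>-space.\<close>

definition functional_code :: "nat \<Rightarrow> nat \<Rightarrow> 'a::field vec list \<Rightarrow> 'a vec set" where
  "functional_code n d Ps =
     (\<lambda>F. vec (length Ps) (\<lambda>i. eval_form F (Ps ! i))) ` forms n d"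

definition linear_code :: "nat \<Rightarrow> 'a::field vec set \<Rightarrow> bool" where
  "linear_code N C \<longleftrightarrow> VectorSpace.subspace class_ring C (module_vec TYPE('a) N)"

definition code_dim :: "nat \<Rightarrow> 'a::field vec set \<Rightarrow> nat" where
  "code_dim N C = vectorspace.dim class_ring ((module_vec TYPE('a) N)\<lparr>carrier := C\<rparr>)"

definition hamming_weight :: "'a::zero vec \<Rightarrow> nat" where
  "hamming_weight c = card {i. i < dim_vec c \<and> c $ i \<noteq> 0}"

definition min_distance :: "'a::zero vec set \<Rightarrow> nat" where
  "min_distance C = Min {hamming_weight c | c. c \<in> C \<and> c \<noteq> 0\<^sub>v (dim_vec c)}"

end

(*
  Let K be the field with q^2 elements. In suitable coordinates the cone is the set of all (x, t)
  with x isotropic for the non-degenerate form on K^n. A form F of degree d restricted to the line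
  over x is a polynomial in t; let e be its generic degree, so that its leading coefficient is a form
  G of degree d - e in x. Over the points with G(x) = 0 the whole line may be contained in V(F), over
  the others there are at most e zeros. If e = 0, then F is a cone over G, which gives 1 + q^2 M. If
  e = d, then G is constant and there are at most d u zeros. If 0 < e < d and n > 2, a Bezout type
  bound for the number of isotropic zeros of G gives the first bound; for n = 2 the form G has at
  most d - e zeros on the projective line, while M >= d.

  The Bezout bound is elementary. A form of degree at most q that does not vanish identically is
  nonzero at some isotropic Q. Take an anisotropic u orthogonal to Q. On each translate
  y Q + x u + w of the plane spanned by Q and u the two equations rewrite y^d and x^(q+1) in terms of
  lower monomials, so at most d (q + 1) monomials span all functions on their common zero set.

  All counts are made for vectors; a set of vectors closed under scaling has
  1 + (q^2 - 1) N elements if it contains N projective points.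
*)
theory Submission
  imports Defs
begin

section \<open>Finite fields of square order\<close>

text \<open>The hypersurface may meet the isotropic vectors in a reducible or singular set, so
  intersection theory is replaced by counting. For isotropic Q the Hermitian equation on a plane has
  no y^(q+1), so the hypersurface, with leading term f(Q) y^d, controls y and the Hermitian equation
  controls x. Averaging d (q + 1) zeros per plane over all q^(2n) translation vectors and dividing
  by the q^4 points of a plane gives d R with R = (q + 1) q^(2n-4). The same R bounds the number N
  of base points. A line over a zero of G costs q^2 and any other line e, in total 1 + e (N - a) +
  q^2 a for a projective zeros; for 0 < e < d, the estimate 1 + (q^2 - 1) a <= (d - e) R makes this
  at most e N + (d - e) R <= N + (d - 1) R. For n = 2 the orthogonal complement of an isotropic
  vector is its own span, so no anisotropic partner of Q exists and another argument must be found.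
  The bound d <= q makes q + 1 isotropic points on a line too many for a form not vanishing on that
  line. Dimensions and ranks are read off from cardinalities.\<close>

text \<open>Any nonzero coefficient will do, not only the leading one. Later uses know the constant
  term, the generic leading coefficient, or some coefficient in between.\<close>

lemma card_power_sum_roots_le:
  fixes c :: "nat \<Rightarrow> 'a::idom"
  assumes "e \<le> d" "c e \<noteq> 0"
  shows "card {t. (\<Sum>i\<le>d. c i * t ^ i) = 0} \<le> d"
proof -
  let ?p = "\<Sum>i\<le>d. monom (c i) i"
  have co: "coeff ?p j = (if j \<le> d then c j else 0)" for j
    by (simp add: coeff_sum)
  have deg: "Polynomial.degree ?p \<le> d"
    by (rule degree_le) (simp add: co)
  have "?p \<noteq> 0"
  proof
    assume "?p = 0"
    then have "coeff ?p e = 0" by simp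
    then show False using assms by (simp add: co)
  qed
  moreover have "poly ?p t = (\<Sum>i\<le>d. c i * t ^ i)" for t
    by (simp add: poly_sum poly_monom)
  ultimately show ?thesis
    using card_poly_roots_bound[of ?p] deg by auto
qed

text \<open>Multiplication by a nonzero \<open>x\<close> permutes the nonzero elements; comparing
  their products gives \<open>x ^ card ?A = 1\<close>.\<close>

lemma power_card_UNIV_eq_self:
  fixes x :: "'a::{field,finite}"
  shows "x ^ card (UNIV :: 'a set) = x"
proof (cases "x = 0")
  case True
  then show ?thesis by (simp add: card_gt_0_iff power_0_left)
next
  case False
  let ?A = "UNIV - {0 :: 'a}"
  have "(\<Prod>y\<in>?A. x * y) = \<Prod>?A"
    by (rule prod.reindex_bij_witness[of _ "\<lambda>y. y / x" "\<lambda>y. x * y"]) (use False in auto)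
  moreover have "(\<Prod>y\<in>?A. x * y) = x ^ card ?A * \<Prod>?A"
    by (simp only: prod.distrib prod_constant)
  moreover have "\<Prod>?A \<noteq> 0" by simp
  ultimately have "x ^ card ?A = 1" by (metis mult_cancel_right2)
  moreover have "card (UNIV :: 'a set) = Suc (card ?A)"
    by (rule card.remove) auto
  ultimately show ?thesis by (simp only: power_Suc mult_1_right)
qed

text \<open>Translation by 1 permutes the field, so adding 1 to every summand leaves the sum of all
  elements unchanged.\<close>

lemma CHAR_dvd_card_UNIV: "CHAR('a::{field,finite}) dvd card (UNIV :: 'a set)"
proof -
  have "bij_betw (\<lambda>x::'a. x + 1) UNIV UNIV"
    by (rule bij_betwI[where g = "\<lambda>x. x - 1"]) auto
  then have "(\<Sum>x\<in>UNIV. x + 1 :: 'a) = (\<Sum>x\<in>UNIV. x)"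
    by (rule sum.reindex_bij_betw)
  then show ?thesis
    by (simp add: sum.distrib of_nat_eq_0_iff_char_dvd)
qed

locale quadratic_field =
  fixes q :: nat and ty :: "'a::{field,finite} itself"
  assumes primepow_q: "primepow q" and card_field: "card (UNIV :: 'a set) = q\<^sup>2"
begin

lemma q_ge_2: "q \<ge> 2"
  using primepow_gt_Suc_0[OF primepow_q] by simp

lemma q_sq_gt: "q\<^sup>2 > q" "q\<^sup>2 > 1"
proof -
  have "q * 2 \<le> q * q" using q_ge_2 by (rule mult_le_mono2)
  then show "q\<^sup>2 > q" "q\<^sup>2 > 1"
    using q_ge_2 by (auto simp only: power2_eq_square)
qed

lemma frobenius_twice [simp]: "((x :: 'a) ^ q) ^ q = x"
  using power_card_UNIV_eq_self[of x] by (simp add: card_field power2_eq_square power_mult)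

lemma q_eq_CHAR_power: obtains k where "prime CHAR('a)" "q = CHAR('a) ^ k"
proof -
  obtain p k where pk: "prime p" "q = p ^ k"
    using primepow_q by (auto simp: primepow_def)
  have "CHAR('a) > 0"
    by (rule finite_imp_CHAR_pos) simp
  then have pr: "prime CHAR('a)"
    by (rule prime_CHAR_semidom)
  have "CHAR('a) dvd p ^ (k * 2)"
    using CHAR_dvd_card_UNIV[where ?'a = 'a] by (simp add: card_field pk power_mult)
  then have "CHAR('a) dvd p"
    using pr prime_dvd_power by blast
  then have "CHAR('a) = p"
    using pr pk(1) primes_dvd_imp_eq by blast
  then show ?thesis using that pr pk by blast
qed

lemma frobenius_add: "(x + y :: 'a) ^ q = x ^ q + y ^ q"
proof -
  obtain k where k: "prime CHAR('a)" "q = CHAR('a) ^ k"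
    by (rule q_eq_CHAR_power)
  show ?thesis
    by (rule freshmans_dream'[OF k])
qed

lemma frobenius_sum: "(\<Sum>i\<in>I. f i :: 'a) ^ q = (\<Sum>i\<in>I. f i ^ q)"
proof -
  obtain k where k: "prime CHAR('a)" "q = CHAR('a) ^ k"
    by (rule q_eq_CHAR_power)
  show ?thesis
    by (rule freshmans_dream_sum'[OF k])
qed

lemma frobenius_minus: "(- x :: 'a) ^ q = - (x ^ q)"
proof -
  have "(x + - x) ^ q = 0" using q_ge_2 by (simp add: power_0_left)
  then show ?thesis by (simp only: frobenius_add eq_neg_iff_add_eq_0 add.commute)
qed

lemma norm_fixed: "((x :: 'a) ^ (q + 1)) ^ q = x ^ (q + 1)"
  by (simp add: power_mult_distrib mult.commute)

text \<open>The norm maps the \<open>q\<^sup>2 - 1\<close> nonzero elements into the at most \<open>q - 1\<close> nonzero fixed points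
  of the Frobenius map with fibres of size at most \<open>q + 1\<close>, so all these bounds are attained.\<close>

lemma card_norm_fibre:
  assumes "(c :: 'a) \<noteq> 0" "c ^ q = c"
  shows "card {t. t ^ (q + 1) = c} = q + 1"
proof (rule ccontr)
  assume ne: "card {t. t ^ (q + 1) = c} \<noteq> q + 1"
  let ?F = "\<lambda>c::'a. {t. t ^ (q + 1) = c}" and ?S = "{c::'a. c \<noteq> 0 \<and> c ^ q = c}"
  have fib: "card (?F c) \<le> q + 1" for c
  proof -
    have "?F c = {t. poly (monom 1 (q + 1) - [:c:]) t = 0}"
      by (auto simp: poly_monom)
    moreover have "Polynomial.degree (monom 1 (q + 1) - [:c:]) \<le> q + 1"
      by (intro degree_diff_le) (auto simp: degree_monom_le)
    moreover have "monom 1 (q + 1) - [:c:] \<noteq> 0"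
    proof
      assume "monom 1 (q + 1) - [:c:] = 0"
      then have "coeff (monom 1 (q + 1) - [:c:]) (q + 1) = 0" by simp
      then show False by simp
    qed
    ultimately show ?thesis
      using card_poly_roots_bound[of "monom 1 (q + 1) - [:c:]"] by simp
  qed
  have S: "card ?S \<le> q - 1"
  proof -
    have q: "q = Suc (q - 1)" using q_ge_2 by simp
    have "?S \<subseteq> {c. poly (monom 1 (q - 1) - 1) c = 0}"
    proof safe
      fix c :: 'a assume "c \<noteq> 0" "c ^ q = c"
      then have "c * c ^ (q - 1) = c * 1"
        by (metis mult.right_neutral power_Suc q)
      then show "poly (monom 1 (q - 1) - 1) c = 0"
        using \<open>c \<noteq> 0\<close> by (simp add: poly_monom)
    qed
    then have "card ?S \<le> card {c. poly (monom 1 (q - 1) - 1 :: 'a poly) c = 0}"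
      by (intro card_mono) auto
    also have "\<dots> \<le> Polynomial.degree (monom 1 (q - 1) - 1 :: 'a poly)"
    proof (rule card_poly_roots_bound)
      have "coeff (monom 1 (q - 1) - 1 :: 'a poly) (q - 1) = 1"
        using q_ge_2 by (simp add: coeff_1)
      then show "monom 1 (q - 1) - 1 \<noteq> (0 :: 'a poly)"
        by (metis coeff_0 zero_neq_one)
    qed
    also have "\<dots> \<le> q - 1"
      by (intro degree_diff_le) (auto simp: degree_monom_le)
    finally show ?thesis .
  qed
  have fin: "finite ?S" "finite (?F c)" for c by simp_all
  have "UNIV - {0} = (\<Union>c\<in>?S. ?F c)"
  proof (intro equalityI subsetI)
    fix t :: 'a assume "t \<in> UNIV - {0}"
    moreover have "(t ^ (q + 1)) ^ q = t ^ (q + 1)" by (rule norm_fixed)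
    ultimately show "t \<in> (\<Union>c\<in>?S. ?F c)" by simp
  qed auto
  then have "card (UNIV - {0 :: 'a}) = card (\<Union>c\<in>?S. ?F c)"
    by (rule arg_cong)
  also have "\<dots> = (\<Sum>c\<in>?S. card (?F c))"
    by (rule card_UN_disjoint) (use fin in \<open>blast+\<close>)
  also have "\<dots> < (\<Sum>c\<in>?S. q + 1)"
  proof (rule sum_strict_mono_ex1[OF fin(1)])
    show "\<forall>c\<in>?S. card (?F c) \<le> q + 1" using fib by blast
    have "card (?F c) < q + 1" using fib ne by (rule le_neq_trans)
    then show "\<exists>c\<in>?S. card (?F c) < q + 1" using assms by blast
  qed
  also have "\<dots> = card ?S * (q + 1)"
    by (simp only: sum_constant of_nat_id)
  also have "\<dots> \<le> (q - 1) * (q + 1)"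
    using S by (rule mult_le_mono1)
  also have "\<dots> = q\<^sup>2 - 1"
    by (simp add: power2_eq_square algebra_simps)
  finally show False
    by (simp add: card_Diff_subset card_field)
qed

lemma norm_surj:
  assumes "(c :: 'a) ^ q = c" "c \<noteq> 0"
  obtains t where "t \<noteq> 0" "t ^ (q + 1) = c"
proof -
  have "{t. t ^ (q + 1) = c} \<noteq> {}"
    using card_norm_fibre[OF assms(2,1)] by (metis add_is_0 card.empty zero_neq_one)
  then show ?thesis using that assms(2) by auto
qed

text \<open>The trace polynomial X + X^q has degree q, fewer than the q^2 field elements. Counting
  also covers characteristic 2, where t = 1 has trace 0.\<close>

lemma trace_nonzero: obtains t :: 'a where "t + t ^ q \<noteq> 0"
proof -
  have "card {t::'a. (\<Sum>i\<le>q. (if i = 1 \<or> i = q then 1 else 0) * t ^ i) = 0} \<le> q"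
    by (rule card_power_sum_roots_le[of q]) auto
  also have "\<dots> < card (UNIV :: 'a set)"
    using q_sq_gt by (simp add: card_field)
  finally obtain t :: 'a where "(\<Sum>i\<le>q. (if i = 1 \<or> i = q then 1 else 0) * t ^ i) \<noteq> 0"
    by (metis (mono_tags, lifting) UNIV_eq_I less_irrefl mem_Collect_eq)
  moreover have "(\<Sum>i\<le>q. (if i = 1 \<or> i = q then 1 else 0) * t ^ i) = (\<Sum>i\<in>{1, q}. t ^ i)"
    using q_ge_2 by (intro sum.mono_neutral_cong_right) auto
  ultimately show ?thesis
    using that[of t] q_ge_2 by simp
qed

end

section \<open>Homogeneous polynomial functions\<close>

text \<open>Polynomial functions replace polynomials: below degree \<open>|K|\<close> nothing is lost, and linear
  substitutions need no expansion of monomials.\<close>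

inductive homogeneous :: "nat \<Rightarrow> nat \<Rightarrow> ('a::comm_ring_1 vec \<Rightarrow> 'a) \<Rightarrow> bool" for N where
  const: "homogeneous N 0 (\<lambda>_. c)"
| zero: "homogeneous N d (\<lambda>_. 0)"
| add: "homogeneous N d f \<Longrightarrow> homogeneous N d g \<Longrightarrow> homogeneous N d (\<lambda>x. f x + g x)"
| linear_mult: "a \<in> carrier_vec N \<Longrightarrow> homogeneous N d f \<Longrightarrow> homogeneous N (Suc d) (\<lambda>x. (a \<bullet> x) * f x)"
| cong: "homogeneous N d f \<Longrightarrow> (\<And>x. x \<in> carrier_vec N \<Longrightarrow> g x = f x) \<Longrightarrow> homogeneous N d g"

lemma homogeneous_linear: "a \<in> carrier_vec N \<Longrightarrow> homogeneous N (Suc 0) (\<lambda>x. a \<bullet> x)"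
  using homogeneous.linear_mult[OF _ homogeneous.const, of a N 1] by simp

lemma homogeneous_coord: "i < N \<Longrightarrow> homogeneous N (Suc 0) (\<lambda>x. x $ i)"
  by (rule homogeneous.cong[OF homogeneous_linear[of "unit_vec N i"]]) auto

lemma homogeneous_mult:
  assumes "homogeneous N d f" "homogeneous N e g"
  shows "homogeneous N (d + e) (\<lambda>x. f x * g x)"
  using assms
proof (induction d f rule: homogeneous.induct)
  case (const c)
  from const show ?case
  proof (induction e g rule: homogeneous.induct)
    case (const b)
    then show ?case using homogeneous.const[of N "c * b"] by simp
  next
    case (zero d)
    then show ?case using homogeneous.zero[of N d] by simp
  next
    case (add d f g)
    show ?case using homogeneous.add[OF add.IH] by (simp add: algebra_simps)
  next
    case (linear_mult a d f)
    show ?case using homogeneous.linear_mult[OF linear_mult(1) linear_mult.IH]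
      by (simp add: algebra_simps)
  next
    case (cong d f g)
    show ?case by (rule homogeneous.cong[OF cong.IH]) (simp add: cong)
  qed
next
  case (zero d)
  then show ?case using homogeneous.zero[of N "d + e"] by simp
next
  case (add d f g')
  show ?case using homogeneous.add[OF add.IH(1,2)] add.prems by (simp add: algebra_simps)
next
  case (linear_mult a d f)
  show ?case using homogeneous.linear_mult[OF linear_mult(1) linear_mult.IH] linear_mult.prems
    by (simp add: algebra_simps)
next
  case (cong d f g')
  show ?case by (rule homogeneous.cong[OF cong.IH]) (simp_all add: cong)
qed

lemma homogeneous_smult: "homogeneous N d f \<Longrightarrow> homogeneous N d (\<lambda>x. c * f x)"
  using homogeneous_mult[OF homogeneous.const[of N c], of d f] by simp

lemma homogeneous_sum:
  "(\<And>i. i \<in> I \<Longrightarrow> homogeneous N d (f i)) \<Longrightarrow> homogeneous N d (\<lambda>x. \<Sum>i\<in>I. f i x)"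
  by (induction I rule: infinite_finite_induct)
    (auto intro: homogeneous.zero homogeneous.add)

lemma homogeneous_power: "homogeneous N d f \<Longrightarrow> homogeneous N (d * k) (\<lambda>x. f x ^ k)"
  by (induction k) (auto intro: homogeneous_mult homogeneous.const)

lemma homogeneous_prod:
  "finite I \<Longrightarrow> (\<And>i. i \<in> I \<Longrightarrow> homogeneous N (d i) (f i))
    \<Longrightarrow> homogeneous N (\<Sum>i\<in>I. d i) (\<lambda>x. \<Prod>i\<in>I. f i x)"
  by (induction I rule: finite_induct) (auto intro: homogeneous_mult homogeneous.const)

text \<open>With A and p describing the cone, this separates the parameter t on a line through the
  vertex from the base point x. With A the identity, it restricts f to an affine line.\<close>

lemma homogeneous_expand:
  fixes f :: "'a::field vec \<Rightarrow> 'a"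
  assumes "homogeneous M d f" "A \<in> carrier_mat M N" "p \<in> carrier_vec M"
  shows "\<exists>c. (\<forall>i\<le>d. homogeneous N (d - i) (c i)) \<and>
    (\<forall>x\<in>carrier_vec N. \<forall>t. f (A *\<^sub>v x + t \<cdot>\<^sub>v p) = (\<Sum>i\<le>d. c i x * t ^ i))"
  using assms(1)
proof (induction d f rule: homogeneous.induct)
  case (const b)
  show ?case by (rule exI[of _ "\<lambda>_ _. b"]) (auto intro: homogeneous.const)
next
  case (zero d)
  show ?case by (rule exI[of _ "\<lambda>_ _. 0"]) (auto intro: homogeneous.zero)
next
  case (add d f g)
  then obtain c c' where c: "\<forall>i\<le>d. homogeneous N (d - i) (c i)" "\<forall>i\<le>d. homogeneous N (d - i) (c' i)"
    "\<forall>x\<in>carrier_vec N. \<forall>t. f (A *\<^sub>v x + t \<cdot>\<^sub>v p) = (\<Sum>i\<le>d. c i x * t ^ i)"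
    "\<forall>x\<in>carrier_vec N. \<forall>t. g (A *\<^sub>v x + t \<cdot>\<^sub>v p) = (\<Sum>i\<le>d. c' i x * t ^ i)"
    by blast
  then show ?case
    by (intro exI[of _ "\<lambda>i x. c i x + c' i x"])
      (auto intro: homogeneous.add simp: sum.distrib algebra_simps)
next
  case (linear_mult a d f)
  then obtain c where c: "\<forall>i\<le>d. homogeneous N (d - i) (c i)"
    "\<forall>x\<in>carrier_vec N. \<forall>t. f (A *\<^sub>v x + t \<cdot>\<^sub>v p) = (\<Sum>i\<le>d. c i x * t ^ i)"
    by blast
  \<comment> \<open>The transpose moves A to the coefficient vector, so a linear form in A x becomes
    the linear form b in x.\<close>
  define b where "b = A\<^sup>T *\<^sub>v a"
  have b: "b \<in> carrier_vec N"
    using assms linear_mult(1) by (simp add: b_def)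
  have ab: "a \<bullet> (A *\<^sub>v x + t \<cdot>\<^sub>v p) = b \<bullet> x + t * (a \<bullet> p)" if "x \<in> carrier_vec N" for x t
  proof -
    have "a \<bullet> (A *\<^sub>v x) = b \<bullet> x"
      unfolding b_def by (rule transpose_vec_mult_scalar[OF assms(2) that linear_mult(1), symmetric])
    moreover have "A *\<^sub>v x \<in> carrier_vec M" using assms that by simp
    ultimately show ?thesis
      using assms(3) linear_mult(1) by (simp add: scalar_prod_add_distrib[of _ M])
  qed
  \<comment> \<open>Product of b x + t (a p) with the polynomial of f: the second summand is the
    first with its index shifted by one. The guards are needed because \<open>c i\<close> is
    specified only for i <= d.\<close>
  let ?c = "\<lambda>i (x::'a vec). (if i \<le> d then (b \<bullet> x) * c i x else 0)
    + (if i = 0 then 0 else (a \<bullet> p) * c (i - 1) x)"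
  show ?case
  proof (intro exI[of _ ?c] conjI allI impI ballI)
    fix i assume i: "i \<le> Suc d"
    have "homogeneous N (Suc d - i) (\<lambda>x. if i \<le> d then (b \<bullet> x) * c i x else 0)"
    proof (cases "i \<le> d")
      case True
      then show ?thesis
        using homogeneous.linear_mult[OF b, of "d - i" "c i"] c(1) by (simp add: Suc_diff_le)
    qed (auto intro: homogeneous.zero)
    moreover have "homogeneous N (Suc d - i) (\<lambda>x. if i = 0 then 0 else (a \<bullet> p) * c (i - 1) x)"
    proof (cases i)
      case (Suc j)
      then show ?thesis
        using homogeneous_smult[of N "d - j" "c j"] c(1) i by simp
    qed (auto intro: homogeneous.zero)
    ultimately show "homogeneous N (Suc d - i) (?c i)"
      by (rule homogeneous.add)
  next
    fix x :: "'a vec" and t assume x: "x \<in> carrier_vec N"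
    have "(\<Sum>i\<le>Suc d. ?c i x * t ^ i) =
        (\<Sum>i\<le>Suc d. (if i \<le> d then (b \<bullet> x) * c i x else 0) * t ^ i) +
        (\<Sum>i\<le>Suc d. (if i = 0 then 0 else (a \<bullet> p) * c (i - 1) x) * t ^ i)"
      by (simp only: distrib_right sum.distrib)
    also have "(\<Sum>i\<le>Suc d. (if i \<le> d then (b \<bullet> x) * c i x else 0) * t ^ i) =
        (b \<bullet> x) * (\<Sum>i\<le>d. c i x * t ^ i)"
      by (simp add: sum_distrib_left mult.assoc)
    also have "(\<Sum>i\<le>Suc d. (if i = 0 then 0 else (a \<bullet> p) * c (i - 1) x) * t ^ i) =
        t * (a \<bullet> p) * (\<Sum>i\<le>d. c i x * t ^ i)"
      by (simp add: sum.atMost_Suc_shift sum_distrib_left mult_ac del: sum.atMost_Suc)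
    finally show "a \<bullet> (A *\<^sub>v x + t \<cdot>\<^sub>v p) * f (A *\<^sub>v x + t \<cdot>\<^sub>v p) = (\<Sum>i\<le>Suc d. ?c i x * t ^ i)"
      using c(2) x by (simp only: ab[OF x]) (simp add: distrib_right)
  qed
next
  case (cong d f g)
  then obtain c where c: "\<forall>i\<le>d. homogeneous N (d - i) (c i)"
    "\<forall>x\<in>carrier_vec N. \<forall>t. f (A *\<^sub>v x + t \<cdot>\<^sub>v p) = (\<Sum>i\<le>d. c i x * t ^ i)"
    by blast
  have "A *\<^sub>v x + t \<cdot>\<^sub>v p \<in> carrier_vec M" if "x \<in> carrier_vec N" for x t
    using assms that by simp
  with c cong(2) show ?case by (intro exI[of _ c]) simp
qed

lemma homogeneous_scale:
  assumes "homogeneous N d f" "x \<in> carrier_vec N"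
  shows "f (t \<cdot>\<^sub>v x) = t ^ d * f x"
  using assms(1)
  by (induction d f rule: homogeneous.induct) (use assms(2) in \<open>auto simp: algebra_simps\<close>)

text \<open>Since the constant coefficient is \<open>f v\<close>, the polynomial on the line is
  nonzero as soon as f does not vanish at v.\<close>

lemma homogeneous_line:
  fixes f :: "'a::field vec \<Rightarrow> 'a"
  assumes "homogeneous N d f" "v \<in> carrier_vec N" "w \<in> carrier_vec N"
  obtains c where "c 0 = f v" "\<And>t. f (v + t \<cdot>\<^sub>v w) = (\<Sum>i\<le>d. c i * t ^ i)"
proof -
  obtain c where c: "\<forall>x\<in>carrier_vec N. \<forall>t. f (1\<^sub>m N *\<^sub>v x + t \<cdot>\<^sub>v w) = (\<Sum>i\<le>d. c i x * t ^ i)"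
    using homogeneous_expand[OF assms(1) one_carrier_mat assms(3)] by auto
  then have e: "f (v + t \<cdot>\<^sub>v w) = (\<Sum>i\<le>d. c i v * t ^ i)" for t
    using assms(2) by (metis one_mult_mat_vec)
  moreover have "c 0 v = f v"
  proof -
    have "f v = f (v + 0 \<cdot>\<^sub>v w)"
      using assms by (intro arg_cong[of _ _ f] eq_vecI) auto
    also have "\<dots> = (\<Sum>i\<le>d. c i v * 0 ^ i)" by (rule e)
    also have "\<dots> = c 0 v"
      by (simp add: power_0_left sum.delta if_distrib[of "\<lambda>z. _ * z"] cong: if_cong)
    finally show ?thesis by simp
  qed
  ultimately show ?thesis using that[of "\<lambda>i. c i v"] by simp
qed

section \<open>Forms and their evaluation\<close>

lemma eval_form_superset:
  assumes "finite A" "Poly_Mapping.keys F \<subseteq> A"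
  shows "eval_form F x = (\<Sum>m\<in>A. Poly_Mapping.lookup F m *
     (\<Prod>i\<in>Poly_Mapping.keys m. (x $ i) ^ Poly_Mapping.lookup m i))"
  unfolding eval_form_def
  using assms by (intro sum.mono_neutral_left) (auto simp: in_keys_iff)

lemma eval_form_add: "eval_form (F + G) x = eval_form F x + eval_form G x"
proof -
  let ?A = "Poly_Mapping.keys F \<union> Poly_Mapping.keys G"
  have "Poly_Mapping.keys (F + G) \<subseteq> ?A" by (rule Poly_Mapping.keys_add)
  then show ?thesis
    by (simp add: eval_form_superset[of ?A] lookup_add sum.distrib distrib_right)
qed

lemma eval_form_zero [simp]: "eval_form 0 x = 0"
  by (simp add: eval_form_def)

lemma eval_form_single: "eval_form (Poly_Mapping.single m c) x =
    c * (\<Prod>i\<in>Poly_Mapping.keys m. (x $ i) ^ Poly_Mapping.lookup m i)"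
  by (subst eval_form_superset[of "{m}"]) auto

lemma eval_form_sum: "eval_form (\<Sum>i\<in>I. F i) x = (\<Sum>i\<in>I. eval_form (F i) x)"
  by (induction I rule: infinite_finite_induct) (auto simp: eval_form_add)

lemma eval_form_diff:
  fixes F G :: "'k::comm_ring_1 mpoly"
  shows "eval_form (F - G) x = eval_form F x - eval_form G x"
  using eval_form_add[of "F - G" G x] by simp

definition exponents :: "nat \<Rightarrow> nat \<Rightarrow> (nat \<Rightarrow>\<^sub>0 nat) set" where
  "exponents n d = {m. Poly_Mapping.keys m \<subseteq> {..n} \<and>
     (\<Sum>i\<in>Poly_Mapping.keys m. Poly_Mapping.lookup m i) = d}"

lemma forms_eq: "forms n d = {F. Poly_Mapping.keys F \<subseteq> exponents n d}"
  by (auto simp: forms_def exponents_def)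

lemma exponents_sum:
  fixes m :: "nat \<Rightarrow>\<^sub>0 nat"
  shows "Poly_Mapping.keys m \<subseteq> {..n} \<Longrightarrow>
   (\<Sum>i\<in>Poly_Mapping.keys m. Poly_Mapping.lookup m i) = (\<Sum>i\<le>n. Poly_Mapping.lookup m i)"
  by (intro sum.mono_neutral_left) (auto simp: in_keys_iff)

lemma exponents_prod:
  fixes x :: "'k::comm_semiring_1 vec"
  shows "m \<in> exponents n d \<Longrightarrow>
   (\<Prod>i\<in>Poly_Mapping.keys m. (x $ i) ^ Poly_Mapping.lookup m i) = (\<Prod>i\<le>n. (x $ i) ^ Poly_Mapping.lookup m i)"
  unfolding exponents_def by (intro prod.mono_neutral_left) (auto simp: in_keys_iff)

lemma exponents_altdef:
  "exponents n d = {m. Poly_Mapping.keys m \<subseteq> {..n} \<and> (\<Sum>i\<le>n. Poly_Mapping.lookup m i) = d}"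
  unfolding exponents_def using exponents_sum by auto

text \<open>Lists make the stars and bars formula \<open>card_length_sum_list\<close> applicable.
  \<open>Poly_Mapping.nth\<close> goes back, as it is zero beyond the end of the list.\<close>

lemma bij_betw_exponents:
  "bij_betw (\<lambda>m. map (Poly_Mapping.lookup m) [0..<Suc n]) (exponents n d)
     {l. length l = n + 1 \<and> sum_list l = d}"
proof (rule bij_betwI[where g = Poly_Mapping.nth])
  have s: "sum_list (map (Poly_Mapping.lookup m) [0..<Suc n]) = (\<Sum>i\<le>n. Poly_Mapping.lookup m i)"
    for m :: "nat \<Rightarrow>\<^sub>0 nat"
    by (simp only: sum_set_upt_conv_sum_list_nat[symmetric] atMost_atLeast0 atLeastLessThanSuc_atLeastAtMost
      set_upt)
  show "(\<lambda>m. map (Poly_Mapping.lookup m) [0..<Suc n]) \<in> exponents n d \<rightarrow>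
      {l. length l = n + 1 \<and> sum_list l = d}"
    using s by (auto simp: exponents_altdef simp del: upt_Suc)
  have n1: "map (Poly_Mapping.lookup (Poly_Mapping.nth l)) [0..<Suc n] = l" if "length l = n + 1" for l :: "nat list"
    using that by (intro nth_equalityI) (auto simp: nth_default_def simp del: upt_Suc)
  then show "map (Poly_Mapping.lookup (Poly_Mapping.nth l)) [0..<Suc n] = l"
    if "l \<in> {l. length l = n + 1 \<and> sum_list l = d}" for l
    using that by simp
  show "Poly_Mapping.nth \<in> {l. length l = n + 1 \<and> sum_list l = d} \<rightarrow> exponents n d"
  proof
    fix l :: "nat list" assume l: "l \<in> {l. length l = n + 1 \<and> sum_list l = d}"
    have "Poly_Mapping.keys (Poly_Mapping.nth l) \<subseteq> {..n}"
      using l by (auto simp: in_keys_iff nth_default_def simp del: keys_nth split: if_splits)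
    then show "Poly_Mapping.nth l \<in> exponents n d"
      using s[of "Poly_Mapping.nth l"] n1[of l] l by (simp add: exponents_altdef del: upt_Suc keys_nth)
  qed
  show "Poly_Mapping.nth (map (Poly_Mapping.lookup m) [0..<Suc n]) = m" if "m \<in> exponents n d" for m
  proof (rule poly_mapping_eqI)
    fix k
    show "Poly_Mapping.lookup (Poly_Mapping.nth (map (Poly_Mapping.lookup m) [0..<Suc n])) k
      = Poly_Mapping.lookup m k"
      using that by (auto simp: nth_default_def exponents_def not_less in_keys_iff subset_iff simp del: upt_Suc)
  qed
qed

lemma card_exponents: "card (exponents n d) = (n + d) choose d"
  using bij_betw_same_card[OF bij_betw_exponents[of n d]] card_length_sum_list[of "n + 1" d]
  by (simp add: add.commute)

lemma finite_exponents [simp]: "finite (exponents n d)"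
proof -
  have "card (exponents n d) > 0" by (simp add: card_exponents)
  then show ?thesis by (rule card_ge_0_finite)
qed

text \<open>The number of forms replaces a basis of the space of forms: if evaluation is injective,
  the code has this many words, which determines its dimension.\<close>

lemma card_forms: "card (forms n d :: 'a::{zero,finite} mpoly set) = card (UNIV :: 'a set) ^ ((n + d) choose d)"
proof -
  let ?E = "exponents n d"
  have "bij_betw (\<lambda>F. restrict (Poly_Mapping.lookup F) ?E) (forms n d) (?E \<rightarrow>\<^sub>E (UNIV :: 'a set))"
  proof (rule bij_betwI[where g = "\<lambda>g. Abs_poly_mapping (\<lambda>m. if m \<in> ?E then g m else 0)"])
    have l: "Poly_Mapping.lookup (Abs_poly_mapping (\<lambda>m. if m \<in> ?E then g m else 0)) =
        (\<lambda>m. if m \<in> ?E then g m else 0)" for g :: "_ \<Rightarrow> 'a"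
      by (rule lookup_Abs_poly_mapping) (rule finite_subset[OF _ finite_exponents[of n d]], auto)
    show "(\<lambda>g. Abs_poly_mapping (\<lambda>m. if m \<in> ?E then g m else 0)) \<in> (?E \<rightarrow>\<^sub>E (UNIV :: 'a set)) \<rightarrow> forms n d"
      by (auto simp: forms_eq in_keys_iff l split: if_splits)
    show "Abs_poly_mapping (\<lambda>m. if m \<in> ?E then restrict (Poly_Mapping.lookup F) ?E m else 0) = F"
      if "F \<in> forms n d" for F :: "'a mpoly"
      by (rule poly_mapping_eqI) (use that in \<open>auto simp: l forms_eq in_keys_iff\<close>)
    show "restrict (Poly_Mapping.lookup (Abs_poly_mapping (\<lambda>m. if m \<in> ?E then g m else 0))) ?E = g"
      if "g \<in> ?E \<rightarrow>\<^sub>E (UNIV :: 'a set)" for g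
      using that by (auto simp: l fun_eq_iff PiE_def extensional_def)
  qed auto
  then have "card (forms n d :: 'a mpoly set) = card (?E \<rightarrow>\<^sub>E (UNIV :: 'a set))"
    by (rule bij_betw_same_card)
  then show ?thesis by (simp add: card_PiE card_exponents)
qed

lemma zero_in_forms [simp]: "0 \<in> forms n d"
  by (simp add: forms_eq)

lemma forms_add: "F \<in> forms n d \<Longrightarrow> G \<in> forms n d \<Longrightarrow> F + G \<in> forms n d"
  using Poly_Mapping.keys_add[of F G] by (auto simp: forms_eq)

lemma forms_diff:
  fixes F G :: "'k::ab_group_add mpoly"
  shows "F \<in> forms n d \<Longrightarrow> G \<in> forms n d \<Longrightarrow> F - G \<in> forms n d"
  by (auto simp: forms_eq in_keys_iff lookup_minus subset_iff) metis

lemma forms_sum: "(\<And>i. i \<in> I \<Longrightarrow> F i \<in> forms n d) \<Longrightarrow> (\<Sum>i\<in>I. F i) \<in> forms n d"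
  by (induction I rule: infinite_finite_induct) (auto intro: forms_add)

lemma forms_single: "m \<in> exponents n d \<Longrightarrow> Poly_Mapping.single m c \<in> forms n d"
  by (auto simp: forms_eq)

section \<open>Passing between forms and homogeneous functions\<close>

lemma homogeneous_eval_form:
  assumes "F \<in> forms n d"
  shows "homogeneous (n + 1) d (eval_form F)"
proof -
  have "homogeneous (n + 1) d (\<lambda>x. Poly_Mapping.lookup F m *
     (\<Prod>i\<in>Poly_Mapping.keys m. (x $ i) ^ Poly_Mapping.lookup m i))"
    if m: "m \<in> Poly_Mapping.keys F" for m
  proof (rule homogeneous_smult)
    have m': "m \<in> exponents n d" using assms m by (auto simp: forms_eq)
    then have "homogeneous (n + 1) (\<Sum>i\<in>Poly_Mapping.keys m. Suc 0 * Poly_Mapping.lookup m i)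
       (\<lambda>x. \<Prod>i\<in>Poly_Mapping.keys m. (x $ i) ^ Poly_Mapping.lookup m i)"
      by (intro homogeneous_prod homogeneous_power homogeneous_coord) (auto simp: exponents_def)
    with m' show "homogeneous (n + 1) d (\<lambda>x. \<Prod>i\<in>Poly_Mapping.keys m. (x $ i) ^ Poly_Mapping.lookup m i)"
      by (simp add: exponents_def)
  qed
  then show ?thesis
    unfolding eval_form_def[abs_def] by (rule homogeneous_sum)
qed

lemma forms_mult_coord:
  fixes F :: "'k::comm_semiring_1 mpoly"
  assumes "F \<in> forms n d" "i \<le> n"
  shows "\<exists>G\<in>forms n (Suc d). \<forall>x. eval_form G x = c * x $ i * eval_form F x"
proof -
  let ?e = "\<lambda>m. m + Poly_Mapping.single i (Suc 0)"
  let ?G = "\<Sum>m\<in>Poly_Mapping.keys F. Poly_Mapping.single (?e m) (c * Poly_Mapping.lookup F m)"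
  have e: "?e m \<in> exponents n (Suc d)" if "m \<in> exponents n d" for m
  proof -
    have "Poly_Mapping.keys (?e m) \<subseteq> {..n}"
      using that assms(2) Poly_Mapping.keys_add[of m "Poly_Mapping.single i (Suc 0)"]
      by (auto simp: exponents_def)
    moreover have "(\<Sum>j\<le>n. Poly_Mapping.lookup (?e m) j) = Suc d"
      using that assms(2)
      by (auto simp: exponents_altdef lookup_add sum.distrib lookup_single when_def)
    ultimately show ?thesis by (simp add: exponents_altdef)
  qed
  have F: "m \<in> exponents n d" if "m \<in> Poly_Mapping.keys F" for m
    using that assms(1) by (auto simp: forms_eq)
  have "?G \<in> forms n (Suc d)"
    by (intro forms_sum forms_single e F)
  moreover have "eval_form ?G x = c * x $ i * eval_form F x" for x
  proof -
    have "eval_form (Poly_Mapping.single (?e m) (c * Poly_Mapping.lookup F m)) x =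
      c * x $ i * (Poly_Mapping.lookup F m *
       (\<Prod>i\<in>Poly_Mapping.keys m. (x $ i) ^ Poly_Mapping.lookup m i))" if "m \<in> Poly_Mapping.keys F" for m
    proof -
      \<comment> \<open>Over the fixed index set {..n} the extra variable splits off as one factor,
        whether or not i was already among the keys of m.\<close>
      have "(\<Prod>j\<le>n. (x $ j) ^ Poly_Mapping.lookup (?e m) j) =
          (\<Prod>j\<le>n. (x $ j) ^ Poly_Mapping.lookup m j * (if j = i then x $ i else 1))"
        by (intro prod.cong) (auto simp: lookup_add lookup_single when_def mult.commute)
      also have "\<dots> = (\<Prod>j\<le>n. (x $ j) ^ Poly_Mapping.lookup m j) * x $ i"
        using assms(2) by (simp add: prod.distrib)
      finally show ?thesis
        using exponents_prod[OF F[OF that], of x] exponents_prod[OF e[OF F[OF that]], of x]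
        by (simp add: eval_form_single mult_ac)
    qed
    then show ?thesis
      by (simp add: eval_form_sum) (simp add: eval_form_def sum_distrib_left)
  qed
  ultimately show ?thesis by blast
qed

text \<open>The way back from functions to polynomials: \<open>max_section\<close> and
  \<open>functional_code\<close> range over \<open>forms\<close>, while the coefficients found by
  expansion are only functions.\<close>

lemma homogeneous_imp_form:
  fixes f :: "'a::field vec \<Rightarrow> 'a"
  assumes "homogeneous (n + 1) d f"
  obtains F where "F \<in> forms n d" "\<And>x. x \<in> carrier_vec (n + 1) \<Longrightarrow> f x = eval_form F x"
proof -
  have "\<exists>F\<in>forms n d. \<forall>x\<in>carrier_vec (n + 1). f x = eval_form F x"
    using assms
  proof (induction d f rule: homogeneous.induct)
    case (const c)
    have "Poly_Mapping.single 0 c \<in> forms n 0"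
      by (rule forms_single) (simp add: exponents_def)
    then show ?case by (rule bexI[rotated]) (simp add: eval_form_single)
  next
    case (zero d)
    show ?case by (rule bexI[of _ 0]) auto
  next
    case (add d f g)
    then obtain F G where "F \<in> forms n d" "\<forall>x\<in>carrier_vec (n + 1). f x = eval_form F x"
      "G \<in> forms n d" "\<forall>x\<in>carrier_vec (n + 1). g x = eval_form G x" by blast
    then show ?case by (intro bexI[of _ "F + G"]) (auto simp: eval_form_add intro: forms_add)
  next
    case (linear_mult a d f)
    then obtain F where F: "F \<in> forms n d" "\<forall>x\<in>carrier_vec (n + 1). f x = eval_form F x" by blast
    have "\<forall>i\<in>{..n}. \<exists>G. G \<in> forms n (Suc d) \<and> (\<forall>x. eval_form G x = a $ i * x $ i * eval_form F x)"
      using forms_mult_coord[OF F(1)] by fastforce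
    then obtain G where G: "\<forall>i\<in>{..n}. G i \<in> forms n (Suc d) \<and>
        (\<forall>x. eval_form (G i) x = a $ i * x $ i * eval_form F x)"
      by (metis (no_types, lifting))
    show ?case
    proof (intro bexI[of _ "\<Sum>i\<le>n. G i"] ballI)
      fix x :: "'a vec" assume x: "x \<in> carrier_vec (n + 1)"
      then have "a \<bullet> x = (\<Sum>i\<le>n. a $ i * x $ i)"
        by (simp add: scalar_prod_def atLeast0LessThan lessThan_Suc_atMost)
      then show "(a \<bullet> x) * f x = eval_form (\<Sum>i\<le>n. G i) x"
        using x F G by (simp add: eval_form_sum sum_distrib_right)
    next
      show "(\<Sum>i\<le>n. G i) \<in> forms n (Suc d)"
        using G by (intro forms_sum) auto
    qed
  next
    case (cong d f g)
    then show ?case by metis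
  qed
  then show ?thesis using that by blast
qed

text \<open>A polynomial with all exponents below |K| is determined by its values. With the other
  variables fixed, it is a polynomial of degree below |K| in the last one with |K| roots, so all its
  coefficients vanish; induction treats the monomials that share the last exponent.\<close>

lemma exponential_sum_eq_zero:
  fixes c :: "'m \<Rightarrow> 'a::{field,finite}" and e :: "'m \<Rightarrow> nat \<Rightarrow> nat"
  assumes "finite A" "\<And>m i. m \<in> A \<Longrightarrow> i < N \<Longrightarrow> e m i < card (UNIV :: 'a set)"
    and "\<And>m m'. m \<in> A \<Longrightarrow> m' \<in> A \<Longrightarrow> (\<And>i. i < N \<Longrightarrow> e m i = e m' i) \<Longrightarrow> m = m'"
    and "\<And>x :: nat \<Rightarrow> 'a. (\<Sum>m\<in>A. c m * (\<Prod>i<N. x i ^ e m i)) = 0"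
    and "m \<in> A"
  shows "c m = 0"
  using assms
proof (induction N arbitrary: A m)
  case 0
  then have "A = {m}" by auto
  then show ?case using "0.prems"(4) by simp
next
  case (Suc N)
  let ?k = "card (UNIV :: 'a set)"
  let ?B = "\<lambda>a. {m\<in>A. e m N = a}"
  show ?case
  proof (rule Suc.IH[of "?B (e m N)"])
    fix x :: "nat \<Rightarrow> 'a"
    define b where "b a = (\<Sum>m\<in>?B a. c m * (\<Prod>i<N. x i ^ e m i))" for a
    have k0: "?k > 0" by (simp add: card_gt_0_iff)
    have le: "e m N \<le> ?k - 1" if "m \<in> A" for m
      using Suc.prems(2)[OF that, of N] by simp
    have b: "(\<Sum>a\<le>?k - 1. b a * t ^ a) = 0" for t
    proof -
      have "(\<Sum>a\<le>?k - 1. b a * t ^ a) =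
          (\<Sum>a\<le>?k - 1. \<Sum>m\<in>?B a. c m * (\<Prod>i<N. x i ^ e m i) * t ^ e m N)"
        by (simp add: b_def sum_distrib_right)
      also have "\<dots> = (\<Sum>m\<in>A. c m * (\<Prod>i<N. x i ^ e m i) * t ^ e m N)"
        using le by (intro sum.group) (auto simp: Suc.prems(1))
      also have "\<dots> = (\<Sum>m\<in>A. c m * (\<Prod>i<Suc N. (x(N := t)) i ^ e m i))"
        by (intro sum.cong) (auto simp: mult.assoc intro!: prod.cong)
      also have "\<dots> = 0" by (rule Suc.prems(4))
      finally show ?thesis .
    qed
    have "b (e m N) = 0"
    proof (rule ccontr)
      assume "b (e m N) \<noteq> 0"
      then have "card {t. (\<Sum>a\<le>?k - 1. b a * t ^ a) = 0} \<le> ?k - 1"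
        using Suc.prems(2)[OF Suc.prems(5), of N] by (intro card_power_sum_roots_le[of "e m N"]) auto
      moreover have "{t. (\<Sum>a\<le>?k - 1. b a * t ^ a) = 0} = UNIV" using b by blast
      ultimately have "?k \<le> ?k - 1" by (simp only:)
      then show False using k0 by linarith
    qed
    then show "(\<Sum>m\<in>?B (e m N). c m * (\<Prod>i<N. x i ^ e m i)) = 0"
      by (simp add: b_def)
  next
    fix m1 m2 assume m: "m1 \<in> ?B (e m N)" "m2 \<in> ?B (e m N)"
      and eq: "\<And>i. i < N \<Longrightarrow> e m1 i = e m2 i"
    then have "e m1 i = e m2 i" if "i < Suc N" for i
      using that by (cases "i = N") auto
    with m show "m1 = m2" using Suc.prems(3)[of m1 m2] by blast
  qed (use Suc.prems in auto)
qed

text \<open>Each exponent is at most the total degree d < |K|, so the form is a reduced polynomial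
  and differs from 0 as a function.\<close>

lemma form_nonvanishing:
  fixes F :: "'a::{field,finite} mpoly"
  assumes "F \<in> forms n d" "F \<noteq> 0" "d < card (UNIV :: 'a set)"
  obtains x where "x \<in> carrier_vec (n + 1)" "eval_form F x \<noteq> 0"
proof -
  obtain m where m: "m \<in> Poly_Mapping.keys F"
    using assms(2) by (metis equals0I keys_eq_empty)
  have F: "m \<in> exponents n d" if "m \<in> Poly_Mapping.keys F" for m
    using that assms(1) by (auto simp: forms_eq)
  have "\<exists>x. x \<in> carrier_vec (n + 1) \<and> eval_form F x \<noteq> 0"
  proof (rule ccontr)
    assume *: "\<not> ?thesis"
    have "Poly_Mapping.lookup F m = 0"
    proof (rule exponential_sum_eq_zero[of "Poly_Mapping.keys F" "n + 1" Poly_Mapping.lookup, OF _ _ _ _ m])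
      fix m i assume "m \<in> Poly_Mapping.keys F" "i < n + 1"
      then have "Poly_Mapping.lookup m i \<le> (\<Sum>i\<le>n. Poly_Mapping.lookup m i)"
        by (intro member_le_sum) auto
      also have "\<dots> = d" using F[OF \<open>m \<in> Poly_Mapping.keys F\<close>] by (simp add: exponents_altdef)
      finally show "Poly_Mapping.lookup m i < card (UNIV :: 'a set)" using assms(3) by simp
    next
      fix m m' assume "m \<in> Poly_Mapping.keys F" "m' \<in> Poly_Mapping.keys F"
        and eq: "\<And>i. i < n + 1 \<Longrightarrow> Poly_Mapping.lookup m i = Poly_Mapping.lookup m' i"
      then have "Poly_Mapping.keys m \<subseteq> {..n}" "Poly_Mapping.keys m' \<subseteq> {..n}"
        using F by (auto simp: exponents_def)
      then have "Poly_Mapping.lookup m i = 0 \<and> Poly_Mapping.lookup m' i = 0" if "\<not> i < n + 1" for i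
        using that by (auto simp: in_keys_iff subset_iff)
      with eq show "m = m'" by (metis poly_mapping_eqI)
    next
      fix x :: "nat \<Rightarrow> 'a"
      have "0 = eval_form F (vec (n + 1) x)" using * by auto
      also have "\<dots> = (\<Sum>m\<in>Poly_Mapping.keys F. Poly_Mapping.lookup F m * (\<Prod>i\<le>n. vec (n + 1) x $ i ^ Poly_Mapping.lookup m i))"
        unfolding eval_form_def by (intro sum.cong arg_cong2[of _ _ _ _ "(*)"] exponents_prod[of _ n d] F) auto
      also have "\<dots> = (\<Sum>m\<in>Poly_Mapping.keys F. Poly_Mapping.lookup F m * (\<Prod>i<n+1. x i ^ Poly_Mapping.lookup m i))"
        by (intro sum.cong arg_cong2[of _ _ _ _ "(*)"] prod.cong) auto
      finally show "(\<Sum>m\<in>Poly_Mapping.keys F. Poly_Mapping.lookup F m * (\<Prod>i<n+1. x i ^ Poly_Mapping.lookup m i)) = 0"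
        by simp
    qed auto
    then show False using m by (simp add: in_keys_iff)
  qed
  then show ?thesis using that by blast
qed

section \<open>Plane sections\<close>

text \<open>The weights \<open>q\<close> of \<open>x\<close> and \<open>q + 1\<close> of \<open>y\<close> are chosen such that \<open>x\<^bsup>q+1\<^esup>\<close> and \<open>y\<^sup>q\<close>, the leading
  terms of a Hermitian form on a plane through an isotropic vector, are equally heavy.\<close>

inductive weight_lt :: "nat \<Rightarrow> nat \<Rightarrow> ('a::comm_ring_1 \<Rightarrow> 'a \<Rightarrow> 'a) \<Rightarrow> bool" for q w where
  zero: "weight_lt q w (\<lambda>_ _. 0)"
| monomial: "weight_lt q w g \<Longrightarrow> i * q + j * (q + 1) < w \<Longrightarrow> weight_lt q w (\<lambda>x y. g x y + c * x ^ i * y ^ j)"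

lemma weight_lt_monomial: "i * q + j * (q + 1) < w \<Longrightarrow> weight_lt q w (\<lambda>x y. c * x ^ i * y ^ j)"
  using weight_lt.monomial[OF weight_lt.zero] by simp

lemma weight_lt_add:
  assumes "weight_lt q w g" "weight_lt q w f"
  shows "weight_lt q w (\<lambda>x y. f x y + g x y)"
  using assms(1)
proof (induction g rule: weight_lt.induct)
  case zero
  then show ?case using assms(2) by simp
next
  case (monomial g i j c)
  show ?case using weight_lt.monomial[OF monomial.IH monomial(2), of c] by (simp add: algebra_simps)
qed

lemma weight_lt_mono: "weight_lt q w g \<Longrightarrow> w \<le> w' \<Longrightarrow> weight_lt q w' g"
  by (induction g rule: weight_lt.induct) (auto intro: weight_lt.zero weight_lt.monomial)

lemma weight_lt_mult_monomial:
  assumes "weight_lt q w g" "w + i * q + j * (q + 1) \<le> w'"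
  shows "weight_lt q w' (\<lambda>x y. c * x ^ i * y ^ j * g x y)"
  using assms(1)
proof (induction g rule: weight_lt.induct)
  case zero
  then show ?case by (simp add: weight_lt.zero)
next
  case (monomial g i' j' b)
  have "(i + i') * q + (j + j') * (q + 1) < w'"
    using monomial(2) assms(2) by (simp add: algebra_simps)
  from weight_lt.monomial[OF monomial.IH this, of "c * b"]
  show ?case by (simp add: algebra_simps power_add)
qed

text \<open>The bound \<open>Suc w'\<close> says that g has weight at most w', so strictness is lost
  in one factor only.\<close>

lemma weight_lt_mult:
  assumes "weight_lt q w f" "weight_lt q (Suc w') g" "w + w' \<le> w''"
  shows "weight_lt q w'' (\<lambda>x y. f x y * g x y)"
  using assms(2)
proof (induction g rule: weight_lt.induct)
  case zero
  then show ?case by (simp add: weight_lt.zero)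
next
  case (monomial g i j c)
  have "weight_lt q w'' (\<lambda>x y. c * x ^ i * y ^ j * f x y)"
    using monomial(2) assms(1,3) by (intro weight_lt_mult_monomial[of q w]) (auto simp: algebra_simps)
  from weight_lt_add[OF this monomial.IH]
  show ?case by (simp add: algebra_simps)
qed

text \<open>On the translated plane y has weight q + 1, x has weight q and constants have weight 0.
  Hence y^d is the only monomial of degree at most d that reaches weight d (q + 1), and its
  coefficient is the value of f at Q.\<close>

lemma homogeneous_weight:
  fixes f :: "'a::field vec \<Rightarrow> 'a"
  assumes "homogeneous N d f" and carrier: "Q \<in> carrier_vec N" "b \<in> carrier_vec N" "v \<in> carrier_vec N"
  shows "\<exists>g. weight_lt q (d * (q + 1)) g \<and>
    (\<forall>x y. f (y \<cdot>\<^sub>v Q + x \<cdot>\<^sub>v b + v) = f Q * y ^ d + g x y)"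
  using assms(1)
proof (induction d f rule: homogeneous.induct)
  case (const c)
  show ?case by (rule exI[of _ "\<lambda>_ _. 0"]) (auto intro: weight_lt.zero)
next
  case (zero d)
  show ?case by (rule exI[of _ "\<lambda>_ _. 0"]) (auto intro: weight_lt.zero)
next
  case (add d f f')
  then obtain g g' where "weight_lt q (d * (q + 1)) g" "weight_lt q (d * (q + 1)) g'"
    "\<forall>x y. f (y \<cdot>\<^sub>v Q + x \<cdot>\<^sub>v b + v) = f Q * y ^ d + g x y"
    "\<forall>x y. f' (y \<cdot>\<^sub>v Q + x \<cdot>\<^sub>v b + v) = f' Q * y ^ d + g' x y" by blast
  then show ?case
    by (intro exI[of _ "\<lambda>x y. g x y + g' x y"]) (auto intro: weight_lt_add simp: algebra_simps)
next
  case (linear_mult a d f)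
  then obtain g where g: "weight_lt q (d * (q + 1)) g"
    "\<forall>x y. f (y \<cdot>\<^sub>v Q + x \<cdot>\<^sub>v b + v) = f Q * y ^ d + g x y" by blast
  \<comment> \<open>The trivial powers are kept to match the shape of
    \<open>weight_lt_monomial\<close>.\<close>
  define l where "l = (\<lambda>x y :: 'a. (a \<bullet> b) * x ^ 1 * y ^ 0 + (a \<bullet> v) * x ^ 0 * y ^ 0)"
  have l: "weight_lt q (q + 1) l"
    unfolding l_def by (intro weight_lt_add weight_lt_monomial) auto
  have a: "a \<bullet> (y \<cdot>\<^sub>v Q + x \<cdot>\<^sub>v b + v) = (a \<bullet> Q) * y + l x y" for x y
    using carrier linear_mult(1) by (simp add: scalar_prod_add_distrib[of _ N] l_def)
  \<comment> \<open>All products of (a Q) y + l with f(Q) y^d + g except the leading one.\<close>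
  let ?g = "\<lambda>x y. f Q * x ^ 0 * y ^ d * l x y + ((a \<bullet> Q) * x ^ 0 * y ^ 1 * g x y + l x y * g x y)"
  have "weight_lt q (Suc d * (q + 1)) (\<lambda>x y. f Q * x ^ 0 * y ^ d * l x y)"
    by (rule weight_lt_mult_monomial[OF l]) simp
  moreover have "weight_lt q (Suc d * (q + 1)) (\<lambda>x y. (a \<bullet> Q) * x ^ 0 * y ^ 1 * g x y)"
    by (rule weight_lt_mult_monomial[OF g(1)]) simp
  moreover have "weight_lt q (Suc d * (q + 1)) (\<lambda>x y. l x y * g x y)"
    by (rule weight_lt_mult[OF l weight_lt_mono[OF g(1)], of "d * (q + 1)"]) auto
  ultimately have "weight_lt q (Suc d * (q + 1)) ?g"
    by (intro weight_lt_add)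
  moreover have "\<forall>x y. a \<bullet> (y \<cdot>\<^sub>v Q + x \<cdot>\<^sub>v b + v) * f (y \<cdot>\<^sub>v Q + x \<cdot>\<^sub>v b + v)
      = a \<bullet> Q * f Q * y ^ Suc d + ?g x y"
    using g(2) by (simp add: a algebra_simps)
  ultimately show ?case by blast
next
  case (cong d f f')
  then show ?case using carrier by simp
qed

text \<open>Modulo the two equations every monomial is a combination of the \<open>x\<^sup>i y\<^sup>j\<close> with
  \<open>i \<le> q\<close> and \<open>j < d\<close>, so these span all functions on the common zero set.\<close>

lemma card_plane_section_le:
  fixes Z :: "('a::{field,finite} \<times> 'a) set"
  assumes g: "weight_lt q (d * (q + 1)) g" "c \<noteq> 0"
      "\<And>x y. (x, y) \<in> Z \<Longrightarrow> c * y ^ d + g x y = 0"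
    and h: "weight_lt q (q * (q + 1)) h" "a \<noteq> 0"
      "\<And>x y. (x, y) \<in> Z \<Longrightarrow> a * x ^ (q + 1) + b * y ^ q + h x y = 0"
  shows "card Z \<le> d * (q + 1)"
proof -
  let ?I = "{..q} \<times> {..<d}"
  define sp where "sp = (\<lambda>f. \<exists>k. \<forall>x y. (x, y) \<in> Z \<longrightarrow> f x y = (\<Sum>(i, j)\<in>?I. k (i, j) * x ^ i * y ^ j :: 'a))"
  have sp0: "sp (\<lambda>_ _. 0)"
    unfolding sp_def by (rule exI[of _ "\<lambda>_. 0"]) (auto simp: case_prod_unfold)
  have spadd: "sp (\<lambda>x y. f x y + f' x y)" if s1: "sp f" and s2: "sp f'" for f f'
  proof -
    obtain k where k: "\<forall>x y. (x, y) \<in> Z \<longrightarrow> f x y = (\<Sum>(i, j)\<in>?I. k (i, j) * x ^ i * y ^ j)"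
      using s1 unfolding sp_def by blast
    obtain k' where "\<forall>x y. (x, y) \<in> Z \<longrightarrow> f' x y = (\<Sum>(i, j)\<in>?I. k' (i, j) * x ^ i * y ^ j)"
      using s2 unfolding sp_def by blast
    with k show ?thesis
      unfolding sp_def by (intro exI[of _ "\<lambda>p. k p + k' p"])
        (auto simp: case_prod_unfold sum.distrib distrib_right)
  qed
  have spsmult: "sp (\<lambda>x y. s * f x y)" if sf: "sp f" for f s
  proof -
    obtain k where "\<forall>x y. (x, y) \<in> Z \<longrightarrow> f x y = (\<Sum>(i, j)\<in>?I. k (i, j) * x ^ i * y ^ j)"
      using sf unfolding sp_def by blast
    then show ?thesis
      unfolding sp_def by (intro exI[of _ "\<lambda>p. s * k p"])
        (auto simp: case_prod_unfold sum_distrib_left mult.assoc)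
  qed
  have spcong: "sp f" if s1: "sp f'" and eq: "\<And>x y. (x, y) \<in> Z \<Longrightarrow> f x y = f' x y" for f f'
  proof -
    obtain k where "\<forall>x y. (x, y) \<in> Z \<longrightarrow> f' x y = (\<Sum>(i, j)\<in>?I. k (i, j) * x ^ i * y ^ j)"
      using s1 unfolding sp_def by blast
    then show ?thesis
      unfolding sp_def using eq by (intro exI[of _ k]) simp
  qed
  have spbasis: "sp (\<lambda>x y. x ^ i * y ^ j)" if "i \<le> q" "j < d" for i j
    unfolding sp_def
  proof (rule exI[of _ "\<lambda>p. if p = (i, j) then 1 else 0"], intro allI impI)
    fix x y :: 'a
    have "(\<Sum>(i', j')\<in>?I. (if (i', j') = (i, j) then 1 else 0) * x ^ i' * y ^ j')
      = (\<Sum>p\<in>?I. if p = (i, j) then x ^ i * y ^ j else 0)"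
      by (rule sum.cong) (auto split: if_splits)
    also have "\<dots> = x ^ i * y ^ j" using that by simp
    finally show "x ^ i * y ^ j = (\<Sum>(i', j')\<in>?I. (if (i', j') = (i, j) then 1 else 0) * x ^ i' * y ^ j')"
      by simp
  qed
  have lower: "sp f" if "weight_lt q w f" "\<And>i j. i * q + j * (q + 1) < w \<Longrightarrow> sp (\<lambda>x y. x ^ i * y ^ j)" for f w
    using that(1)
  proof (induction f rule: weight_lt.induct)
    case (monomial g i j c)
    show ?case
      by (rule spcong[OF spadd[OF monomial.IH spsmult[OF that(2)[OF monomial(2)], of c]]]) (simp add: mult.assoc)
  qed (rule sp0)
  \<comment> \<open>Replacing y^d lowers the weight. Replacing x^(q+1) gives terms of lower weight
    and a multiple of y^q, which has the same weight but a smaller exponent of x. Hence an outer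
    induction on the weight and an inner one on the exponent of x.\<close>
  have mono: "sp (\<lambda>x y. x ^ i * y ^ j)" for i j
  proof (induction "i * q + j * (q + 1)" arbitrary: i j rule: less_induct)
    case outer: less
    define w where "w = i * q + j * (q + 1)"
    have low: "sp f" if "weight_lt q w f" for f
      by (rule lower[OF that outer]) (simp only: w_def)
    have "sp (\<lambda>x y. x ^ i' * y ^ j')" if "i' * q + j' * (q + 1) = w" for i' j'
      using that
    proof (induction i' arbitrary: j' rule: less_induct)
      case (less i)
      show ?case
      proof (cases "j' < d")
        case False
        have w: "weight_lt q w (\<lambda>x y. - 1 / c * x ^ i * y ^ (j' - d) * g x y)"
        proof (rule weight_lt_mult_monomial[OF g(1)])
          have "j' * (q + 1) = d * (q + 1) + (j' - d) * (q + 1)"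
            using False by (metis add_mult_distrib le_add_diff_inverse not_less)
          then show "d * (q + 1) + i * q + (j' - d) * (q + 1) \<le> w"
            using less.prems by linarith
        qed
        show ?thesis
        proof (rule spcong[OF low[OF w]])
          fix x y assume "(x, y) \<in> Z"
          then have "y ^ d = - 1 / c * g x y"
            using g(2) g(3)[of x y] by (simp add: field_simps eq_neg_iff_add_eq_0)
          moreover have "y ^ j' = y ^ (j' - d) * y ^ d"
            using False by (simp flip: power_add)
          ultimately show "x ^ i * y ^ j' = - 1 / c * x ^ i * y ^ (j' - d) * g x y"
            by simp
        qed
      next
        case j: True
        show ?thesis
        proof (cases "i \<le> q")
          case True
          with j show ?thesis by (rule spbasis[rotated])
        next
          case False
          then obtain k where i: "i = k + (q + 1)"
            by (metis Suc_eq_plus1 add.commute le_iff_add not_less_eq_eq)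
          have kw: "k * q + (j' + q) * (q + 1) = w"
            using less.prems by (simp add: i algebra_simps)
          have w: "weight_lt q w (\<lambda>x y. - 1 / a * x ^ k * y ^ j' * h x y)"
          proof (rule weight_lt_mult_monomial[OF h(1)])
            show "q * (q + 1) + k * q + j' * (q + 1) \<le> w"
              using kw by (simp add: algebra_simps)
          qed
          have 1: "sp (\<lambda>x y. x ^ k * y ^ (j' + q))"
            by (rule less.IH[OF _ kw]) (simp add: i)
          show ?thesis
          proof (rule spcong[OF spadd[OF low[OF w] spsmult[OF 1, of "- b / a"]]])
            fix x y assume "(x, y) \<in> Z"
            then have "a * x ^ (q + 1) = - (b * y ^ q + h x y)"
              using h(3)[of x y] by (simp only: eq_neg_iff_add_eq_0 add.assoc)
            then have "x ^ (q + 1) = - (b * y ^ q + h x y) / a"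
              using h(2) by (metis nonzero_mult_div_cancel_left)
            also have "\<dots> = - 1 / a * h x y + - b / a * y ^ q"
              by (simp add: add_divide_distrib diff_divide_distrib)
            finally have "x ^ i * y ^ j' = x ^ k * (- 1 / a * h x y + - b / a * y ^ q) * y ^ j'"
              by (simp only: i power_add)
            also have "\<dots> = - 1 / a * x ^ k * y ^ j' * h x y + - b / a * (x ^ k * y ^ (j' + q))"
              by (simp only: distrib_left distrib_right power_add mult_ac)
            finally show "x ^ i * y ^ j' = - 1 / a * x ^ k * y ^ j' * h x y + - b / a * (x ^ k * y ^ (j' + q))" .
          qed
        qed
      qed
    qed
    then show ?case by (simp add: w_def)
  qed
  have poly: "sp (\<lambda>x y. poly p x * poly r y)" for p r :: "'a poly"
  proof -
    have sum: "sp (\<lambda>x y. \<Sum>i\<in>S. f i x y)" if "\<And>i. i \<in> S \<Longrightarrow> sp (f i)" for S :: "nat set" and f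
      using that by (induction S rule: infinite_finite_induct) (auto intro: sp0 spadd)
    have "sp (\<lambda>x y. \<Sum>i\<le>Polynomial.degree p. \<Sum>j\<le>Polynomial.degree r.
        (coeff p i * coeff r j) * (x ^ i * y ^ j))"
      by (intro sum spsmult mono)
    then show ?thesis
      by (rule spcong) (simp add: poly_altdef sum_product mult_ac)
  qed
  \<comment> \<open>Lagrange interpolation: the value of \<open>D a\<close> is nonzero exactly at a,
    so products of two such polynomials are multiples of the indicator functions of points.\<close>
  have all: "sp f" for f
  proof -
    define D where "D = (\<lambda>a::'a. (\<Prod>z\<in>UNIV - {a}. [:- z, 1:]))"
    have D: "poly (D a) x = 0 \<longleftrightarrow> x \<noteq> a" for a x
      by (auto simp: D_def poly_prod)
    have sum: "sp (\<lambda>x y. \<Sum>i\<in>S. f i x y)" if "\<And>i. i \<in> S \<Longrightarrow> sp (f i)" for S :: "('a \<times> 'a) set" and f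
      using that by (induction S rule: infinite_finite_induct) (auto intro: sp0 spadd)
    have "sp (\<lambda>x y. \<Sum>p\<in>UNIV. f (fst p) (snd p) / (poly (D (fst p)) (fst p) * poly (D (snd p)) (snd p))
        * (poly (D (fst p)) x * poly (D (snd p)) y))"
      by (intro sum spsmult poly)
    then show ?thesis
    proof (rule spcong)
      fix x y
      have "(\<Sum>p\<in>UNIV. f (fst p) (snd p) / (poly (D (fst p)) (fst p) * poly (D (snd p)) (snd p))
        * (poly (D (fst p)) x * poly (D (snd p)) y)) = (\<Sum>p\<in>UNIV. if p = (x, y) then f x y else 0)"
        by (intro sum.cong) (auto simp: D)
      then show "f x y = (\<Sum>p\<in>UNIV. f (fst p) (snd p) / (poly (D (fst p)) (fst p) * poly (D (snd p)) (snd p))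
        * (poly (D (fst p)) x * poly (D (snd p)) y))" by simp
    qed
  qed
  \<comment> \<open>Spanning is turned into an inequality by counting: coefficient families on the
    monomial set map onto all functions on Z, so |K|^|Z| is at most |K|^(d (q + 1)).\<close>
  let ?r = "\<lambda>k. restrict (\<lambda>(x, y). \<Sum>(i, j)\<in>?I. k (i, j) * x ^ i * y ^ j) Z"
  have "(Z \<rightarrow>\<^sub>E (UNIV :: 'a set)) \<subseteq> ?r ` (?I \<rightarrow>\<^sub>E UNIV)"
  proof
    fix f assume f: "f \<in> Z \<rightarrow>\<^sub>E (UNIV :: 'a set)"
    obtain k where k: "\<forall>x y. (x, y) \<in> Z \<longrightarrow> f (x, y) = (\<Sum>(i, j)\<in>?I. k (i, j) * x ^ i * y ^ j)"
      using all[of "\<lambda>x y. f (x, y)"] unfolding sp_def by blast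
    have "f = ?r (restrict k ?I)"
    proof
      fix p :: "'a \<times> 'a"
      obtain x y where p: "p = (x, y)" by fastforce
      show "f p = ?r (restrict k ?I) p"
      proof (cases "p \<in> Z")
        case True
        have "(\<Sum>(i, j)\<in>?I. k (i, j) * x ^ i * y ^ j) = (\<Sum>(i, j)\<in>?I. restrict k ?I (i, j) * x ^ i * y ^ j)"
          by (intro sum.cong) auto
        then show ?thesis using k True p by simp
      qed (use f p in \<open>auto simp: PiE_def extensional_def\<close>)
    qed
    moreover have "?r (restrict k ?I) \<in> ?r ` (?I \<rightarrow>\<^sub>E UNIV)" by (rule imageI) (auto simp only: restrict_PiE_iff)
    ultimately show "f \<in> ?r ` (?I \<rightarrow>\<^sub>E UNIV)" by (simp only:)
  qed
  then have "card (Z \<rightarrow>\<^sub>E (UNIV :: 'a set)) \<le> card (?I \<rightarrow>\<^sub>E (UNIV :: 'a set))"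
    by (intro surj_card_le finite_PiE) auto
  moreover have "finite Z" by simp
  moreover have "card ?I = d * (q + 1)" by (simp only: card_cartesian_product) simp
  ultimately have le: "card (UNIV :: 'a set) ^ card Z \<le> card (UNIV :: 'a set) ^ (d * (q + 1))"
    by (simp only: card_PiE finite_SigmaI finite_lessThan finite_atMost prod_constant)
  have "card (UNIV :: 'a set) > 1"
  proof -
    have "card {0, 1 :: 'a} \<le> card (UNIV :: 'a set)" by (rule card_mono) auto
    then show ?thesis by simp
  qed
  then show ?thesis using le by (rule power_le_imp_le_exp)
qed

section \<open>Counting in vector spaces over finite fields\<close>

text \<open>Over a finite field this allows both the rank of the Hermitian matrices and the
  dimension of the code to be found by counting.\<close>

lemma (in vectorspace) card_carrier_eq_power_dim:
  assumes "finite (carrier V)"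
  shows "card (carrier V) = card (carrier K) ^ dim"
proof -
  have "fin_dim"
    unfolding fin_dim_def using assms in_own_span[of "carrier V"] span_is_subset2[of "carrier V"]
    by (intro exI[of _ "carrier V"]) auto
  then obtain B where B: "finite B" "basis B" using finite_basis_exists by blast
  then have BV: "B \<subseteq> carrier V" by (simp add: basis_def)
  have ex: "\<forall>v. v \<in> carrier V \<longrightarrow> (\<exists>!a. a \<in> B \<rightarrow>\<^sub>E carrier K \<and> lincomb a B = v)"
    using basis_criterion[OF B(1) BV] B(2) by blast
  have "bij_betw (\<lambda>a. lincomb a B) (B \<rightarrow>\<^sub>E carrier K) (carrier V)"
    unfolding bij_betw_def
  proof (intro conjI equalityI subsetI inj_onI)
    fix a b assume "a \<in> B \<rightarrow>\<^sub>E carrier K" "b \<in> B \<rightarrow>\<^sub>E carrier K" "lincomb a B = lincomb b B"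
    moreover from this have "lincomb a B \<in> carrier V" using BV by (intro lincomb_closed) auto
    ultimately show "a = b" using ex by metis
  next
    fix v assume "v \<in> (\<lambda>a. lincomb a B) ` (B \<rightarrow>\<^sub>E carrier K)"
    then show "v \<in> carrier V" using BV by (auto intro!: lincomb_closed)
  next
    fix v assume "v \<in> carrier V"
    then show "v \<in> (\<lambda>a. lincomb a B) ` (B \<rightarrow>\<^sub>E carrier K)" using ex by blast
  qed
  then have "card (B \<rightarrow>\<^sub>E carrier K) = card (carrier V)" by (rule bij_betw_same_card)
  then show ?thesis using dim_basis[OF B] B(1) by (simp add: card_PiE)
qed

lemma finite_carrier_vec [simp]: "finite (carrier_vec N :: 'a::finite vec set)"
  and card_carrier_vec: "card (carrier_vec N :: 'a::finite vec set) = card (UNIV :: 'a set) ^ N"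
proof -
  have "bij_betw (\<lambda>f. vec N f) ({..<N} \<rightarrow>\<^sub>E (UNIV :: 'a set)) (carrier_vec N)"
    by (rule bij_betwI[where g = "\<lambda>v :: 'a vec. restrict (\<lambda>i. v $ i) {..<N}"])
      (auto simp: fun_eq_iff PiE_def extensional_def)
  then show "card (carrier_vec N :: 'a vec set) = card (UNIV :: 'a set) ^ N"
    "finite (carrier_vec N :: 'a vec set)"
    using bij_betw_same_card bij_betw_finite finite_PiE[of "{..<N}" "\<lambda>_. UNIV :: 'a set"]
    by (fastforce simp: card_PiE)+
qed

lemma card_subspace:
  fixes W :: "'a::{field,finite} vec set"
  assumes "subspace class_ring W (module_vec TYPE('a) N)"
  shows "card W = card (UNIV :: 'a set) ^ vectorspace.dim class_ring (module_vec TYPE('a) N\<lparr>carrier := W\<rparr>)"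
proof -
  interpret V: vec_space "TYPE('a)" N .
  interpret W: vectorspace class_ring "module_vec TYPE('a) N\<lparr>carrier := W\<rparr>"
    by (rule V.subspace_is_vs[OF assms])
  have "W \<subseteq> carrier_vec N"
    using assms submodule.subset[of class_ring W "module_vec TYPE('a) N"] unfolding subspace_def by simp
  then have "finite W" using finite_subset finite_carrier_vec by blast
  then show ?thesis using W.card_carrier_eq_power_dim by simp
qed

text \<open>Rank and nullity in terms of cardinalities: the image has |K|^rank elements and every
  fibre over it is a translate of the kernel.\<close>

lemma card_kernel_mult_rank:
  fixes H :: "'a::{field,finite} mat"
  assumes H: "H \<in> carrier_mat N N"
  shows "card {v\<in>carrier_vec N. H *\<^sub>v v = 0\<^sub>v N} * card (UNIV :: 'a set) ^ vec_space.rank N H = card (UNIV :: 'a set) ^ N"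
proof -
  interpret V: vec_space "TYPE('a)" N .
  let ?k = "card (UNIV :: 'a set)" and ?ker = "{v\<in>carrier_vec N. H *\<^sub>v v = 0\<^sub>v N}"
  let ?im = "V.span (set (cols H))"
  have cols: "set (cols H) \<subseteq> carrier_vec N" using H cols_dim by blast
  have im: "?im = (\<lambda>v. H *\<^sub>v v) ` carrier_vec N"
    using V.col_space_eq[OF H] H unfolding V.col_space_def by auto
  have "subspace class_ring ?im (module_vec TYPE('a) N)"
    using V.span_is_submodule[of "set (cols H)"] cols V.vectorspace_axioms by (simp add: subspace_def)
  then have im_card: "card ?im = ?k ^ V.rank H"
    unfolding V.rank_def by (rule card_subspace)
  have fibre: "card {v\<in>carrier_vec N. H *\<^sub>v v = w} = card ?ker" if w: "w \<in> ?im" for w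
  proof -
    obtain u where u: "u \<in> carrier_vec N" "w = H *\<^sub>v u" using w im by blast
    have "bij_betw (\<lambda>v. u + v) ?ker {v\<in>carrier_vec N. H *\<^sub>v v = w}"
    proof (rule bij_betwI[where g = "\<lambda>v. v - u"])
      show "(\<lambda>v. u + v) \<in> ?ker \<rightarrow> {v\<in>carrier_vec N. H *\<^sub>v v = w}"
      proof
        fix v assume v: "v \<in> ?ker"
        then have "H *\<^sub>v (u + v) = w + 0\<^sub>v N"
          using u by (simp add: mult_add_distrib_mat_vec[OF H])
        also have "\<dots> = w" using u H by simp
        finally show "u + v \<in> {v\<in>carrier_vec N. H *\<^sub>v v = w}" using u v by simp
      qed
      show "(\<lambda>v. v - u) \<in> {v\<in>carrier_vec N. H *\<^sub>v v = w} \<rightarrow> ?ker"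
      proof
        fix v assume v: "v \<in> {v\<in>carrier_vec N. H *\<^sub>v v = w}"
        then have "H *\<^sub>v (v - u) = w - w"
          using u by (simp add: mult_minus_distrib_mat_vec[OF H])
        also have "\<dots> = 0\<^sub>v N" using u H by simp
        finally show "v - u \<in> ?ker" using u v by simp
      qed
      show "u + v - u = v" if "v \<in> ?ker" for v
        by (rule eq_vecI) (use that u in auto)
      show "u + (v - u) = v" if "v \<in> {v\<in>carrier_vec N. H *\<^sub>v v = w}" for v
        by (rule eq_vecI) (use that u in auto)
    qed
    then show ?thesis by (rule bij_betw_same_card[symmetric])
  qed
  have "carrier_vec N = (\<Union>w\<in>?im. {v\<in>carrier_vec N. H *\<^sub>v v = w})"
    using im by auto
  then have "card (carrier_vec N :: 'a vec set) = card (\<Union>w\<in>?im. {v\<in>carrier_vec N. H *\<^sub>v v = w})"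
    by (rule arg_cong)
  also have "\<dots> = (\<Sum>w\<in>?im. card {v\<in>carrier_vec N. H *\<^sub>v v = w})"
    by (rule card_UN_disjoint) (auto simp: im)
  also have "\<dots> = card ?im * card ?ker"
    using fibre by simp
  finally show ?thesis
    by (simp add: im_card card_carrier_vec mult.commute)
qed

section \<open>Hermitian forms\<close>

locale hermitian_form = quadratic_field q ty for q :: nat and ty :: "'a::{field,finite} itself" +
  fixes N :: nat and H :: "'a mat"
  assumes H_carrier: "H \<in> carrier_mat N N"
    and H_conj: "i < N \<Longrightarrow> j < N \<Longrightarrow> H $$ (i, j) = (H $$ (j, i)) ^ q"
begin

definition B :: "'a vec \<Rightarrow> 'a vec \<Rightarrow> 'a" where
  "B u v = (\<Sum>i<N. \<Sum>j<N. H $$ (i, j) * u $ i * (v $ j) ^ q)"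

abbreviation h :: "'a vec \<Rightarrow> 'a" where "h u \<equiv> B u u"

lemma B_conj: "B v u = (B u v) ^ q"
proof -
  have "(B u v) ^ q = (\<Sum>i<N. \<Sum>j<N. (H $$ (i, j) * u $ i * (v $ j) ^ q) ^ q)"
    by (simp add: B_def frobenius_sum)
  also have "\<dots> = (\<Sum>i<N. \<Sum>j<N. H $$ (j, i) * v $ j * (u $ i) ^ q)"
  proof (intro sum.cong refl)
    fix i j assume "i \<in> {..<N}" "j \<in> {..<N}"
    then show "(H $$ (i, j) * u $ i * (v $ j) ^ q) ^ q = H $$ (j, i) * v $ j * (u $ i) ^ q"
      using H_conj[of j i] by (simp add: power_mult_distrib mult_ac)
  qed
  also have "\<dots> = B v u"
    unfolding B_def by (rule sum.swap)
  finally show ?thesis ..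
qed

text \<open>Represents the functional \<open>B _ v\<close> by the scalar product, so that linearity
  on the left is inherited from \<open>scalar_prod\<close>; \<open>B_conj\<close> then transfers it
  to the right side.\<close>

definition dual :: "'a vec \<Rightarrow> 'a vec" where
  "dual v = vec N (\<lambda>i. \<Sum>j<N. H $$ (i, j) * (v $ j) ^ q)"

lemma dual_carrier [simp]: "dual v \<in> carrier_vec N"
  by (simp add: dual_def)

lemma B_dual: "u \<in> carrier_vec N \<Longrightarrow> B u v = dual v \<bullet> u"
  by (simp add: B_def dual_def scalar_prod_def atLeast0LessThan sum_distrib_left sum_distrib_right mult_ac)

lemma B_add_left: "u \<in> carrier_vec N \<Longrightarrow> u' \<in> carrier_vec N \<Longrightarrow> B (u + u') v = B u v + B u' v"
  by (simp add: B_dual scalar_prod_add_distrib[of _ N])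

lemma B_smult_left: "u \<in> carrier_vec N \<Longrightarrow> B (c \<cdot>\<^sub>v u) v = c * B u v"
  by (simp add: B_dual)

lemma B_add_right: "u \<in> carrier_vec N \<Longrightarrow> u' \<in> carrier_vec N \<Longrightarrow> B v (u + u') = B v u + B v u'"
  by (simp add: B_conj[of v] B_add_left frobenius_add)

lemma B_smult_right: "u \<in> carrier_vec N \<Longrightarrow> B v (c \<cdot>\<^sub>v u) = c ^ q * B v u"
  by (simp add: B_conj[of v] B_smult_left power_mult_distrib)

lemma B_zero [simp]: "B (0\<^sub>v N) v = 0" "B v (0\<^sub>v N) = 0"
  using q_ge_2 by (simp_all add: B_conj[of v] B_dual)

lemma h_add: "u \<in> carrier_vec N \<Longrightarrow> v \<in> carrier_vec N \<Longrightarrow> h (u + v) = h u + B u v + (B u v) ^ q + h v"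
  by (simp add: B_add_left B_add_right B_conj[of v u])

lemma h_smult: "u \<in> carrier_vec N \<Longrightarrow> h (c \<cdot>\<^sub>v u) = c ^ (q + 1) * h u"
  by (simp add: B_smult_left B_smult_right)

lemma h_fixed: "(h u) ^ q = h u"
  using B_conj[of u u] by simp

lemma B_mult_mat_left:
  assumes "A \<in> carrier_mat N k" "x \<in> carrier_vec k"
  shows "B (A *\<^sub>v x) v = (\<Sum>i<k. x $ i * B (col A i) v)"
proof -
  have "B (A *\<^sub>v x) v = dual v \<bullet> (A *\<^sub>v x)" using assms by (simp add: B_dual)
  also have "\<dots> = (A\<^sup>T *\<^sub>v dual v) \<bullet> x"
    by (rule transpose_vec_mult_scalar[symmetric]) (use assms in auto)
  also have "\<dots> = (\<Sum>i<k. x $ i * B (col A i) v)"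
    unfolding scalar_prod_def atLeast0LessThan using assms
    by (intro sum.cong) (auto simp: B_dual col_carrier_vec comm_scalar_prod[of _ N] mult.commute)
  finally show ?thesis .
qed

text \<open>For isotropic u and v, h(c u + v) is the trace of c B(u, v). If B(u, v) were nonzero,
  scaling would make it an element of nonzero trace.\<close>

lemma polarization:
  assumes W: "\<And>v. v \<in> W \<Longrightarrow> v \<in> carrier_vec N" "\<And>v. v \<in> W \<Longrightarrow> h v = 0"
    "\<And>u v. u \<in> W \<Longrightarrow> v \<in> W \<Longrightarrow> u + v \<in> W" "\<And>u c. u \<in> W \<Longrightarrow> c \<cdot>\<^sub>v u \<in> W"
    and uv: "u \<in> W" "v \<in> W"
  shows "B u v = 0"
proof (rule ccontr)
  assume ne: "B u v \<noteq> 0"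
  obtain t :: 'a where t: "t + t ^ q \<noteq> 0" by (rule trace_nonzero)
  let ?u = "(t / B u v) \<cdot>\<^sub>v u"
  have "h (?u + v) = 0" "h ?u = 0" "h v = 0" using W uv by auto
  moreover have "B ?u v = t" using W(1)[OF uv(1)] ne by (simp add: B_smult_left)
  ultimately show False using h_add[of ?u v] W(1) uv t by simp
qed

section \<open>Orthonormal systems, the radical and the rank\<close>

definition orthonormal :: "nat \<Rightarrow> (nat \<Rightarrow> 'a vec) \<Rightarrow> bool" where
  "orthonormal k b \<longleftrightarrow> (\<forall>i<k. b i \<in> carrier_vec N) \<and>
     (\<forall>i<k. \<forall>j<k. B (b i) (b j) = (if i = j then 1 else 0))"

definition frame :: "nat \<Rightarrow> (nat \<Rightarrow> 'a vec) \<Rightarrow> 'a mat" where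
  "frame k b = mat_of_cols N (map b [0..<k])"

lemma frame_carrier [simp]: "frame k b \<in> carrier_mat N k"
  using mat_of_cols_carrier(1)[of N "map b [0..<k]"] by (simp add: frame_def)

lemma dim_frame [simp]: "dim_row (frame k b) = N" "dim_col (frame k b) = k"
  using frame_carrier by blast+

lemma frame_vec_carrier [simp]: "x \<in> carrier_vec k \<Longrightarrow> frame k b *\<^sub>v x \<in> carrier_vec N"
  by (rule mult_mat_vec_carrier[OF frame_carrier])

lemma B_frame_left:
  assumes "orthonormal k b" "x \<in> carrier_vec k"
  shows "B (frame k b *\<^sub>v x) v = (\<Sum>i<k. x $ i * B (b i) v)"
proof -
  have "col (frame k b) i = b i" if "i < k" for i
    using assms(1) that by (simp add: frame_def orthonormal_def)
  then show ?thesis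
    by (simp add: B_mult_mat_left[OF frame_carrier assms(2)])
qed

lemma B_frame_basis:
  assumes "orthonormal k b" "x \<in> carrier_vec k" "j < k"
  shows "B (frame k b *\<^sub>v x) (b j) = x $ j"
proof -
  have "B (frame k b *\<^sub>v x) (b j) = (\<Sum>i<k. if i = j then x $ j else 0)"
    unfolding B_frame_left[OF assms(1,2)]
    using assms by (intro sum.cong) (auto simp: orthonormal_def)
  then show ?thesis using assms(3) by simp
qed

lemma h_frame:
  assumes "orthonormal k b" "x \<in> carrier_vec k"
  shows "h (frame k b *\<^sub>v x) = (\<Sum>i<k. (x $ i) ^ (q + 1))"
proof -
  have "B (b i) (frame k b *\<^sub>v x) = (x $ i) ^ q" if "i < k" for i
    using B_frame_basis[OF assms that] by (simp add: B_conj[of "b i"])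
  then show ?thesis
    by (simp add: B_frame_left[OF assms])
qed

text \<open>Pairing with the basis vectors recovers the coordinates, so K^k embeds into K^N.\<close>

lemma orthonormal_le:
  assumes "orthonormal k b"
  shows "k \<le> N"
proof -
  have "inj_on (\<lambda>x. frame k b *\<^sub>v x) (carrier_vec k)"
  proof (rule inj_onI)
    fix x y :: "'a vec" assume "x \<in> carrier_vec k" "y \<in> carrier_vec k" "frame k b *\<^sub>v x = frame k b *\<^sub>v y"
    then show "x = y"
      using B_frame_basis[OF assms, of x] B_frame_basis[OF assms, of y]
      by (intro eq_vecI) auto
  qed
  then have "card (carrier_vec k :: 'a vec set) \<le> card (carrier_vec N :: 'a vec set)"
    by (rule card_inj_on_le) auto
  then have "(q\<^sup>2) ^ k \<le> (q\<^sup>2) ^ N"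
    by (simp only: card_carrier_vec card_field)
  then show ?thesis
    using q_sq_gt(2) by (rule power_le_imp_le_exp[rotated])
qed

definition radical :: "'a vec set" where
  "radical = {v \<in> carrier_vec N. \<forall>u\<in>carrier_vec N. B u v = 0}"

text \<open>A maximal orthonormal system spans a complement of the radical: an anisotropic vector orthogonal
  to it could be normalized and added.\<close>

lemma orthonormal_decomposition:
  obtains k b where "orthonormal k b"
    "bij_betw (\<lambda>(x, w). frame k b *\<^sub>v x + w) (carrier_vec k \<times> radical) (carrier_vec N)"
proof -
  have "orthonormal 0 (\<lambda>_. 0\<^sub>v N)" by (simp add: orthonormal_def)
  then have "\<exists>b. orthonormal 0 b" by blast
  moreover have "\<And>k. \<exists>b. orthonormal k b \<Longrightarrow> k \<le> N" using orthonormal_le by blast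
  ultimately obtain k where k: "\<exists>b. orthonormal k b" "\<And>l. \<exists>b. orthonormal l b \<Longrightarrow> l \<le> k"
    using Nat.ex_has_greatest_nat[of "\<lambda>k. \<exists>b. orthonormal k b" 0 N] by blast
  then obtain b where b: "orthonormal k b" by blast
  define W where "W = {v \<in> carrier_vec N. \<forall>i<k. B v (b i) = 0}"
  have bc: "b i \<in> carrier_vec N" if "i < k" for i using b that by (simp add: orthonormal_def)
  have h0: "h w = 0" if w: "w \<in> W" for w
  proof (rule ccontr)
    assume ne: "h w \<noteq> 0"
    \<comment> \<open>Values of h are fixed by the Frobenius map, hence so is the inverse, which is
      therefore a norm; this permits scaling w to length 1.\<close>
    have "(1 / h w) ^ q = 1 / h w" by (simp add: power_one_over h_fixed)
    then obtain t where t: "t \<noteq> 0" "t ^ (q + 1) = 1 / h w" using norm_surj ne by (metis divide_eq_0_iff zero_neq_one)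
    have wc: "w \<in> carrier_vec N" using w by (simp add: W_def)
    let ?b = "b(k := t \<cdot>\<^sub>v w)"
    have hb: "h (t \<cdot>\<^sub>v w) = 1" unfolding h_smult[OF wc] t(2) using ne by simp
    have o: "B (t \<cdot>\<^sub>v w) (b i) = 0" "B (b i) (t \<cdot>\<^sub>v w) = 0" if "i < k" for i
      using w that wc q_ge_2 by (auto simp: W_def B_smult_left B_conj[of "b i"])
    have "orthonormal (Suc k) ?b"
      using b hb o wc bc unfolding orthonormal_def by (auto simp: less_Suc_eq)
    then show False using k(2)[of "Suc k"] by auto
  qed
  have W0: "B u w = 0" if "u \<in> W" "w \<in> W" for u w
    using polarization[of W u w] h0 that unfolding W_def
    by (auto simp: B_add_left B_smult_left)
  \<comment> \<open>Orthogonal projection: the pairings with the basis vectors are the coordinates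
    to be subtracted.\<close>
  have split: "\<exists>x\<in>carrier_vec k. \<exists>w\<in>W. v = frame k b *\<^sub>v x + w" if v: "v \<in> carrier_vec N" for v
  proof -
    let ?x = "vec k (\<lambda>i. B v (b i))"
    let ?w = "v + (- 1) \<cdot>\<^sub>v (frame k b *\<^sub>v ?x)"
    have x: "?x \<in> carrier_vec k" by simp
    have "B ?w (b i) = 0" if "i < k" for i
      using B_frame_basis[OF b x that] v that frame_vec_carrier[OF x, of b]
      by (simp add: B_add_left B_smult_left)
    then have "?w \<in> W" using v by (simp add: W_def)
    moreover have "v = frame k b *\<^sub>v ?x + ?w"
      by (rule eq_vecI) (use v frame_vec_carrier[OF x, of b] in auto)
    ultimately show ?thesis using x by blast
  qed
  \<comment> \<open>W is orthogonal to the system and, being totally isotropic, to itself; together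
    these span everything.\<close>
  have "W = radical"
  proof (intro equalityI subsetI)
    fix w assume w: "w \<in> W"
    have "B u w = 0" if u: "u \<in> carrier_vec N" for u
    proof -
      obtain x w' where x: "x \<in> carrier_vec k" "w' \<in> W" "u = frame k b *\<^sub>v x + w'" using split[OF u] by blast
      have "B (b i) w = 0" if "i < k" for i
        using w that q_ge_2 by (simp add: B_conj[of "b i"] W_def)
      then show ?thesis
        using x w W0[of w' w] by (simp add: B_add_left W_def B_frame_left[OF b])
    qed
    then show "w \<in> radical" using w by (simp add: radical_def W_def)
  next
    fix w assume w: "w \<in> radical"
    then have "B w (b i) = 0" if "i < k" for i
      using bc[OF that] q_ge_2 by (simp add: B_conj[of w] radical_def)
    then show "w \<in> W" using w by (simp add: radical_def W_def)
  qed
  moreover have "bij_betw (\<lambda>(x, w). frame k b *\<^sub>v x + w) (carrier_vec k \<times> W) (carrier_vec N)"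
    unfolding bij_betw_def
  proof
    show "inj_on (\<lambda>(x, w). frame k b *\<^sub>v x + w) (carrier_vec k \<times> W)"
    proof (rule inj_onI, clarsimp)
      fix x w y w'
      assume *: "x \<in> carrier_vec k" "w \<in> W" "y \<in> carrier_vec k" "w' \<in> W"
        "frame k b *\<^sub>v x + w = frame k b *\<^sub>v y + w'"
      have co: "B (frame k b *\<^sub>v x + w) (b j) = x $ j" if "x \<in> carrier_vec k" "w \<in> W" "j < k" for x w j
        using that by (simp add: B_add_left W_def B_frame_basis[OF b])
      have xy: "x = y"
      proof (rule eq_vecI)
        fix j assume j: "j < dim_vec y"
        then show "x $ j = y $ j" using co[of x w j] co[of y w' j] * by simp
      qed (use * in auto)
      moreover have "w = w'"
      proof (rule eq_vecI)
        have wc: "w \<in> carrier_vec N" "w' \<in> carrier_vec N" using * by (auto simp: W_def)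
        fix j assume j: "j < dim_vec w'"
        have "(frame k b *\<^sub>v x + w) $ j = (frame k b *\<^sub>v x + w') $ j" using * xy by simp
        then show "w $ j = w' $ j" using j wc by simp
      qed (use * in \<open>auto simp: W_def\<close>)
      ultimately show "x = y \<and> w = w'" by simp
    qed
    have "frame k b *\<^sub>v x + w \<in> carrier_vec N" if "x \<in> carrier_vec k" "w \<in> W" for x w
      using that by (simp add: W_def)
    then show "(\<lambda>(x, w). frame k b *\<^sub>v x + w) ` (carrier_vec k \<times> W) = carrier_vec N"
      using split by (auto simp: image_iff)
  qed
  ultimately show ?thesis using that b by blast
qed

lemma h_decomposition:
  assumes "orthonormal k b" "x \<in> carrier_vec k" "w \<in> radical"
  shows "h (frame k b *\<^sub>v x + w) = (\<Sum>i<k. (x $ i) ^ (q + 1))"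
proof -
  have w: "w \<in> carrier_vec N" "B u w = 0" if "u \<in> carrier_vec N" for u
    using assms(3) that by (auto simp: radical_def)
  have f: "frame k b *\<^sub>v x \<in> carrier_vec N" using assms(2) by simp
  show ?thesis
    using h_add[OF f w(1)[OF f]] w(2)[OF f] w(2)[OF w(1)[OF f]] h_frame[OF assms(1,2)] q_ge_2
    by simp
qed

text \<open>The entrywise q-th power is an involution that exchanges the radical with the kernel of
  H. It is only semilinear, but a bijection is enough for the cardinality.\<close>

lemma card_radical: "card radical * card (UNIV :: 'a set) ^ vec_space.rank N H = card (UNIV :: 'a set) ^ N"
proof -
  let ?ker = "{v\<in>carrier_vec N. H *\<^sub>v v = 0\<^sub>v N}"
  let ?F = "map_vec (\<lambda>x::'a. x ^ q)"
  have FF: "?F (?F v) = v" for v :: "'a vec"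
    by (rule eq_vecI) auto
  have d: "H *\<^sub>v ?F v = dual v" if "v \<in> carrier_vec N" for v
    using H_carrier that
    by (intro eq_vecI) (auto simp: dual_def scalar_prod_def atLeast0LessThan)
  have "v \<in> radical \<longleftrightarrow> dual v = 0\<^sub>v N" if "v \<in> carrier_vec N" for v
  proof
    assume v: "v \<in> radical"
    show "dual v = 0\<^sub>v N"
    proof (rule eq_vecI)
      fix i assume i: "i < dim_vec (0\<^sub>v N :: 'a vec)"
      then have "dual v $ i = B (unit_vec N i) v" by (simp add: B_dual)
      then show "dual v $ i = 0\<^sub>v N $ i" using v i by (simp add: radical_def)
    qed (simp add: dual_def)
  qed (use that in \<open>simp add: radical_def B_dual\<close>)
  then have rad: "radical = {v\<in>carrier_vec N. dual v = 0\<^sub>v N}" by (auto simp: radical_def)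
  have "bij_betw ?F radical ?ker"
  proof (rule bij_betwI[where g = ?F])
    show "?F \<in> ?ker \<rightarrow> radical"
    proof
      fix v assume v: "v \<in> ?ker"
      have "dual (?F v) = H *\<^sub>v ?F (?F v)" using v by (intro d[symmetric]) simp
      also have "\<dots> = 0\<^sub>v N" using v by (simp only: FF) simp
      finally show "?F v \<in> radical" using v by (simp add: rad)
    qed
  qed (use FF d in \<open>auto simp: rad\<close>)
  then have "card radical = card ?ker" by (rule bij_betw_same_card)
  then show ?thesis using card_kernel_mult_rank[OF H_carrier] by simp
qed

text \<open>Both |K|^k and |K|^rank are |K|^N divided by the size of the radical.\<close>

lemma rank_decomposition:
  assumes "bij_betw (\<lambda>(x, w). frame k b *\<^sub>v x + w) (carrier_vec k \<times> radical) (carrier_vec N)"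
  shows "vec_space.rank N H = k"
proof -
  let ?c = "card (UNIV :: 'a set)"
  have "?c ^ k * card radical = ?c ^ N"
    using bij_betw_same_card[OF assms] by (simp add: card_cartesian_product card_carrier_vec)
  then have "card radical * ?c ^ vec_space.rank N H = card radical * ?c ^ k"
    using card_radical by (simp add: mult.commute)
  moreover have "card radical > 0"
    using \<open>?c ^ k * card radical = ?c ^ N\<close> q_ge_2 by (cases "card radical") (auto simp: card_field)
  ultimately have "?c ^ vec_space.rank N H = ?c ^ k" by simp
  then show ?thesis
    using q_sq_gt(2) by (simp only: card_field power_inject_exp)
qed

lemma orthonormal_mono: "orthonormal k b \<Longrightarrow> l \<le> k \<Longrightarrow> orthonormal l b"
  by (simp add: orthonormal_def)

section \<open>Anisotropic vectors orthogonal to a given vector\<close>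

lemma perp_closed:
  assumes "\<And>u. u \<in> carrier_vec N \<Longrightarrow> B u v = 0 \<Longrightarrow> h u = 0"
    and "u \<in> carrier_vec N" "B u v = 0" "u' \<in> carrier_vec N" "B u' v = 0"
  shows "B u u' = 0"
  by (rule polarization[of "{u \<in> carrier_vec N. B u v = 0}"])
    (use assms in \<open>auto simp: B_add_left B_smult_left\<close>)

text \<open>Otherwise the complement of v is totally isotropic. Projecting b_0 and b_1 into it gives
  B(b_i, b_j) = B(b_i, v) B(v, b_j) / h(v), which would make the 2 by 2 identity matrix a matrix of
  rank at most 1.\<close>

lemma perp_anisotropic_nonisotropic:
  assumes b: "orthonormal 2 b" and v: "v \<in> carrier_vec N" "h v \<noteq> 0"
  obtains u where "u \<in> carrier_vec N" "B u v = 0" "h u \<noteq> 0"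
proof (rule ccontr)
  assume "\<not> thesis"
  with that have *: "h u = 0" if "u \<in> carrier_vec N" "B u v = 0" for u using that by blast
  have bc: "b i \<in> carrier_vec N" if "i < 2" for i using b that by (simp add: orthonormal_def)
  define u where "u i = b i + (- B (b i) v / h v) \<cdot>\<^sub>v v" for i
  have u: "u i \<in> carrier_vec N" "B (u i) v = 0" if "i < 2" for i
    using bc[OF that] v by (simp_all add: u_def B_add_left B_smult_left)
  have e: "(if i = j then 1 else 0) = B (b i) v * B v (b j) / h v" if ij: "i < 2" "j < 2" for i j
  proof -
    have "0 = B (u i) (u j)"
      by (rule perp_closed[OF *, symmetric]) (use u ij in auto)
    also have "\<dots> = B (u i) (b j)"
      using u[OF ij(1)] bc[OF ij(2)] v by (subst u_def[of j]) (simp add: B_add_right B_smult_right)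
    also have "\<dots> = B (b i) (b j) - B (b i) v * B v (b j) / h v"
      using bc[OF ij(1)] v by (simp add: u_def B_add_left B_smult_left)
    finally show ?thesis using b ij by (simp add: orthonormal_def)
  qed
  have "B (b 0) v * B v (b 1) = 0" using e[of 0 1] v by simp
  then show False using e[of 0 0] e[of 1 1] by auto
qed

text \<open>An isotropic v admits no projection into its complement, so three basis vectors are
  combined in pairs instead. If the complement were totally isotropic, all B(b_i, v) would be
  nonzero, and then \<open>u 0 1\<close> and \<open>u 1 2\<close> lie in it without being
  orthogonal, as they share b_1.\<close>

lemma perp_anisotropic_isotropic:
  assumes b: "orthonormal 3 b" and v: "v \<in> carrier_vec N"
  obtains u where "u \<in> carrier_vec N" "B u v = 0" "h u \<noteq> 0"
proof (rule ccontr)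
  assume "\<not> thesis"
  with that have *: "h u = 0" if "u \<in> carrier_vec N" "B u v = 0" for u using that by blast
  have bc: "b i \<in> carrier_vec N" if "i < 3" for i using b that by (simp add: orthonormal_def)
  have bb: "B (b i) (b j) = (if i = j then 1 else 0)" if "i < 3" "j < 3" for i j
    using b that by (simp add: orthonormal_def)
  have ne: "B (b i) v \<noteq> 0" if "i < 3" for i
    using *[OF bc[OF that]] bb[OF that that] by auto
  define u where "u i j = B (b j) v \<cdot>\<^sub>v b i + (- B (b i) v) \<cdot>\<^sub>v b j" for i j
  have u: "u i j \<in> carrier_vec N" "B (u i j) v = 0" if "i < 3" "j < 3" for i j
    using bc that by (simp_all add: u_def B_add_left B_smult_left)
  have "0 = B (u 0 1) (u 1 2)"
    by (rule perp_closed[OF *, symmetric]) (use u in auto)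
  also have "\<dots> = - B (b 0) v * (B (b 2) v) ^ q"
    using bc bb by (simp add: u_def B_add_left B_smult_left B_add_right B_smult_right)
  finally show False using ne[of 0] ne[of 2] by simp
qed

text \<open>If \<open>h v \<noteq> 0\<close>, choose an anisotropic \<open>u\<close> orthogonal to \<open>v\<close>: the line \<open>v + tu\<close> carries \<open>q + 1\<close>
  isotropic points, too many for a polynomial of degree at most \<open>q\<close>.\<close>

lemma isotropic_nonvanishing:
  assumes b: "orthonormal 2 b" and f: "homogeneous N d f" "d \<le> q" and v: "v \<in> carrier_vec N" "f v \<noteq> 0"
  obtains u where "u \<in> carrier_vec N" "h u = 0" "f u \<noteq> 0"
proof (cases "h v = 0")
  case True
  then show ?thesis using that v by blast
next
  case False
  then obtain u where u: "u \<in> carrier_vec N" "B u v = 0" "h u \<noteq> 0"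
    using perp_anisotropic_nonisotropic[OF b v(1)] by blast
  have vu: "B v u = 0" using u(2) q_ge_2 by (simp add: B_conj[of v])
  obtain c where c: "c 0 = f v" "\<And>t. f (v + t \<cdot>\<^sub>v u) = (\<Sum>i\<le>d. c i * t ^ i)"
    using homogeneous_line[OF f(1) v(1) u(1)] by blast
  \<comment> \<open>As u and v are orthogonal, h(v + t u) = h(v) + t^(q+1) h(u); \<open>?T\<close>
    is the set of its zeros.\<close>
  let ?T = "{t. t ^ (q + 1) = - h v / h u}" and ?R = "{t. (\<Sum>i\<le>d. c i * t ^ i) = 0}"
  have "card ?R \<le> d"
    by (rule card_power_sum_roots_le[of 0]) (use c v in auto)
  also have "d < q + 1" using f(2) by simp
  also have "q + 1 = card ?T"
    by (rule card_norm_fibre[symmetric])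
      (use False u(3) in \<open>simp_all add: power_divide frobenius_minus h_fixed\<close>)
  finally have "\<not> ?T \<subseteq> ?R"
    using card_mono[of ?R ?T] by auto
  then obtain t where t: "t ^ (q + 1) = - h v / h u" "f (v + t \<cdot>\<^sub>v u) \<noteq> 0" using c by auto
  have "h (v + t \<cdot>\<^sub>v u) = h v + t ^ (q + 1) * h u"
    using h_add[OF v(1), of "t \<cdot>\<^sub>v u"] h_smult[OF u(1), of t] u v vu q_ge_2
    by (simp add: B_smult_right)
  then have "h (v + t \<cdot>\<^sub>v u) = 0" unfolding t(1) using u(3) by simp
  then show ?thesis using that[of "v + t \<cdot>\<^sub>v u"] t(2) u v by simp
qed

text \<open>A Bezout type bound: choose an isotropic vector \<open>Q\<close> outside the hypersurface and an anisotropic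
  vector \<open>u\<close> orthogonal to it, and average the bound for plane sections over all translates of
  the plane spanned by \<open>Q\<close> and \<open>u\<close>.\<close>

lemma card_isotropic_zeros_le:
  assumes b: "orthonormal 3 b" and f: "homogeneous N d f" "d \<le> q" and v: "v \<in> carrier_vec N" "f v \<noteq> 0"
  shows "card {x \<in> carrier_vec N. h x = 0 \<and> f x = 0} \<le> d * (q + 1) * q ^ (2 * (N - 2))"
proof -
  obtain Q where Q: "Q \<in> carrier_vec N" "h Q = 0" "f Q \<noteq> 0"
    using isotropic_nonvanishing[OF orthonormal_mono[OF b] f v] by auto
  obtain u where u: "u \<in> carrier_vec N" "B u Q = 0" "h u \<noteq> 0"
    using perp_anisotropic_isotropic[OF b Q(1)] by blast
  have Qu: "B Q u = 0" using u(2) q_ge_2 by (simp add: B_conj[of Q])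
  let ?Z = "{x \<in> carrier_vec N. h x = 0 \<and> f x = 0}"
  let ?p = "\<lambda>(x, y). y \<cdot>\<^sub>v Q + x \<cdot>\<^sub>v u"
  have plane: "card {p. ?p p + w \<in> ?Z} \<le> d * (q + 1)" if w: "w \<in> carrier_vec N" for w
  proof -
    obtain g where g: "weight_lt q (d * (q + 1)) g"
      "\<forall>x y. f (y \<cdot>\<^sub>v Q + x \<cdot>\<^sub>v u + w) = f Q * y ^ d + g x y"
      using homogeneous_weight[OF f(1) Q(1) u(1) w] by blast
    \<comment> \<open>What remains of h(y Q + x u + w) besides the terms in x^(q+1) and y^q. There
      is no y^(q+1) because h(Q) = 0, and no mixed term because Q and u are orthogonal. The heaviest
      remaining term, x^q, has weight q^2.\<close>
    define g' where "g' = (\<lambda>x y :: 'a. (B u w) ^ q * x ^ q * y ^ 0 + (B u w * x ^ 1 * y ^ 0 +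
      (B Q w * x ^ 0 * y ^ 1 + h w * x ^ 0 * y ^ 0)))"
    have q2: "Suc 0 < q * q" using q_sq_gt(2) by (simp add: power2_eq_square)
    have g': "weight_lt q (q * (q + 1)) g'"
      unfolding g'_def using q_ge_2 q2 by (intro weight_lt_add weight_lt_monomial) auto
    show ?thesis
    proof (rule card_plane_section_le[OF g(1) Q(3) _ g' u(3), where b = "(B Q w) ^ q"])
      fix x y assume "(x, y) \<in> {p. ?p p + w \<in> ?Z}"
      then have *: "h (y \<cdot>\<^sub>v Q + x \<cdot>\<^sub>v u + w) = 0" "f (y \<cdot>\<^sub>v Q + x \<cdot>\<^sub>v u + w) = 0" by auto
      show "f Q * y ^ d + g x y = 0" using g(2) *(2) by simp
      have "h (y \<cdot>\<^sub>v Q + x \<cdot>\<^sub>v u) = x ^ (q + 1) * h u"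
        using h_add[of "y \<cdot>\<^sub>v Q" "x \<cdot>\<^sub>v u"] h_smult[OF u(1), of x] h_smult[OF Q(1), of y] Q u Qu q_ge_2
        by (simp add: B_smult_right B_smult_left)
      moreover have "B (y \<cdot>\<^sub>v Q + x \<cdot>\<^sub>v u) w = y * B Q w + x * B u w"
        using Q u by (simp add: B_add_left B_smult_left)
      ultimately have "0 = x ^ (q + 1) * h u + (y * B Q w + x * B u w) + (y * B Q w + x * B u w) ^ q + h w"
        using h_add[of "y \<cdot>\<^sub>v Q + x \<cdot>\<^sub>v u" w] Q u w *(1) by simp
      then show "h u * x ^ (q + 1) + (B Q w) ^ q * y ^ q + g' x y = 0"
        by (simp add: frobenius_add power_mult_distrib g'_def algebra_simps)
    qed
  qed
  have p: "?p p \<in> carrier_vec N" for p using Q u by (auto split: prod.split)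
  have shift: "card {w \<in> carrier_vec N. ?p p + w \<in> ?Z} = card ?Z" for p
  proof -
    have "bij_betw (\<lambda>w. ?p p + w) {w \<in> carrier_vec N. ?p p + w \<in> ?Z} ?Z"
    proof (rule bij_betwI[where g = "\<lambda>x. x - ?p p"])
      have e: "?p p + (x - ?p p) = x" if "x \<in> carrier_vec N" for x
        by (rule eq_vecI) (use that p[of p] in auto)
      then show "?p p + (x - ?p p) = x" if "x \<in> ?Z" for x
        using that by blast
      show "(\<lambda>x. x - ?p p) \<in> ?Z \<rightarrow> {w \<in> carrier_vec N. ?p p + w \<in> ?Z}"
      proof
        fix x assume x: "x \<in> ?Z"
        then have "x - ?p p \<in> carrier_vec N" using p[of p] by (intro minus_carrier_vec) auto
        moreover have "?p p + (x - ?p p) \<in> ?Z" using e[of x] x by simp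
        ultimately show "x - ?p p \<in> {w \<in> carrier_vec N. ?p p + w \<in> ?Z}" by blast
      qed
      show "?p p + w - ?p p = w" if "w \<in> {w \<in> carrier_vec N. ?p p + w \<in> ?Z}" for w
        by (rule eq_vecI) (use that p[of p] in auto)
    qed auto
    then show ?thesis by (rule bij_betw_same_card)
  qed
  \<comment> \<open>Double counting of the pairs of a translation w and plane parameters p: for each
    of the q^4 values of p, exactly |Z| translations lead to a zero.\<close>
  have "(\<Sum>w\<in>carrier_vec N. card {p \<in> UNIV. ?p p + w \<in> ?Z}) = (\<Sum>p\<in>(UNIV :: ('a \<times> 'a) set). card ?Z)"
    by (rule sum_multicount_gen[of "carrier_vec N" UNIV "\<lambda>w p. ?p p + w \<in> ?Z" "\<lambda>_. card ?Z"])
      (simp_all only: finite_carrier_vec finite_UNIV shift ball_simps simp_thms)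
  moreover have "card (UNIV :: ('a \<times> 'a) set) = (q\<^sup>2)\<^sup>2"
    using card_cartesian_product[of "UNIV :: 'a set" "UNIV :: 'a set"]
    by (simp only: UNIV_Times_UNIV card_field power2_eq_square[of "q\<^sup>2"])
  ultimately have "(q\<^sup>2)\<^sup>2 * card ?Z = (\<Sum>w\<in>carrier_vec N. card {p. ?p p + w \<in> ?Z})"
    by (simp only: sum_constant of_nat_id UNIV_I simp_thms)
  also have "\<dots> \<le> (\<Sum>w\<in>(carrier_vec N :: 'a vec set). d * (q + 1))"
    by (rule sum_mono) (use plane in blast)
  also have "\<dots> = (q\<^sup>2) ^ N * (d * (q + 1))"
    by (simp only: sum_constant card_carrier_vec card_field of_nat_id)
  also have "N = 2 + (N - 2)" using orthonormal_le[OF b] by simp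
  then have "(q\<^sup>2) ^ N = (q\<^sup>2)\<^sup>2 * q ^ (2 * (N - 2))"
    by (metis power_add power_mult)
  finally have "(q\<^sup>2)\<^sup>2 * card ?Z \<le> (q\<^sup>2)\<^sup>2 * (d * (q + 1) * q ^ (2 * (N - 2)))"
    by (simp only: mult_ac)
  then show ?thesis
    using q_ge_2 by (subst (asm) mult_le_cancel1) auto
qed

end

section \<open>Rational points\<close>

context quadratic_field
begin

text \<open>Splitting off one coordinate a leaves a^(q+1) = - S. There is one solution if S = 0, and
  a full norm fibre of q + 1 elements otherwise, since S is fixed by the Frobenius map.\<close>

lemma card_diagonal_zeros_Suc:
  "card {x \<in> carrier_vec (Suc r) :: 'a vec set. (\<Sum>i<Suc r. (x $ i) ^ (q + 1)) = 0} =
   card {x \<in> carrier_vec r :: 'a vec set. (\<Sum>i<r. (x $ i) ^ (q + 1)) = 0} +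
   (q + 1) * ((q\<^sup>2) ^ r - card {x \<in> carrier_vec r :: 'a vec set. (\<Sum>i<r. (x $ i) ^ (q + 1)) = 0})"
proof -
  define S where "S r x = (\<Sum>i<r. (x $ i) ^ (q + 1))" for r and x :: "'a vec"
  let ?Z = "\<lambda>r. {x \<in> carrier_vec r. S r x = 0}"
  let ?W = "{x \<in> carrier_vec r. S r x \<noteq> 0}"
  let ?T = "\<lambda>x. {a. a ^ (q + 1) + S r x = 0}"
  have S_Cons: "S (Suc r) (vCons a x) = a ^ (q + 1) + S r x" for a x
    unfolding S_def by (subst sum.lessThan_Suc_shift) simp
  have "bij_betw (\<lambda>(x, a). vCons a x) (SIGMA x:carrier_vec r. ?T x) (?Z (Suc r))"
  proof (rule bij_betwI[where g = "\<lambda>v :: 'a vec. (vec r (\<lambda>i. v $ Suc i), v $ 0)"])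
    have e: "vCons (v $ 0) (vec r (\<lambda>i. v $ Suc i)) = v" if "v \<in> carrier_vec (Suc r)" for v :: "'a vec"
      by (rule eq_vecI) (use that in \<open>auto simp: vec_index_vCons\<close>)
    show "(\<lambda>(x, a). vCons a x) \<in> (SIGMA x:carrier_vec r. ?T x) \<rightarrow> ?Z (Suc r)"
      by (auto simp: S_Cons simp del: power_Suc)
    show "(\<lambda>v :: 'a vec. (vec r (\<lambda>i. v $ Suc i), v $ 0)) \<in> ?Z (Suc r) \<rightarrow> (SIGMA x:carrier_vec r. ?T x)"
    proof
      fix v :: "'a vec" assume v: "v \<in> ?Z (Suc r)"
      then have "S (Suc r) (vCons (v $ 0) (vec r (\<lambda>i. v $ Suc i))) = 0" by (simp add: e)
      then show "(vec r (\<lambda>i. v $ Suc i), v $ 0) \<in> (SIGMA x:carrier_vec r. ?T x)"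
        unfolding S_Cons by simp
    qed
    show "(\<lambda>v :: 'a vec. (vec r (\<lambda>i. v $ Suc i), v $ 0)) ((\<lambda>(x, a). vCons a x) p) = p"
      if "p \<in> (SIGMA x:carrier_vec r. ?T x)" for p
      using that by (auto intro!: eq_vecI)
    show "(\<lambda>(x, a). vCons a x) (vec r (\<lambda>i. v $ Suc i), v $ 0) = v" if "v \<in> ?Z (Suc r)" for v :: "'a vec"
      using that e by simp
  qed
  then have "card (?Z (Suc r)) = card (SIGMA x:carrier_vec r. ?T x)"
    by (rule bij_betw_same_card[symmetric])
  also have "\<dots> = (\<Sum>x\<in>carrier_vec r. card (?T x))"
    by (rule card_SigmaI) auto
  also have "\<dots> = (\<Sum>x\<in>carrier_vec r. if S r x = 0 then 1 else q + 1)"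
  proof (rule sum.cong[OF refl])
    fix x :: "'a vec"
    have f: "S r x ^ q = S r x"
      unfolding S_def frobenius_sum using norm_fixed by (intro sum.cong) auto
    have T: "?T x = {a. a ^ (q + 1) = - S r x}" by (simp only: eq_neg_iff_add_eq_0)
    show "card (?T x) = (if S r x = 0 then 1 else q + 1)"
    proof (cases "S r x = 0")
      case True
      then have "?T x = {0}" unfolding T by auto
      then show ?thesis using True by simp
    next
      case False
      then show ?thesis unfolding T
        using card_norm_fibre[of "- S r x"] by (simp add: frobenius_minus f)
    qed
  qed
  also have "\<dots> = (\<Sum>x\<in>?Z r. 1) + (\<Sum>x\<in>?W. q + 1)"
    by (subst sum.If_cases) (auto simp: Int_def)
  also have "card ?W = (q\<^sup>2) ^ r - card (?Z r)"
  proof -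
    have "?W = carrier_vec r - ?Z r" by auto
    then have "card ?W = card (carrier_vec r :: 'a vec set) - card (?Z r)"
      by (simp add: card_Diff_subset)
    then show ?thesis by (simp only: card_carrier_vec card_field)
  qed
  then have "(\<Sum>x\<in>?Z r. 1) + (\<Sum>x\<in>?W. q + 1) = card (?Z r) + (q + 1) * ((q\<^sup>2) ^ r - card (?Z r))"
    by (simp only: sum_constant of_nat_id mult_1_right mult.commute)
  finally show ?thesis by (simp only: S_def)
qed

text \<open>Solves the recursion z' = (q + 1) q^(2r) - q z. The factor q clears the exponents 2r - 1
  and r - 1, so that r = 0 is covered.\<close>

lemma card_diagonal_zeros:
  "int q * int (card {x \<in> carrier_vec r :: 'a vec set. (\<Sum>i<r. (x $ i) ^ (q + 1)) = 0}) =
   int q ^ (2 * r) + (- 1) ^ r * (int q ^ Suc r - int q ^ r)"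
proof (induction r)
  case 0
  have "x = 0\<^sub>v 0" if "x \<in> carrier_vec 0" for x :: "'a vec"
    by (rule eq_vecI) (use that in auto)
  then have "{x \<in> carrier_vec 0 :: 'a vec set. (\<Sum>i<0. (x $ i) ^ (q + 1)) = 0} = {0\<^sub>v 0}"
    by auto
  then show ?case by simp
next
  case (Suc r)
  define z where "z = card {x \<in> carrier_vec r :: 'a vec set. (\<Sum>i<r. (x $ i) ^ (q + 1)) = 0}"
  define z' where "z' = card {x \<in> carrier_vec (Suc r) :: 'a vec set. (\<Sum>i<Suc r. (x $ i) ^ (q + 1)) = 0}"
  have "z \<le> card (carrier_vec r :: 'a vec set)" unfolding z_def by (rule card_mono) auto
  then have le: "z \<le> q ^ (2 * r)" by (simp only: card_carrier_vec card_field power_mult)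
  have "z' = z + (q + 1) * (q ^ (2 * r) - z)"
    unfolding z_def z'_def card_diagonal_zeros_Suc by (simp only: power_mult)
  then have "int z' = int z + (int q + 1) * (int q ^ (2 * r) - int z)"
    by (simp only: of_nat_add of_nat_mult of_nat_diff[OF le] of_nat_power of_nat_1)
  then have "int q * int z' = (int q + 1) * int q * int q ^ (2 * r) - int q * (int q * int z)"
    by (simp only: ring_distribs mult_ac mult_1_left)
  also have "int q * int z = int q ^ (2 * r) + (- 1) ^ r * (int q ^ Suc r - int q ^ r)"
    unfolding z_def by (rule Suc.IH)
  finally show ?case
    unfolding z'_def by (simp add: algebra_simps)
qed

lemma card_projective:
  assumes Z: "Z \<subseteq> carrier_vec (n + 1)" "0\<^sub>v (n + 1) \<in> Z"
    and scale: "\<And>x t. x \<in> Z \<Longrightarrow> (t :: 'a) \<noteq> 0 \<Longrightarrow> t \<cdot>\<^sub>v x \<in> Z"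
  shows "card Z = 1 + (q\<^sup>2 - 1) * card (Z \<inter> proj_space n)"
proof -
  let ?P = "Z \<inter> proj_space n"
  have "bij_betw (\<lambda>(t, x). t \<cdot>\<^sub>v x) ((UNIV - {0}) \<times> ?P) (Z - {0\<^sub>v (n + 1)})"
    unfolding bij_betw_def
  proof
    show "inj_on (\<lambda>(t, x). t \<cdot>\<^sub>v x) ((UNIV - {0}) \<times> ?P)"
    proof (rule inj_onI)
      fix a b assume "a \<in> (UNIV - {0}) \<times> ?P" "b \<in> (UNIV - {0}) \<times> ?P"
        "(\<lambda>(t, x). t \<cdot>\<^sub>v x) a = (\<lambda>(t, x). t \<cdot>\<^sub>v x) b"
      then obtain t x s y where ab: "a = (t, x)" "b = (s, y)"
        and *: "(t :: 'a) \<noteq> 0" "s \<noteq> 0" "x \<in> proj_space n" "y \<in> proj_space n" "t \<cdot>\<^sub>v x = s \<cdot>\<^sub>v y"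
        by auto
      obtain i where i: "i \<le> n" "x $ i = 1" "\<And>j. i < j \<Longrightarrow> j \<le> n \<Longrightarrow> x $ j = 0"
        using *(3) by (auto simp: proj_space_def)
      obtain j where j: "j \<le> n" "y $ j = 1" "\<And>i. j < i \<Longrightarrow> i \<le> n \<Longrightarrow> y $ i = 0"
        using *(4) by (auto simp: proj_space_def)
      have c: "dim_vec x = n + 1" "dim_vec y = n + 1" using *(3,4) by (auto simp: proj_space_def)
      have e: "t * x $ l = s * y $ l" if "l \<le> n" for l
        using arg_cong[OF *(5), of "\<lambda>v :: 'a vec. v $ l"] that c by simp
      \<comment> \<open>If they differed, then at the larger of the two positions one side of t x =
        s y would be zero and the other not.\<close>
      have "i = j"
      proof (rule ccontr)
        assume "i \<noteq> j"
        then show False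
          using e[OF i(1)] e[OF j(1)] i(2,3) j(2,3) i(1) j(1) *(1,2)
          by (metis linorder_neqE_nat mult_1_right mult_zero_right)
      qed
      then have "t = s" using e[OF i(1)] i(2) j(2) by simp
      moreover have "x = y"
        by (rule eq_vecI) (use c e *(1) \<open>t = s\<close> in auto)
      ultimately show "a = b" using ab by simp
    qed
    show "(\<lambda>(t, x). t \<cdot>\<^sub>v x) ` ((UNIV - {0}) \<times> ?P) = Z - {0\<^sub>v (n + 1)}"
    proof (intro equalityI subsetI)
      fix z assume "z \<in> (\<lambda>(t, x). t \<cdot>\<^sub>v x) ` ((UNIV - {0}) \<times> ?P)"
      then obtain t x where tx: "t \<noteq> 0" "x \<in> Z" "x \<in> proj_space n" "z = t \<cdot>\<^sub>v x" by auto
      then obtain i where "i \<le> n" "x $ i = 1" "dim_vec x = n + 1" by (auto simp: proj_space_def)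
      then have "z $ i \<noteq> 0\<^sub>v (n + 1) $ i" using tx by simp
      then show "z \<in> Z - {0\<^sub>v (n + 1)}" using tx scale by auto
    next
      fix z assume z: "z \<in> Z - {0\<^sub>v (n + 1)}"
      then have zc: "dim_vec z = n + 1" using Z by auto
      \<comment> \<open>Its maximum is the position of the last nonzero coordinate, the one
        normalized to 1 in \<open>proj_space\<close>.\<close>
      let ?I = "{i. i \<le> n \<and> z $ i \<noteq> 0}"
      have "?I \<noteq> {}"
      proof
        assume "?I = {}"
        then have "z = 0\<^sub>v (n + 1)" using zc by (intro eq_vecI) auto
        then show False using z by simp
      qed
      then have M: "Max ?I \<in> ?I" by (intro Max_in) auto
      define i where "i = Max ?I"
      have i: "i \<le> n" "z $ i \<noteq> 0" using M by (auto simp: i_def)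
      have "z $ j = 0" if "i < j" "j \<le> n" for j
      proof (rule ccontr)
        assume "z $ j \<noteq> 0"
        then have "j \<le> i" unfolding i_def using that by (intro Max_ge) auto
        then show False using that by simp
      qed
      then have "(1 / z $ i) \<cdot>\<^sub>v z \<in> proj_space n"
        using i zc carrier_vecI[OF zc] by (auto simp: proj_space_def intro!: exI[of _ i])
      moreover have "(1 / z $ i) \<cdot>\<^sub>v z \<in> Z" using z i by (intro scale) auto
      moreover have "z = z $ i \<cdot>\<^sub>v ((1 / z $ i) \<cdot>\<^sub>v z)"
        using i by (intro eq_vecI) auto
      ultimately show "z \<in> (\<lambda>(t, x). t \<cdot>\<^sub>v x) ` ((UNIV - {0}) \<times> ?P)"
        using i by (intro image_eqI[of _ _ "(z $ i, (1 / z $ i) \<cdot>\<^sub>v z)"]) auto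
    qed
  qed
  then have "card (Z - {0\<^sub>v (n + 1)}) = (q\<^sup>2 - 1) * card ?P"
    using bij_betw_same_card by (fastforce simp: card_cartesian_product card_Diff_subset card_field)
  moreover have "finite Z" using Z(1) finite_subset finite_carrier_vec by blast
  ultimately show ?thesis using card.remove[OF _ Z(2)] by simp
qed

end

section \<open>Descent from the algebraic closure to the finite field\<close>

lemma map_vec_proj_space: "map_vec to_ac x \<in> proj_space n \<longleftrightarrow> x \<in> proj_space n"
proof (cases "x \<in> carrier_vec (n + 1)")
  case True
  then have "map_vec to_ac x $ i = to_ac (x $ i)" if "i \<le> n" for i using that by simp
  moreover have "to_ac y = 1 \<longleftrightarrow> y = 1" "to_ac y = 0 \<longleftrightarrow> y = 0" for y :: 'a
    by (metis to_ac_1 to_ac_eq_iff, metis to_ac_0 to_ac_eq_iff)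
  ultimately show ?thesis
    using True unfolding proj_space_def by auto
qed (auto simp: proj_space_def)

text \<open>The embedding is injective, so no coefficient disappears and both sums run over the same
  keys.\<close>

lemma eval_form_map_to_ac:
  assumes "F \<in> forms n d" "x \<in> carrier_vec (n + 1)"
  shows "eval_form (Poly_Mapping.map to_ac F) (map_vec to_ac x) = to_ac (eval_form F x)"
proof -
  have l: "Poly_Mapping.lookup (Poly_Mapping.map to_ac F) m = to_ac (Poly_Mapping.lookup F m)" for m
    by (simp add: Poly_Mapping.map.rep_eq when_def)
  have "to_ac y = 0 \<longleftrightarrow> y = 0" for y :: 'a by (metis to_ac_0 to_ac_eq_iff)
  then have k: "Poly_Mapping.keys (Poly_Mapping.map to_ac F) = Poly_Mapping.keys F"
    by (auto simp: in_keys_iff l)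
  show ?thesis
    unfolding eval_form_def k l to_ac_sum to_ac_mult to_ac_prod to_ac_power
  proof (intro sum.cong refl arg_cong2[of _ _ _ _ "(*)"] prod.cong arg_cong2[of _ _ _ _ "(^)"])
    fix m i assume "m \<in> Poly_Mapping.keys F" "i \<in> Poly_Mapping.keys m"
    then have "i \<le> n" using assms(1) by (auto simp: forms_def)
    then show "map_vec to_ac x $ i = to_ac (x $ i)" using assms(2) by simp
  qed
qed

lemma rational_points_zero_set:
  assumes "F \<in> forms n d"
  shows "rational_points (S \<inter> zero_set n F) = {x \<in> rational_points S. x \<in> proj_space n \<and> eval_form F x = 0}"
proof -
  have "to_ac y = 0 \<longleftrightarrow> y = 0" for y :: 'a by (metis to_ac_0 to_ac_eq_iff)
  then have "map_vec to_ac x \<in> zero_set n F \<longleftrightarrow> x \<in> proj_space n \<and> eval_form F x = 0" for x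
    unfolding zero_set_def using eval_form_map_to_ac[OF assms, of x]
    by (auto simp: map_vec_proj_space proj_space_def[of n])
  then show ?thesis by (auto simp: rational_points_def)
qed

lemma (in quadratic_field) hermitian_formI:
  assumes "hermitian_matrix q n (H :: 'a mat)"
  shows "hermitian_form q (n + 1) H"
proof unfold_locales
  show "H \<in> carrier_mat (n + 1) (n + 1)"
    using assms unfolding hermitian_matrix_def by blast
  show "H $$ (i, j) = (H $$ (j, i)) ^ q" if "i < n + 1" "j < n + 1" for i j
  proof -
    have "i \<le> n" "j \<le> n" using that by simp_all
    then show ?thesis using assms unfolding hermitian_matrix_def by blast
  qed
qed

context hermitian_form
begin

lemma rational_points_hermitian_variety:
  assumes "N = n + 1"
  shows "rational_points (hermitian_variety q n H) = {x \<in> carrier_vec (n + 1). h x = 0} \<inter> proj_space n"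
proof -
  have z: "to_ac y = 0 \<longleftrightarrow> y = 0" for y :: 'a by (metis to_ac_0 to_ac_eq_iff)
  have "(\<Sum>i\<le>n. \<Sum>j\<le>n. to_ac (H $$ (i, j)) * map_vec to_ac x $ i * (map_vec to_ac x $ j) ^ q) = to_ac (h x)"
    if "x \<in> carrier_vec (n + 1)" for x
    unfolding B_def using that assms by (simp add: to_ac_sum lessThan_Suc_atMost)
  then have "map_vec to_ac x \<in> hermitian_variety q n H \<longleftrightarrow> x \<in> proj_space n \<and> h x = 0" for x
    unfolding hermitian_variety_def by (auto simp: map_vec_proj_space proj_space_def[of n] z)
  then show ?thesis by (auto simp: rational_points_def proj_space_def)
qed

text \<open>Positive degree makes the zero vector a zero of f, as \<open>card_projective\<close>
  demands.\<close>

lemma card_section: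
  assumes "N = n + 1" "homogeneous N d f" "d \<ge> 1"
  shows "card {x \<in> carrier_vec N. h x = 0 \<and> f x = 0} =
    1 + (q\<^sup>2 - 1) * card {x \<in> rational_points (hermitian_variety q n H). f x = 0}"
proof -
  let ?Z = "{x \<in> carrier_vec N. h x = 0 \<and> f x = 0}"
  have "f (0 \<cdot>\<^sub>v 0\<^sub>v N) = 0 ^ d * f (0\<^sub>v N)" by (rule homogeneous_scale[OF assms(2)]) simp
  moreover have "(0 :: 'a) \<cdot>\<^sub>v 0\<^sub>v N = 0\<^sub>v N" by (rule eq_vecI) auto
  ultimately have f0: "f (0\<^sub>v N) = 0" using assms(3) by (simp add: power_0_left)
  have "card ?Z = 1 + (q\<^sup>2 - 1) * card (?Z \<inter> proj_space n)"
  proof (rule card_projective)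
    fix x t assume "x \<in> ?Z" "(t :: 'a) \<noteq> 0"
    then show "t \<cdot>\<^sub>v x \<in> ?Z" using homogeneous_scale[OF assms(2)] h_smult by auto
  qed (use assms f0 B_zero(1)[of "0\<^sub>v N"] in auto)
  also have "?Z \<inter> proj_space n = {x \<in> rational_points (hermitian_variety q n H). f x = 0}"
    unfolding rational_points_hermitian_variety[OF assms(1)] using assms(1) by auto
  finally show ?thesis .
qed

lemma card_isotropic:
  assumes "N = n + 1"
  shows "card {x \<in> carrier_vec N. h x = 0} = 1 + (q\<^sup>2 - 1) * card (rational_points (hermitian_variety q n H))"
proof -
  have "card {x \<in> carrier_vec N. h x = 0 \<and> (0 :: 'a) = 0} = 1 + (q\<^sup>2 - 1) *
      card {x \<in> rational_points (hermitian_variety q n H). (0 :: 'a) = 0}"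
    \<comment> \<open>The zero function counts as homogeneous of degree 1, so the whole variety is a
      section.\<close>
    by (rule card_section[OF assms homogeneous.zero[of N 1]]) simp
  then show ?thesis by (simp only: simp_thms Collect_mem_eq)
qed

end

text \<open>H and U are given independently of each other. Both become the diagonal form in
  orthonormal coordinates; A passes from the coordinates of U to those of H, and p spans the radical
  of H, the vertex.\<close>

lemma (in quadratic_field) cone_coordinates:
  fixes H U :: "'a mat"
  assumes "hermitian_form q (Suc N) H" "vec_space.rank (Suc N) H = N"
    and "hermitian_form q N U" "vec_space.rank N U = N"
  obtains A p b b' where "hermitian_form.orthonormal q (Suc N) H N b" "hermitian_form.orthonormal q N U N b'"
    "A \<in> carrier_mat (Suc N) N" "p \<in> carrier_vec (Suc N)"
    "bij_betw (\<lambda>(x, t). A *\<^sub>v x + t \<cdot>\<^sub>v p) (carrier_vec N \<times> UNIV) (carrier_vec (Suc N))"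
    "\<And>x t. x \<in> carrier_vec N \<Longrightarrow> hermitian_form.B q (Suc N) H (A *\<^sub>v x + t \<cdot>\<^sub>v p) (A *\<^sub>v x + t \<cdot>\<^sub>v p)
      = hermitian_form.B q N U x x"
    "card {x \<in> carrier_vec N. hermitian_form.B q N U x x = 0} =
      card {x \<in> carrier_vec N :: 'a vec set. (\<Sum>i<N. (x $ i) ^ (q + 1)) = 0}"
proof -
  interpret H: hermitian_form q "TYPE('a)" "Suc N" H by fact
  interpret U: hermitian_form q "TYPE('a)" N U by fact
  let ?c = "card (UNIV :: 'a set)"
  have c0: "?c > 0" by (simp add: card_gt_0_iff)
  obtain k b where b: "H.orthonormal k b"
    "bij_betw (\<lambda>(x, w). H.frame k b *\<^sub>v x + w) (carrier_vec k \<times> H.radical) (carrier_vec (Suc N))"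
    by (rule H.orthonormal_decomposition)
  have k: "k = N" using H.rank_decomposition[OF b(2)] assms(2) by simp
  obtain k' b' where b': "U.orthonormal k' b'"
    "bij_betw (\<lambda>(x, w). U.frame k' b' *\<^sub>v x + w) (carrier_vec k' \<times> U.radical) (carrier_vec N)"
    by (rule U.orthonormal_decomposition)
  have k': "k' = N" using U.rank_decomposition[OF b'(2)] assms(4) by simp
  have cH: "card H.radical = ?c" using H.card_radical assms(2) c0 by simp
  have "card U.radical = 1" using U.card_radical assms(4) c0 by simp
  moreover have "0\<^sub>v N \<in> U.radical" by (simp add: U.radical_def)
  ultimately have radU: "U.radical = {0\<^sub>v N}" by (metis card_1_singletonE singletonD)
  have "\<exists>p\<in>H.radical. p \<noteq> 0\<^sub>v (Suc N)"
  proof (rule ccontr)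
    assume "\<not> ?thesis"
    then have "card H.radical \<le> card {0\<^sub>v (Suc N) :: 'a vec}" by (intro card_mono) auto
    then show False using cH q_sq_gt by (simp add: card_field)
  qed
  then obtain p where p: "p \<in> H.radical" "p \<noteq> 0\<^sub>v (Suc N)" by blast
  have pc: "p \<in> carrier_vec (Suc N)" using p(1) by (simp add: H.radical_def)
  obtain i where i: "i < Suc N" "p $ i \<noteq> 0"
    using p(2) pc by (metis carrier_vecD eq_vecI index_zero_vec)
  have inj: "inj (\<lambda>t. t \<cdot>\<^sub>v p)"
  proof (rule injI)
    fix t s assume "t \<cdot>\<^sub>v p = s \<cdot>\<^sub>v p"
    then have "(t \<cdot>\<^sub>v p) $ i = (s \<cdot>\<^sub>v p) $ i" by simp
    then show "t = s" using i pc by simp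
  qed
  have tp: "t \<cdot>\<^sub>v p \<in> H.radical" for t
    using p(1) by (simp add: H.radical_def H.B_smult_right)
  \<comment> \<open>The radical has |K| elements, so the multiples of one nonzero vector exhaust
    it.\<close>
  have "range (\<lambda>t. t \<cdot>\<^sub>v p) = H.radical"
  proof (rule card_subset_eq)
    show "finite H.radical" by (simp add: H.radical_def)
    show "card (range (\<lambda>t. t \<cdot>\<^sub>v p)) = card H.radical" using inj by (simp add: card_image cH)
  qed (use tp in auto)
  then have bp: "bij_betw (\<lambda>t. t \<cdot>\<^sub>v p) UNIV H.radical" using inj by (simp add: bij_betw_def)
  \<comment> \<open>The rows pair a vector with the basis b', so L computes orthonormal coordinates
    for U and inverts the frame of b'.\<close>
  define L where "L = mat_of_rows N (map (\<lambda>i. U.dual (b' i)) [0..<N])"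
  have Lc: "L \<in> carrier_mat N N" by (simp add: L_def mat_of_rows_def)
  have b'N: "U.orthonormal N b'" using b'(1) k' by simp
  have LF: "L *\<^sub>v (U.frame N b' *\<^sub>v y) = y" if y: "y \<in> carrier_vec N" for y
  proof (rule eq_vecI)
    fix i assume i: "i < dim_vec y"
    then have iN: "i < N" using y by simp
    have "row L i = U.dual (b' i)" using iN by (simp add: L_def)
    then have "(L *\<^sub>v (U.frame N b' *\<^sub>v y)) $ i = U.B (U.frame N b' *\<^sub>v y) (b' i)"
      using iN Lc y by (simp add: U.B_dual)
    then show "(L *\<^sub>v (U.frame N b' *\<^sub>v y)) $ i = y $ i"
      using U.B_frame_basis[OF b'N y iN] by simp
  qed (use Lc y in simp)
  have FL: "U.frame N b' *\<^sub>v (L *\<^sub>v x) = x" if x: "x \<in> carrier_vec N" for x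
  proof -
    have "x \<in> (\<lambda>(x, w). U.frame N b' *\<^sub>v x + w) ` (carrier_vec N \<times> U.radical)"
      using b'(2) x k' by (simp add: bij_betw_def)
    then obtain y where y: "y \<in> carrier_vec N" "x = U.frame N b' *\<^sub>v y + 0\<^sub>v N" by (auto simp: radU)
    then have "x = U.frame N b' *\<^sub>v y" by (metis U.frame_vec_carrier right_zero_vec)
    then show ?thesis using LF[OF y(1)] by simp
  qed
  have Lx: "L *\<^sub>v x \<in> carrier_vec N" if "x \<in> carrier_vec N" for x using Lc that by simp
  have bL: "bij_betw (\<lambda>x. L *\<^sub>v x) (carrier_vec N) (carrier_vec N)"
    by (rule bij_betwI[where g = "\<lambda>y. U.frame N b' *\<^sub>v y"]) (use Lx LF FL in auto)
  have hU: "U.h x = (\<Sum>i<N. ((L *\<^sub>v x) $ i) ^ (q + 1))" if "x \<in> carrier_vec N" for x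
    using U.h_frame[OF b'N Lx[OF that]] FL[OF that] by simp
  define A where "A = H.frame N b * L"
  have Ac: "A \<in> carrier_mat (Suc N) N" unfolding A_def by (rule mult_carrier_mat[OF H.frame_carrier Lc])
  have Ax: "A *\<^sub>v x = H.frame N b *\<^sub>v (L *\<^sub>v x)" if "x \<in> carrier_vec N" for x
    unfolding A_def by (rule assoc_mult_mat_vec[OF H.frame_carrier Lc that])
  have "bij_betw (map_prod (\<lambda>x. L *\<^sub>v x) (\<lambda>t. t \<cdot>\<^sub>v p)) (carrier_vec N \<times> UNIV) (carrier_vec N \<times> H.radical)"
    by (rule bij_betw_map_prod[OF bL bp])
  then have "bij_betw ((\<lambda>(x, w). H.frame N b *\<^sub>v x + w) \<circ> map_prod (\<lambda>x. L *\<^sub>v x) (\<lambda>t. t \<cdot>\<^sub>v p))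
      (carrier_vec N \<times> UNIV) (carrier_vec (Suc N))"
    using b(2) unfolding k by (rule bij_betw_trans)
  then have 1: "bij_betw (\<lambda>(x, t). A *\<^sub>v x + t \<cdot>\<^sub>v p) (carrier_vec N \<times> UNIV) (carrier_vec (Suc N))"
    by (rule bij_betw_cong[THEN iffD1, rotated]) (auto simp: Ax)
  have bN: "H.orthonormal N b" using b(1) k by simp
  have 2: "H.h (A *\<^sub>v x + t \<cdot>\<^sub>v p) = U.h x" if "x \<in> carrier_vec N" for x t
    using H.h_decomposition[OF bN Lx[OF that] tp] hU[OF that] by (simp only: Ax[OF that])
  have "bij_betw (\<lambda>x. L *\<^sub>v x) {x \<in> carrier_vec N. U.h x = 0}
      {x \<in> carrier_vec N. (\<Sum>i<N. (x $ i) ^ (q + 1)) = 0}"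
  proof (rule bij_betwI[where g = "\<lambda>y. U.frame N b' *\<^sub>v y"])
    show "(\<lambda>y. U.frame N b' *\<^sub>v y) \<in> {x \<in> carrier_vec N. (\<Sum>i<N. (x $ i) ^ (q + 1)) = 0}
        \<rightarrow> {x \<in> carrier_vec N. U.h x = 0}"
      using U.h_frame[OF b'N] by auto
  qed (use hU Lx LF FL in auto)
  then have 3: "card {x \<in> carrier_vec N. U.h x = 0} =
      card {x \<in> carrier_vec N :: 'a vec set. (\<Sum>i<N. (x $ i) ^ (q + 1)) = 0}"
    by (rule bij_betw_same_card)
  show ?thesis by (rule that[OF bN b'N Ac pc 1 2 3])
qed

text \<open>With c = q^2 - 1 this passes from vectors to projective points: the zero vector leaves a
  remainder, which disappears if it is smaller than c.\<close>

lemma mult_le_cancel_remainder: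
  fixes r c x y :: nat
  assumes "c * x \<le> r + c * y" "r < c"
  shows "x \<le> y"
proof -
  have "c * x < c * (y + 1)" using assms by simp
  then have "x < y + 1" by (rule mult_less_cancel1[THEN iffD1, THEN conjunct2])
  then show ?thesis by simp
qed

lemma homogeneous_degree_0_const:
  assumes "homogeneous N 0 f" "x \<in> carrier_vec N" "y \<in> carrier_vec N"
  shows "f x = f y"
proof -
  have "f (0 \<cdot>\<^sub>v x) = f x" "f (0 \<cdot>\<^sub>v y) = f y"
    using homogeneous_scale[OF assms(1)] assms(2,3) by simp_all
  moreover have "0 \<cdot>\<^sub>v x = 0 \<cdot>\<^sub>v y" using assms(2,3) by (intro eq_vecI) auto
  ultimately show ?thesis by metis
qed

context quadratic_field
begin

text \<open>Counting the zeros on the lines through a point where \<open>f\<close> does not vanish.\<close>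

lemma card_homogeneous_zeros_le:
  assumes f: "homogeneous N d f" and v: "v \<in> carrier_vec N" "(f v :: 'a) \<noteq> 0"
  shows "(q\<^sup>2 - 1) * card {x \<in> carrier_vec N. f x = 0} \<le> d * ((q\<^sup>2) ^ N - 1)"
proof -
  let ?Z = "{x \<in> carrier_vec N. f x = 0}" and ?V = "carrier_vec N :: 'a vec set" and ?K = "UNIV - {0 :: 'a}"
  \<comment> \<open>The direction w = 0 contributes no zero. In any other direction the polynomial
    in t has constant term f(v), which is nonzero.\<close>
  have line: "card {t \<in> ?K. f (v + t \<cdot>\<^sub>v w) = 0} \<le> (if w = 0\<^sub>v N then 0 else d)" if w: "w \<in> ?V" for w
  proof (cases "w = 0\<^sub>v N")
    case True
    have "v + t \<cdot>\<^sub>v w = v" for t using v True by (intro eq_vecI) auto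
    then show ?thesis using v True by simp
  next
    case False
    obtain c where c: "c 0 = f v" "\<And>t. f (v + t \<cdot>\<^sub>v w) = (\<Sum>i\<le>d. c i * t ^ i)"
      using homogeneous_line[OF f v(1) w] by blast
    have "card {t. (\<Sum>i\<le>d. c i * t ^ i) = 0} \<le> d"
      by (rule card_power_sum_roots_le[of 0]) (use c v in auto)
    moreover have "card {t \<in> ?K. f (v + t \<cdot>\<^sub>v w) = 0} \<le> card {t. (\<Sum>i\<le>d. c i * t ^ i) = 0}"
      by (rule card_mono) (auto simp: c)
    ultimately show ?thesis using False by simp
  qed
  \<comment> \<open>For fixed nonzero t, w is mapped to v + t w bijectively, so summing over t
    counts each zero q^2 - 1 times.\<close>
  have shift: "card {w \<in> ?V. f (v + t \<cdot>\<^sub>v w) = 0} = card ?Z" if t: "t \<in> ?K" for t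
  proof -
    have e: "v + t \<cdot>\<^sub>v ((1 / t) \<cdot>\<^sub>v (x - v)) = x" if "x \<in> ?V" for x
      by (rule eq_vecI) (use t that v in auto)
    have "bij_betw (\<lambda>w. v + t \<cdot>\<^sub>v w) {w \<in> ?V. f (v + t \<cdot>\<^sub>v w) = 0} ?Z"
    proof (rule bij_betwI[where g = "\<lambda>x. (1 / t) \<cdot>\<^sub>v (x - v)"])
      show "(\<lambda>x. (1 / t) \<cdot>\<^sub>v (x - v)) \<in> ?Z \<rightarrow> {w \<in> ?V. f (v + t \<cdot>\<^sub>v w) = 0}"
        using e v by auto
      show "(1 / t) \<cdot>\<^sub>v (v + t \<cdot>\<^sub>v w - v) = w" if "w \<in> {w \<in> ?V. f (v + t \<cdot>\<^sub>v w) = 0}" for w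
        by (rule eq_vecI) (use t that v in auto)
    qed (use v e in auto)
    then show ?thesis by (rule bij_betw_same_card)
  qed
  have "(\<Sum>w\<in>?V. card {t \<in> ?K. f (v + t \<cdot>\<^sub>v w) = 0}) = (\<Sum>t\<in>?K. card ?Z)"
    by (rule sum_multicount_gen) (use shift in auto)
  also have "\<dots> = (q\<^sup>2 - 1) * card ?Z"
    by (simp add: card_Diff_subset card_field)
  finally have "(q\<^sup>2 - 1) * card ?Z = (\<Sum>w\<in>?V. card {t \<in> ?K. f (v + t \<cdot>\<^sub>v w) = 0})" ..
  also have "\<dots> \<le> (\<Sum>w\<in>?V. if w = 0\<^sub>v N then 0 else d)"
    by (rule sum_mono) (use line in blast)
  also have "\<dots> = (\<Sum>w\<in>?V - {0\<^sub>v N}. d)"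
    by (rule sum.mono_neutral_cong_right) auto
  also have "\<dots> = d * ((q\<^sup>2) ^ N - 1)"
    by (simp add: card_Diff_subset card_carrier_vec card_field mult.commute)
  finally show ?thesis .
qed

text \<open>The nonzero value at v guarantees that the form representing f is not the zero
  polynomial.\<close>

lemma max_section_ge:
  assumes "homogeneous (n + 1) d f" "v \<in> carrier_vec (n + 1)" "(f v :: 'a) \<noteq> 0"
    and S: "rational_points S \<subseteq> proj_space n"
  shows "card {x \<in> rational_points S. f x = 0} \<le> max_section n d S"
proof -
  obtain F where F: "F \<in> forms n d" "\<And>x. x \<in> carrier_vec (n + 1) \<Longrightarrow> f x = eval_form F x"
    using homogeneous_imp_form[OF assms(1)] by blast
  have F0: "F \<noteq> 0" using F(2)[OF assms(2)] assms(3) by auto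
  have c: "proj_space n \<subseteq> (carrier_vec (n + 1) :: 'a vec set)" by (auto simp: proj_space_def)
  let ?X = "{card (rational_points (S \<inter> zero_set n G)) | G. G \<in> forms n d \<and> G \<noteq> 0}"
  \<comment> \<open>A common bound makes the set of section sizes finite, as \<open>Max\<close>
    requires.\<close>
  have "?X \<subseteq> {..card (carrier_vec (n + 1) :: 'a vec set)}"
    using c S by (auto simp: rational_points_zero_set intro!: card_mono)
  then have "finite ?X" using finite_subset by blast
  then have "card (rational_points (S \<inter> zero_set n F)) \<le> max_section n d S"
    unfolding max_section_def using F(1) F0 by (intro Max_ge) auto
  moreover have "rational_points (S \<inter> zero_set n F) = {x \<in> rational_points S. f x = 0}"
  proof -
    have "x \<in> proj_space n \<and> eval_form F x = f x" if "x \<in> rational_points S" for x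
      using F(2)[of x] c S that by auto
    then show ?thesis unfolding rational_points_zero_set[OF F(1)] by auto
  qed
  ultimately show ?thesis by simp
qed

text \<open>Compares the base points with the constant of the Bezout type bound, so that both can be
  absorbed into multiples of (q + 1) q^(2n-4). The hypothesis is the exact count, multiplied by
  q.\<close>

lemma card_isotropic_points_le:
  assumes Z: "int q * (1 + (int q ^ 2 - 1) * int u) = int q ^ (2 * n) + (- 1) ^ n * (int q ^ Suc n - int q ^ n)"
    and n: "n \<ge> 2"
  shows "u \<le> (q + 1) * q ^ (2 * n - 4)"
proof -
  define Q where "Q = int q"
  have Q: "Q \<ge> 2" using q_ge_2 by (simp add: Q_def)
  obtain k where k: "n = k + 2" using n by (metis add.commute le_iff_add)
  have QQ: "Q * Q \<ge> 2 * Q" using Q by (intro mult_right_mono) auto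
  have "(- 1) ^ n * (Q ^ Suc n - Q ^ n) \<le> Q ^ Suc n - Q ^ n"
    using Q by (cases "even n") (auto simp: mult_le_cancel_right)
  \<comment> \<open>The right side is what the claimed bound leaves after subtracting Q^(2n). For k
    = 0, that is n = 2, it equals the left side.\<close>
  also have "\<dots> \<le> Q + Q ^ (2 * k) * (Q ^ 3 - Q ^ 2 - Q)"
  proof (cases k)
    case 0
    then show ?thesis by (simp add: k power_numeral_reduce)
  next
    case (Suc j)
    have "Q ^ Suc n - Q ^ n = Q ^ (k + 2) * (Q - 1)" by (simp add: k algebra_simps)
    also have "\<dots> \<le> Q ^ (2 * k + 1) * (Q * Q - Q - 1)"
    proof (rule mult_mono)
      show "Q ^ (k + 2) \<le> Q ^ (2 * k + 1)" using Q Suc by (intro power_increasing) auto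
      show "Q - 1 \<le> Q * Q - Q - 1" using QQ by linarith
    qed (use Q in auto)
    also have "\<dots> = Q ^ (2 * k) * (Q ^ 3 - Q ^ 2 - Q)"
      by (simp add: algebra_simps power_numeral_reduce)
    finally show ?thesis using Q by linarith
  qed
  finally have "Q * (1 + (Q ^ 2 - 1) * int u) \<le> Q ^ (2 * n) + (Q + Q ^ (2 * k) * (Q ^ 3 - Q ^ 2 - Q))"
    using Z unfolding Q_def by linarith
  moreover have "2 * n = 2 * k + 4" using k by simp
  then have "Q ^ (2 * n) = Q ^ (2 * k) * Q ^ 4" by (simp only: power_add)
  moreover have "Q * (1 + (Q ^ 2 - 1) * int u) = Q + (Q * (Q ^ 2 - 1)) * int u"
    by (simp add: algebra_simps)
  moreover have "P * Q ^ 4 + P * (Q ^ 3 - Q ^ 2 - Q) = (Q * (Q ^ 2 - 1)) * ((Q + 1) * P)" for P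
    by (simp add: algebra_simps power2_eq_square power3_eq_cube power4_eq_xxxx)
  ultimately have "(Q * (Q ^ 2 - 1)) * int u \<le> (Q * (Q ^ 2 - 1)) * ((Q + 1) * Q ^ (2 * k))"
    by (metis add.commute add.left_commute add_le_cancel_left)
  moreover have "Q ^ 2 - 1 > 0" unfolding power2_eq_square using Q QQ by linarith
  then have "Q * (Q ^ 2 - 1) > 0" using Q by simp
  ultimately have "int u \<le> (Q + 1) * Q ^ (2 * k)" by (simp only: mult_le_cancel_left_pos)
  then have "int u \<le> int ((q + 1) * q ^ (2 * k))" by (simp add: Q_def algebra_simps)
  then show ?thesis using k by (simp only: of_nat_le_iff) simp
qed

end

section \<open>The cone and its base\<close>

locale hermitian_cone = quadratic_field q ty for q :: nat and ty :: "'a::{field,finite} itself" +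
  fixes n :: nat and H U :: "'a mat"
  assumes n_ge_2: "n \<ge> 2"
    and H: "hermitian_matrix q n H" "vec_space.rank (n + 1) H = n"
    and U: "hermitian_matrix q (n - 1) U" "vec_space.rank n U = n"
begin

sublocale H: hermitian_form q ty "n + 1" H
  by (rule hermitian_formI[OF H(1)])

sublocale U: hermitian_form q ty n U
  using hermitian_formI[OF U(1)] n_ge_2 by simp

abbreviation "cone_points \<equiv> rational_points (hermitian_variety q n H)"
abbreviation "base_points \<equiv> rational_points (hermitian_variety q (n - 1) U)"

lemma n_eq: "n = (n - 1) + 1" using n_ge_2 by simp

lemma base_points_eq: "base_points = {x \<in> carrier_vec n. U.h x = 0} \<inter> proj_space (n - 1)"
  using U.rational_points_hermitian_variety[OF n_eq] n_eq by simp

lemma cone_points_eq: "cone_points = {x \<in> carrier_vec (n + 1). H.h x = 0} \<inter> proj_space n"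
  by (rule H.rational_points_hermitian_variety) simp

lemma coordinates:
  obtains A p b b' where "H.orthonormal n b" "U.orthonormal n b'"
    "A \<in> carrier_mat (n + 1) n" "p \<in> carrier_vec (n + 1)"
    "bij_betw (\<lambda>(x, t). A *\<^sub>v x + t \<cdot>\<^sub>v p) (carrier_vec n \<times> UNIV) (carrier_vec (n + 1))"
    "\<And>x t. x \<in> carrier_vec n \<Longrightarrow> H.h (A *\<^sub>v x + t \<cdot>\<^sub>v p) = U.h x"
  by (rule cone_coordinates[of n H U, unfolded Suc_eq_plus1,
      OF H.hermitian_form_axioms H(2) U.hermitian_form_axioms U(2)]) (rule that)

lemma card_base_diagonal: "card {x \<in> carrier_vec n. U.h x = 0} =
    card {x \<in> carrier_vec n :: 'a vec set. (\<Sum>i<n. (x $ i) ^ (q + 1)) = 0}"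
  by (rule cone_coordinates[of n H U, unfolded Suc_eq_plus1,
      OF H.hermitian_form_axioms H(2) U.hermitian_form_axioms U(2)])

lemma card_base_vectors: "card {x \<in> carrier_vec n. U.h x = 0} = 1 + (q\<^sup>2 - 1) * card base_points"
  by (rule U.card_isotropic[OF n_eq])

lemma card_base_points:
  "int q * (1 + (int q ^ 2 - 1) * int (card base_points)) = int q ^ (2 * n) + (- 1) ^ n * (int q ^ Suc n - int q ^ n)"
proof -
  have "int q * int (1 + (q\<^sup>2 - 1) * card base_points) = int q ^ (2 * n) + (- 1) ^ n * (int q ^ Suc n - int q ^ n)"
    using card_diagonal_zeros[of n] unfolding card_base_diagonal[symmetric] card_base_vectors .
  moreover have "int (q\<^sup>2 - 1) = int q ^ 2 - 1"
    using q_sq_gt(2) by (simp add: of_nat_diff)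
  ultimately show ?thesis by (simp only: of_nat_add of_nat_mult of_nat_1)
qed

lemma card_base_points_le: "card base_points \<le> (q + 1) * q ^ (2 * n - 4)"
  by (rule card_isotropic_points_le[OF card_base_points n_ge_2])

lemma card_base_points_line: "n = 2 \<Longrightarrow> card base_points = q + 1"
proof -
  assume n: "n = 2"
  define Q where "Q = int q"
  define u where "u = int (card base_points)"
  have Q: "Q \<ge> 2" using q_ge_2 by (simp add: Q_def)
  have "Q * (1 + (Q ^ 2 - 1) * u) = Q ^ 4 + (Q ^ 3 - Q ^ 2)"
    using card_base_points unfolding n Q_def u_def by simp
  then have "(Q * (Q ^ 2 - 1)) * u = (Q * (Q ^ 2 - 1)) * (Q + 1)"
    by (simp add: algebra_simps power2_eq_square power3_eq_cube power4_eq_xxxx)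
  moreover have "Q * Q \<ge> 2 * Q" using Q by (intro mult_right_mono) auto
  then have "Q ^ 2 - 1 > 0" unfolding power2_eq_square using Q by linarith
  then have "Q * (Q ^ 2 - 1) > 0" using Q by (intro mult_pos_pos) auto
  then have "Q * (Q ^ 2 - 1) \<noteq> 0" by (rule less_imp_neq[symmetric])
  ultimately have "u = Q + 1" by (simp only: mult_cancel_left simp_thms)
  then show "card base_points = q + 1" by (simp add: u_def Q_def)
qed

lemma card_cone_points: "card cone_points = 1 + q\<^sup>2 * card base_points"
proof -
  obtain A p b b' where "H.orthonormal n b" "U.orthonormal n b'"
    "A \<in> carrier_mat (n + 1) n" "p \<in> carrier_vec (n + 1)"
    and A: "bij_betw (\<lambda>(x, t). A *\<^sub>v x + t \<cdot>\<^sub>v p) (carrier_vec n \<times> UNIV) (carrier_vec (n + 1))"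
    "\<And>x t. x \<in> carrier_vec n \<Longrightarrow> H.h (A *\<^sub>v x + t \<cdot>\<^sub>v p) = U.h x"
    by (rule coordinates) (rule that)
  let ?g = "\<lambda>(x, t). A *\<^sub>v x + t \<cdot>\<^sub>v p"
  have img: "?g ` (carrier_vec n \<times> UNIV) = carrier_vec (n + 1)" using A(1) by (simp add: bij_betw_def)
  have "bij_betw ?g ({x \<in> carrier_vec n. U.h x = 0} \<times> UNIV) {y \<in> carrier_vec (n + 1). H.h y = 0}"
  proof (rule bij_betw_subset[OF A(1)])
    show "?g ` ({x \<in> carrier_vec n. U.h x = 0} \<times> UNIV) = {y \<in> carrier_vec (n + 1). H.h y = 0}"
      unfolding img[symmetric] using A(2) by (fastforce simp: image_iff)
  qed auto
  then have "card ({x \<in> carrier_vec n. U.h x = 0} \<times> (UNIV :: 'a set)) = card {y \<in> carrier_vec (n + 1). H.h y = 0}"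
    by (rule bij_betw_same_card)
  \<comment> \<open>Isotropic vectors of the cone are pairs of an isotropic base vector and a scalar
    t. Cancelling q^2 - 1 leaves the vertex and q^2 further points on each line through it.\<close>
  then have "(1 + (q\<^sup>2 - 1) * card base_points) * q\<^sup>2 = 1 + (q\<^sup>2 - 1) * card cone_points"
    by (simp only: card_cartesian_product card_base_vectors card_field H.card_isotropic[OF refl])
  then have "(q\<^sup>2 - 1) * card cone_points = (q\<^sup>2 - 1) * (1 + q\<^sup>2 * card base_points)"
    using q_sq_gt(2) by (simp add: algebra_simps)
  moreover have "q\<^sup>2 - 1 \<noteq> 0" using q_sq_gt(2) by simp
  ultimately show ?thesis by (simp only: mult_cancel1 simp_thms)
qed

lemma base_points_subset: "base_points \<subseteq> carrier_vec n" "base_points \<subseteq> proj_space (n - 1)"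
  unfolding base_points_eq by auto

lemma finite_base_points: "finite base_points"
  using base_points_subset(1) finite_carrier_vec by (rule finite_subset)

text \<open>On the projective line the products of \<open>d\<close> linear forms cut out any \<open>d\<close> of the \<open>q + 1\<close> points.\<close>

lemma line_max_section_ge:
  assumes n: "n = 2" and d: "d \<le> q"
  shows "d \<le> max_section (n - 1) d (hermitian_variety q (n - 1) U)"
proof -
  have u: "card base_points = q + 1" by (rule card_base_points_line[OF n])
  note base = base_points_subset(2) and fin = finite_base_points
  obtain S where S: "S \<subseteq> base_points" "card S = d" "finite S"
    using obtain_subset_with_card_n[of d base_points] u d by auto
  have "base_points \<noteq> S" using u S(2) d by auto
  \<comment> \<open>A spare point outside S, available since d < q + 1, witnesses that the product
    of linear forms is nonzero.\<close>
  then obtain w where w: "w \<in> base_points" "w \<notin> S" using S(1) by blast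
  \<comment> \<open>The 2 by 2 determinant of x and y, a linear form in y whose only zero on the
    projective line is x.\<close>
  define l where "l x y = vec_of_list [x $ 1, - (x $ 0)] \<bullet> y" for x y :: "'a vec"
  have l: "l x y = x $ 1 * y $ 0 - x $ 0 * y $ 1" if "y \<in> carrier_vec 2" for x y
    using that by (simp add: l_def scalar_prod_def numeral_2_eq_2)
  have pts: "x \<in> carrier_vec 2" "x \<in> proj_space 1" if "x \<in> base_points" for x
    using that base_points_subset unfolding n by auto
  have l0: "x = y" if xp: "x \<in> proj_space 1" and yp: "y \<in> proj_space 1" and l0: "l x y = 0" for x y
  proof -
    have xy: "x \<in> carrier_vec 2" "y \<in> carrier_vec 2"
      using xp yp by (auto simp: proj_space_def numeral_2_eq_2)
    have "x $ 1 = 1 \<or> x $ 0 = 1 \<and> x $ 1 = 0" if "x \<in> proj_space 1" for x :: "'a vec"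
      using that by (auto simp: proj_space_def le_Suc_eq)
    from this[OF xp] this[OF yp] have "x $ 0 = y $ 0 \<and> x $ 1 = y $ 1"
      using l[OF xy(2), of x] l0 by auto
    then show ?thesis using xy by (intro eq_vecI) (auto simp: less_2_cases_iff)
  qed
  have "homogeneous 2 (\<Sum>x\<in>S. Suc 0) (\<lambda>y. \<Prod>x\<in>S. l x y)"
  proof (rule homogeneous_prod[OF S(3)])
    fix x :: "'a vec"
    have "vec_of_list [x $ 1, - (x $ 0)] \<in> carrier_vec 2" by (rule carrier_vecI) simp
    then show "homogeneous 2 (Suc 0) (l x)" unfolding l_def by (rule homogeneous_linear)
  qed
  then have hom: "homogeneous (n - 1 + 1) d (\<lambda>y. \<Prod>x\<in>S. l x y)"
    using S(2) by (simp add: n numeral_2_eq_2)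
  have "l x w \<noteq> 0" if "x \<in> S" for x
    using l0[of x w] pts(2)[of x] pts(2)[of w] S(1) that w by blast
  moreover have wn: "w \<in> carrier_vec (n - 1 + 1)" using pts(1)[OF w(1)] n by (simp add: numeral_2_eq_2)
  ultimately have "(\<Prod>x\<in>S. l x w) \<noteq> 0" using S(3) by simp
  then have "card {x \<in> base_points. (\<Prod>y\<in>S. l y x) = 0} \<le> max_section (n - 1) d (hermitian_variety q (n - 1) U)"
    by (rule max_section_ge[OF hom wn _ base])
  moreover have "S \<subseteq> {x \<in> base_points. (\<Prod>y\<in>S. l y x) = 0}"
  proof
    fix x assume x: "x \<in> S"
    then have "l x x = 0" using l[OF pts(1)[of x], of x] S(1) by (auto simp: mult.commute)
    then show "x \<in> {x \<in> base_points. (\<Prod>y\<in>S. l y x) = 0}"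
      using x S(1,3) by (auto simp: prod_zero_iff)
  qed
  then have "card S \<le> card {x \<in> base_points. (\<Prod>y\<in>S. l y x) = 0}"
    using fin by (intro card_mono) auto
  ultimately show ?thesis using S(2) by simp
qed

lemma card_form_cone_points_le:
  assumes d: "1 \<le> d" "d \<le> q" and f: "homogeneous (n + 1) d f"
    and v: "v \<in> carrier_vec (n + 1)" "f v \<noteq> 0"
  shows "card {x \<in> cone_points. f x = 0} \<le>
    max (card base_points + (d - 1) * (q + 1) * q ^ (2 * n - 4))
        (1 + q\<^sup>2 * max_section (n - 1) d (hermitian_variety q (n - 1) U))"
proof -
  define R where "R = (q + 1) * q ^ (2 * n - 4)"
  define M where "M = max_section (n - 1) d (hermitian_variety q (n - 1) U)"
  define u where "u = card base_points"
  define D where "D = q\<^sup>2 - 1"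
  define r where "r = card {x \<in> cone_points. f x = 0}"
  have D: "D > 0" "q\<^sup>2 = D + 1" "q < D + 1" "2 * q \<le> D + 1"
  proof -
    have "2 * q \<le> q * q" using q_ge_2 by simp
    then show "D > 0" "q\<^sup>2 = D + 1" "q < D + 1" "2 * q \<le> D + 1"
      using q_sq_gt by (auto simp: D_def power2_eq_square)
  qed
  have uR: "u \<le> R" using card_base_points_le by (simp add: u_def R_def)
  obtain A p b b' where b': "U.orthonormal n b'" and "H.orthonormal n b"
    and A: "A \<in> carrier_mat (n + 1) n" "p \<in> carrier_vec (n + 1)"
    and bij: "bij_betw (\<lambda>(x, t). A *\<^sub>v x + t \<cdot>\<^sub>v p) (carrier_vec n \<times> UNIV) (carrier_vec (n + 1))"
    and hA: "\<And>x t. x \<in> carrier_vec n \<Longrightarrow> H.h (A *\<^sub>v x + t \<cdot>\<^sub>v p) = U.h x"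
    by (rule coordinates) (rule that)
  obtain c where c: "\<And>i. i \<le> d \<Longrightarrow> homogeneous n (d - i) (c i)"
    "\<And>x t. x \<in> carrier_vec n \<Longrightarrow> f (A *\<^sub>v x + t \<cdot>\<^sub>v p) = (\<Sum>i\<le>d. c i x * t ^ i)"
    using homogeneous_expand[OF f A] by blast
  let ?Z = "{x \<in> carrier_vec n. U.h x = 0}"
  let ?T = "\<lambda>x. {t. (\<Sum>i\<le>d. c i x * t ^ i) = 0}"
  let ?g = "\<lambda>(x, t). A *\<^sub>v x + t \<cdot>\<^sub>v p"
  have img: "?g ` (carrier_vec n \<times> UNIV) = carrier_vec (n + 1)" using bij by (simp add: bij_betw_def)
  have "bij_betw ?g (SIGMA x:?Z. ?T x) {y \<in> carrier_vec (n + 1). H.h y = 0 \<and> f y = 0}"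
  proof (rule bij_betw_subset[OF bij])
    show "?g ` (SIGMA x:?Z. ?T x) = {y \<in> carrier_vec (n + 1). H.h y = 0 \<and> f y = 0}"
      unfolding img[symmetric] using hA c(2) by (fastforce simp: image_iff)
  qed auto
  then have "card {y \<in> carrier_vec (n + 1). H.h y = 0 \<and> f y = 0} = card (SIGMA x:?Z. ?T x)"
    by (rule bij_betw_same_card[symmetric])
  also have "\<dots> = (\<Sum>x\<in>?Z. card (?T x))"
    by (rule card_SigmaI) auto
  finally have count: "1 + D * r = (\<Sum>x\<in>?Z. card (?T x))"
    unfolding D_def r_def using H.card_section[OF refl f d(1)] by simp
  have Z: "card ?Z = 1 + D * u"
    unfolding D_def u_def by (rule card_base_vectors)
  let ?E = "{i. i \<le> d \<and> (\<exists>x\<in>carrier_vec n. c i x \<noteq> 0)}"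
  obtain xt where xt: "fst xt \<in> carrier_vec n" "v = A *\<^sub>v fst xt + snd xt \<cdot>\<^sub>v p"
    using v(1) unfolding img[symmetric] by force
  \<comment> \<open>If all coefficients vanished identically, f would vanish at v.\<close>
  have "?E \<noteq> {}"
  proof
    assume "?E = {}"
    then have "(\<Sum>i\<le>d. c i (fst xt) * snd xt ^ i) = 0" using xt(1) by (intro sum.neutral) auto
    then show False using c(2)[OF xt(1)] v(2) xt(2) by simp
  qed
  define e where "e = Max ?E"
  have "e \<in> ?E" unfolding e_def using \<open>?E \<noteq> {}\<close> by (intro Max_in) auto
  then obtain x0 where e: "e \<le> d" and x0: "x0 \<in> carrier_vec n" "c e x0 \<noteq> 0" by blast
  have high: "c i x = 0" if "e < i" "i \<le> d" "x \<in> carrier_vec n" for i x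
  proof (rule ccontr)
    assume "c i x \<noteq> 0"
    then have "i \<le> e" unfolding e_def using that by (intro Max_ge) auto
    then show False using that by simp
  qed
  have g: "homogeneous n (d - e) (c e)" by (rule c(1)[OF e])
  let ?A = "{x \<in> carrier_vec n. U.h x = 0 \<and> c e x = 0}"
  have T: "card (?T x) \<le> e" if x: "x \<in> ?Z - ?A" for x
  proof -
    have "(\<Sum>i\<le>d. c i x * t ^ i) = (\<Sum>i\<le>e. c i x * t ^ i)" for t
      using e x high by (intro sum.mono_neutral_right) auto
    then show ?thesis using card_power_sum_roots_le[of e e "\<lambda>i. c i x"] x by auto
  qed
  have "(\<Sum>x\<in>?Z. card (?T x)) = (\<Sum>x\<in>?Z - ?A. card (?T x)) + (\<Sum>x\<in>?A. card (?T x))"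
    by (rule sum.subset_diff) auto
  \<comment> \<open>Over a zero of the leading coefficient the whole line of q^2 scalars is
    conceded, including over x = 0 when e < d.\<close>
  also have "\<dots> \<le> (\<Sum>x\<in>?Z - ?A. e) + (\<Sum>x\<in>?A. q\<^sup>2)"
  proof (intro add_mono sum_mono T)
    fix x show "card (?T x) \<le> q\<^sup>2"
      unfolding card_field[symmetric] by (rule card_mono) auto
  qed
  also have "\<dots> = e * (card ?Z - card ?A) + q\<^sup>2 * card ?A"
    by (subst sum_constant, subst card_Diff_subset) (auto simp: mult.commute)
  finally have bound: "1 + D * r \<le> e * (card ?Z - card ?A) + q\<^sup>2 * card ?A"
    unfolding count .
  have goal: "r \<le> max (u + (d - 1) * R) (1 + q\<^sup>2 * M)"
  proof (cases "e = d")
    case True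
    \<comment> \<open>The leading coefficient has degree d - e = 0, so it is a nonzero constant and
      no line is conceded.\<close>
    have "c e x = c e x0" if "x \<in> carrier_vec n" for x
      using homogeneous_degree_0_const[of n "c e" x x0] g True that x0(1) by simp
    then have "?A = {}" using x0(2) by auto
    then have A0: "card ?A = 0" by (simp only: card.empty)
    have "1 + D * r \<le> d * (1 + D * u)" using bound unfolding Z A0 using True by simp
    then have "D * r \<le> (d - 1) + D * (d * u)"
      using d(1) by (simp add: algebra_simps)
    moreover have "d - 1 < D" using d D by linarith
    ultimately have "r \<le> d * u" by (rule mult_le_cancel_remainder)
    also have "d * u = u + (d - 1) * u" using d(1) by (cases d) auto
    also have "\<dots> \<le> u + (d - 1) * R" using uR by simp
    finally show ?thesis by simp
  next
    case False
    with e have ed: "e < d" by simp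
    define a where "a = card {x \<in> base_points. c e x = 0}"
    have A: "card ?A = 1 + D * a"
      unfolding a_def D_def using U.card_section[OF n_eq g] ed by simp
    have "a \<le> u" unfolding a_def u_def
      by (rule card_mono[OF finite_base_points]) auto
    then have "1 + D * r \<le> e * (D * (u - a)) + (D + 1) * (1 + D * a)"
      using bound unfolding Z A D(2) by (simp add: diff_mult_distrib2)
    \<comment> \<open>The line over the zero vector contributes D nonzero vectors, which form one
      point, the vertex; this is the inner 1.\<close>
    also have "\<dots> = 1 + D * (1 + e * (u - a) + (D + 1) * a)" by (simp add: algebra_simps)
    finally have "D * r \<le> D * (1 + e * (u - a) + (D + 1) * a)" by (simp only: add_le_cancel_left)
    then have "r \<le> 1 + e * (u - a) + (D + 1) * a" using D(1) by (rule mult_left_le_imp_le)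
    then have r: "r \<le> 1 + e * (u - a) + q\<^sup>2 * a" by (simp only: D(2))
    note base = base_points_subset(2)
    show ?thesis
    proof (cases "e = 0")
      case True
      have "homogeneous (n - 1 + 1) d (c e)" "x0 \<in> carrier_vec (n - 1 + 1)"
        using g x0(1) True by (simp_all only: n_eq[symmetric] diff_zero)
      then have "a \<le> M" unfolding a_def M_def using x0(2) base by (rule max_section_ge)
      then have "q\<^sup>2 * a \<le> q\<^sup>2 * M" by simp
      moreover have "r \<le> 1 + q\<^sup>2 * a" using r True by simp
      ultimately have "r \<le> 1 + q\<^sup>2 * M" by linarith
      then show ?thesis by simp
    next
      case e0: False
      define k where "k = d - e"
      note gk = g[folded k_def]
      have k: "1 \<le> k" "k \<le> q" "e + k = d" using ed d by (auto simp: k_def)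
      show ?thesis
      proof (cases "n = 2")
        case True
        have "D * card {x \<in> carrier_vec n. c e x = 0} \<le> k * ((q\<^sup>2) ^ n - 1)"
          unfolding D_def by (rule card_homogeneous_zeros_le[OF gk x0])
        also have "(q\<^sup>2) ^ n - 1 = D * (D + 2)"
          unfolding True D(2) by (simp add: power2_eq_square algebra_simps)
        also have "k * (D * (D + 2)) = D * (k * (D + 2))" by (rule mult.left_commute)
        finally have "card {x \<in> carrier_vec n. c e x = 0} \<le> k * (D + 2)"
          using D(1) by (rule mult_left_le_imp_le)
        moreover have "card ?A \<le> card {x \<in> carrier_vec n. c e x = 0}" by (rule card_mono) auto
        ultimately have "D * a \<le> (2 * k - 1) + D * k" unfolding A by (simp add: algebra_simps)
        \<comment> \<open>Since e >= 1, k is at most q - 1, so the remainder is at most 2q - 3 < q^2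
          - 1.\<close>
        moreover have "2 * k - 1 < D" using k e0 d D by linarith
        ultimately have ak: "a \<le> k" by (rule mult_le_cancel_remainder)
        have u: "u = q + 1" unfolding u_def by (rule card_base_points_line[OF True])
        have dM: "d \<le> M" unfolding M_def by (rule line_max_section_ge[OF True d(2)])
        \<comment> \<open>A crude estimate is enough here: replacing the factor u - a by q^2 gives
          q^2 (e + k) = q^2 d, which M >= d covers.\<close>
        have eu: "e * (u - a) + q\<^sup>2 * a \<le> e * q\<^sup>2 + q\<^sup>2 * k"
          using u D ak by (intro add_mono mult_le_mono2) auto
        also have "e * q\<^sup>2 + q\<^sup>2 * k = q\<^sup>2 * (e + k)" by (simp add: algebra_simps)
        also have "e + k = d" by (rule k(3))
        also have "q\<^sup>2 * d \<le> q\<^sup>2 * M" using dM by simp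
        finally show ?thesis using r by simp
      next
        case False
        then have n3: "n \<ge> 3" using n_ge_2 by simp
        have "card ?A \<le> k * (q + 1) * q ^ (2 * (n - 2))"
          by (rule U.card_isotropic_zeros_le[OF U.orthonormal_mono[OF b' n3] gk k(2) x0])
        also have "2 * (n - 2) = 2 * n - 4" by simp
        finally have DaR: "1 + D * a \<le> k * R" unfolding A R_def by (simp only: mult.assoc)
        \<comment> \<open>As e >= 1, the saving e a pays for the difference between q^2 a and D a.
          The surplus 1 is then part of the bound for 1 + D a.\<close>
        have "e * (u - a) + q\<^sup>2 * a \<le> e * u + D * a"
        proof -
          have "e * (u - a) + e * a = e * u" using \<open>a \<le> u\<close> by (simp flip: distrib_left)
          moreover have "a \<le> e * a" using e0 by simp
          moreover have "q\<^sup>2 * a = D * a + a" unfolding D(2) by simp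
          ultimately show ?thesis by linarith
        qed
        then have "r \<le> e * u + k * R" using r DaR by linarith
        also have "e * u = u + (e - 1) * u" using e0 by (cases e) auto
        also have "u + (e - 1) * u + k * R \<le> u + ((e - 1) * R + k * R)"
          using uR by simp
        also have "(e - 1) * R + k * R = (d - 1) * R"
          using e0 k(3) by (simp flip: add_mult_distrib)
        finally show ?thesis by simp
      qed
    qed
  qed
  then show ?thesis
    unfolding r_def u_def M_def R_def by (simp only: mult.assoc)
qed

text \<open>Gives injectivity of evaluation: for d <= q a nonzero form is nonzero at some isotropic
  vector of the cone.\<close>

lemma form_nonvanishing_cone:
  assumes F: "F \<in> forms n d" "F \<noteq> 0" and d: "1 \<le> d" "d \<le> q"
  obtains x where "x \<in> cone_points" "eval_form F x \<noteq> (0 :: 'a)"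
proof -
  have "d < card (UNIV :: 'a set)" using d q_sq_gt by (simp add: card_field)
  then obtain v where v: "v \<in> carrier_vec (n + 1)" "eval_form F v \<noteq> 0"
    using form_nonvanishing[OF F] by blast
  have hom: "homogeneous (n + 1) d (eval_form F)" by (rule homogeneous_eval_form[OF F(1)])
  obtain A p b b' where b: "H.orthonormal n b"
    and "U.orthonormal n b'" "A \<in> carrier_mat (n + 1) n" "p \<in> carrier_vec (n + 1)"
    "bij_betw (\<lambda>(x, t). A *\<^sub>v x + t \<cdot>\<^sub>v p) (carrier_vec n \<times> UNIV) (carrier_vec (n + 1))"
    "\<And>x t. x \<in> carrier_vec n \<Longrightarrow> H.h (A *\<^sub>v x + t \<cdot>\<^sub>v p) = U.h x"
    by (rule coordinates) (rule that)
  obtain w where w: "w \<in> carrier_vec (n + 1)" "H.h w = 0" "eval_form F w \<noteq> 0"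
    using H.isotropic_nonvanishing[OF H.orthonormal_mono[OF b n_ge_2] hom d(2) v] by blast
  have "\<exists>x\<in>cone_points. eval_form F x \<noteq> 0"
  proof (rule ccontr)
    assume "\<not> ?thesis"
    then have "{x \<in> cone_points. eval_form F x = 0} = cone_points" by auto
    \<comment> \<open>Instead of normalizing w, vectors are counted: if F vanished at all points of
      the cone, the isotropic zeros of F would be as numerous as the isotropic vectors.\<close>
    then have "card {x \<in> carrier_vec (n + 1). H.h x = 0 \<and> eval_form F x = 0} = card {x \<in> carrier_vec (n + 1). H.h x = 0}"
      using H.card_section[OF refl hom d(1)] H.card_isotropic[OF refl] by simp
    then have "{x \<in> carrier_vec (n + 1). H.h x = 0 \<and> eval_form F x = 0} = {x \<in> carrier_vec (n + 1). H.h x = 0}"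
      by (intro card_subset_eq) auto
    then show False using w by blast
  qed
  then show ?thesis using that by blast
qed

end

section \<open>The functional code\<close>

lemma subspace_functional_code:
  fixes Ps :: "'a::field vec list"
  assumes "set Ps \<subseteq> carrier_vec (n + 1)"
  shows "subspace class_ring (functional_code n d Ps) (module_vec TYPE('a) (length Ps))"
proof -
  interpret V: vec_space "TYPE('a)" "length Ps" .
  let ?c = "\<lambda>F. vec (length Ps) (\<lambda>i. eval_form F (Ps ! i))"
  have "submodule class_ring (functional_code n d Ps) (module_vec TYPE('a) (length Ps))"
  proof
    show "functional_code n d Ps \<subseteq> carrier (module_vec TYPE('a) (length Ps))"
      by (auto simp: functional_code_def)
  next
    fix v w assume "v \<in> functional_code n d Ps" "w \<in> functional_code n d Ps"
    then obtain F G where FG: "F \<in> forms n d" "v = ?c F" "G \<in> forms n d" "w = ?c G"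
      by (auto simp: functional_code_def)
    have "v + w = ?c (F + G)" by (rule eq_vecI) (auto simp: FG eval_form_add)
    then show "v \<oplus>\<^bsub>module_vec TYPE('a) (length Ps)\<^esub> w \<in> functional_code n d Ps"
      using forms_add[OF FG(1,3)] by (simp add: functional_code_def)
  next
    have "0\<^sub>v (length Ps) = ?c 0" by (rule eq_vecI) auto
    then have "0\<^sub>v (length Ps) \<in> functional_code n d Ps"
      unfolding functional_code_def by (rule image_eqI) simp
    then show "\<zero>\<^bsub>module_vec TYPE('a) (length Ps)\<^esub> \<in> functional_code n d Ps"
      by simp
  next
    fix c :: 'a and v assume "v \<in> functional_code n d Ps"
    then obtain F where F: "F \<in> forms n d" "v = ?c F" by (auto simp: functional_code_def)
    \<comment> \<open>The scalar multiple is formed as a homogeneous function and then represented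
      by a form, which agrees with it on the points of the list.\<close>
    obtain G where G: "G \<in> forms n d" "\<And>x. x \<in> carrier_vec (n + 1) \<Longrightarrow> c * eval_form F x = eval_form G x"
      using homogeneous_imp_form[OF homogeneous_smult[OF homogeneous_eval_form[OF F(1)]]] by blast
    have "c \<cdot>\<^sub>v v = ?c G"
    proof (rule eq_vecI)
      fix i assume i: "i < dim_vec (?c G)"
      then have "Ps ! i \<in> carrier_vec (n + 1)" using assms by auto
      then show "(c \<cdot>\<^sub>v v) $ i = ?c G $ i" using i G(2) by (simp add: F)
    qed (simp add: F)
    then show "c \<odot>\<^bsub>module_vec TYPE('a) (length Ps)\<^esub> v \<in> functional_code n d Ps"
      using G(1) by (simp add: functional_code_def)
  qed
  then show ?thesis using V.vectorspace_axioms by (simp add: subspace_def)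
qed

lemma card_zeros_list:
  assumes "distinct Ps"
  shows "card {i. i < length Ps \<and> P (Ps ! i)} = card {x \<in> set Ps. P x}"
proof -
  have "bij_betw (\<lambda>i. Ps ! i) {i. i < length Ps \<and> P (Ps ! i)} {x \<in> set Ps. P x}"
    using assms by (auto simp: bij_betw_def inj_on_def nth_eq_iff_index_eq in_set_conv_nth image_iff)
  then show ?thesis by (rule bij_betw_same_card)
qed

context hermitian_cone
begin

context
  fixes d :: nat and Ps :: "'a vec list"
  assumes d: "1 \<le> d" "d \<le> q" and Ps: "distinct Ps" "set Ps = cone_points"
begin

lemma length_points: "length Ps = card cone_points"
  using distinct_card[OF Ps(1)] Ps(2) by simp

lemma cone_points_carrier: "set Ps \<subseteq> carrier_vec (n + 1)"
  unfolding Ps(2) cone_points_eq by auto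

text \<open>Two forms with the same codeword differ by a form vanishing on the whole cone, which
  must be 0.\<close>

lemma card_functional_code:
  "card (functional_code n d Ps) = card (UNIV :: 'a set) ^ ((n + d) choose d)"
proof -
  let ?c = "\<lambda>F. vec (length Ps) (\<lambda>i. eval_form F (Ps ! i))"
  have "inj_on ?c (forms n d)"
  proof (rule inj_onI, rule ccontr)
    fix F G :: "'a mpoly" assume FG: "F \<in> forms n d" "G \<in> forms n d" "?c F = ?c G" "F \<noteq> G"
    then obtain x where x: "x \<in> cone_points" "eval_form (F - G) x \<noteq> 0"
      using form_nonvanishing_cone[OF forms_diff[OF FG(1,2)] _ d] by auto
    then obtain i where i: "i < length Ps" "x = Ps ! i" using Ps(2) by (metis in_set_conv_nth)
    then have "?c F $ i = ?c G $ i" using FG(3) by simp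
    then show False using x(2) i by (simp add: eval_form_diff)
  qed
  then show ?thesis
    unfolding functional_code_def by (simp add: card_image card_forms)
qed

lemma code_dim_functional_code: "code_dim (length Ps) (functional_code n d Ps) = (n + d) choose d"
proof -
  have "card (UNIV :: 'a set) ^ code_dim (length Ps) (functional_code n d Ps) = card (UNIV :: 'a set) ^ ((n + d) choose d)"
    unfolding card_functional_code[symmetric] code_dim_def
    by (rule card_subspace[OF subspace_functional_code[OF cone_points_carrier], symmetric])
  then show ?thesis using q_sq_gt(2) by (simp only: card_field power_inject_exp)
qed

lemma min_distance_functional_code:
  "int (min_distance (functional_code n d Ps)) \<ge> int (card cone_points) -
    int (max (card base_points + (d - 1) * (q + 1) * q ^ (2 * n - 4))
             (1 + q\<^sup>2 * max_section (n - 1) d (hermitian_variety q (n - 1) U)))"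
proof -
  let ?C = "functional_code n d Ps"
  let ?W = "{hamming_weight c | c. c \<in> ?C \<and> c \<noteq> 0\<^sub>v (dim_vec c)}"
  \<comment> \<open>A nonzero codeword exists, so \<open>Min\<close> in \<open>min_distance\<close>
    is taken over a nonempty set and is attained. Its weight is the number of points outside the
    zeros of a form.\<close>
  have "card ?C > 1"
    unfolding card_functional_code card_field by (rule one_less_power[OF q_sq_gt(2)]) simp
  then have "\<not> ?C \<subseteq> {0\<^sub>v (length Ps)}"
    using card_mono[of "{0\<^sub>v (length Ps) :: 'a vec}" ?C] by auto
  then obtain c where "c \<in> ?C" "c \<noteq> 0\<^sub>v (length Ps)" by blast
  moreover from this have "dim_vec c = length Ps" by (auto simp: functional_code_def)
  ultimately have "?W \<noteq> {}" by auto
  moreover have "?C \<subseteq> carrier_vec (length Ps)" by (auto simp: functional_code_def)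
  then have "finite ?C" using finite_carrier_vec by (rule finite_subset)
  then have "finite ?W" by (simp add: setcompr_eq_image)
  ultimately have "min_distance ?C \<in> ?W" unfolding min_distance_def by (rule Min_in[rotated])
  then obtain c where c: "min_distance ?C = hamming_weight c" "c \<in> ?C" "c \<noteq> 0\<^sub>v (dim_vec c)" by blast
  then obtain F where F: "F \<in> forms n d" "c = vec (length Ps) (\<lambda>i. eval_form F (Ps ! i))"
    by (auto simp: functional_code_def)
  have "\<exists>i<length Ps. c $ i \<noteq> 0"
  proof (rule ccontr)
    assume "\<not> ?thesis"
    then have "c = 0\<^sub>v (dim_vec c)" by (intro eq_vecI) (auto simp: F(2))
    then show False using c(3) by simp
  qed
  then obtain i where "i < length Ps" "eval_form F (Ps ! i) \<noteq> 0" by (auto simp: F(2))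
  then have v: "Ps ! i \<in> carrier_vec (n + 1)" "eval_form F (Ps ! i) \<noteq> 0"
    using cone_points_carrier by auto
  have "hamming_weight c = card {i. i < length Ps \<and> eval_form F (Ps ! i) \<noteq> 0}"
    unfolding hamming_weight_def F(2) by (rule arg_cong[of _ _ card]) auto
  also have "\<dots> = card {x \<in> set Ps. eval_form F x \<noteq> 0}"
    by (rule card_zeros_list[OF Ps(1)])
  also have "{x \<in> set Ps. eval_form F x \<noteq> 0} = set Ps - {x \<in> cone_points. eval_form F x = 0}"
    unfolding Ps(2) by auto
  also have "card \<dots> = card cone_points - card {x \<in> cone_points. eval_form F x = 0}"
    unfolding Ps(2)[symmetric] by (rule card_Diff_subset) auto
  finally have "int (hamming_weight c) \<ge> int (card cone_points) - int (card {x \<in> cone_points. eval_form F x = 0})"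
    by linarith
  moreover have "int (card {x \<in> cone_points. eval_form F x = 0}) \<le>
      int (max (card base_points + (d - 1) * (q + 1) * q ^ (2 * n - 4))
             (1 + q\<^sup>2 * max_section (n - 1) d (hermitian_variety q (n - 1) U)))"
    unfolding of_nat_le_iff
    by (rule card_form_cone_points_le[OF d homogeneous_eval_form[OF F(1)] v])
  ultimately show ?thesis unfolding c(1) by linarith
qed

end

lemma real_card_cone_points:
  "real (card cone_points) = 1 + (real q)\<^sup>2 *
    ((real q ^ (n - 1) - (-1) ^ (n - 1)) * (real q ^ n - (-1) ^ n) / ((real q)\<^sup>2 - 1))"
proof -
  define Q where "Q = real q"
  define u where "u = real (card base_points)"
  obtain k where k: "n = Suc k" using n_ge_2 by (cases n) auto
  have Q: "Q \<ge> 2" using q_ge_2 by (simp add: Q_def)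
  have "1 < Q\<^sup>2" using Q by (intro one_less_power) auto
  then have D: "Q\<^sup>2 - 1 \<noteq> 0" by simp
  have "real_of_int (int q * (1 + (int q ^ 2 - 1) * int (card base_points))) =
      real_of_int (int q ^ (2 * n) + (- 1) ^ n * (int q ^ Suc n - int q ^ n))"
    by (rule arg_cong[OF card_base_points])
  then have "Q * (1 + (Q\<^sup>2 - 1) * u) = Q ^ (2 * n) + (- 1) ^ n * (Q ^ Suc n - Q ^ n)"
    by (simp add: Q_def u_def)
  also have "\<dots> = Q * (Q ^ (2 * k + 1) - (- 1) ^ k * (Q ^ n - Q ^ k))"
    unfolding k by (simp add: algebra_simps)
  finally have "1 + (Q\<^sup>2 - 1) * u = Q ^ (2 * k + 1) - (- 1) ^ k * (Q ^ n - Q ^ k)"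
    using Q by simp
  moreover have "(Q ^ k - (- 1) ^ k) * (Q ^ n - (- 1) ^ n) = Q ^ (2 * k + 1) - (- 1) ^ k * (Q ^ n - Q ^ k) - 1"
  proof -
    \<comment> \<open>With n = k + 1, (-1)^n is - s; the factorization then uses only s * s =
      1.\<close>
    define P s where "P = Q ^ k" and "s = (- 1 :: real) ^ k"
    have "s * s = 1" by (simp add: s_def flip: power_mult_distrib)
    moreover have "Q ^ (2 * k) = P * P" by (simp add: P_def mult_2 power_add)
    moreover have "(P - s) * (Q * P + s) = Q * (P * P) - s * (Q * P - P) - s * s"
      by (simp add: algebra_simps)
    ultimately show ?thesis unfolding k by (simp add: P_def s_def)
  qed
  ultimately have "(Q\<^sup>2 - 1) * u = (Q ^ k - (- 1) ^ k) * (Q ^ n - (- 1) ^ n)" by simp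
  then have "u = (Q ^ k - (- 1) ^ k) * (Q ^ n - (- 1) ^ n) / (Q\<^sup>2 - 1)"
    using D by (simp add: field_simps)
  then show ?thesis
    unfolding card_cone_points by (simp add: k u_def Q_def)
qed

end

theorem theorem4p4:
  fixes q n d :: nat
    and H U :: "'a :: {field, finite} mat"
    and Ps :: "'a vec list"
  assumes "primepow q" and "card (UNIV :: 'a set) = q\<^sup>2"
    and "n \<ge> 2" and "1 \<le> d" and "d \<le> q"
    and "hermitian_matrix q n H" and "vec_space.rank (n + 1) H = n"
    and "hermitian_matrix q (n - 1) U" and "vec_space.rank n U = n"
    and "distinct Ps" and "set Ps = rational_points (hermitian_variety q n H)"
  defines "m \<equiv> card (rational_points (hermitian_variety q n H))"
    and "u \<equiv> card (rational_points (hermitian_variety q (n - 1) U))"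
    and "M \<equiv> max_section (n - 1) d (hermitian_variety q (n - 1) U)"
    and "C \<equiv> functional_code n d Ps"
  shows "linear_code m C \<and>
    real m = 1 + (real q)\<^sup>2 *
      ((real q ^ (n - 1) - (-1) ^ (n - 1)) * (real q ^ n - (-1) ^ n) / ((real q)\<^sup>2 - 1)) \<and>
    code_dim m C = (n + d) choose d \<and>
    int (min_distance C) \<ge>
      int m - int (max (u + (d - 1) * (q + 1) * q ^ (2 * n - 4)) (1 + q\<^sup>2 * M))"
proof -
  interpret hermitian_cone q "TYPE('a)" n H U
    using assms(1-9) by unfold_locales
  note prems = assms(4,5,10,11)
  have len: "length Ps = m" unfolding m_def by (rule length_points[OF prems])
  have "linear_code m C"
    unfolding linear_code_def C_def len[symmetric]
    by (rule subspace_functional_code[OF cone_points_carrier[OF prems]])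
  moreover have "code_dim m C = (n + d) choose d"
    unfolding C_def len[symmetric] by (rule code_dim_functional_code[OF prems])
  ultimately show ?thesis
    using real_card_cone_points min_distance_functional_code[OF prems]
    unfolding m_def u_def M_def C_def by blast
qed

end
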